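(* Let $\mathbf G$ be an indexing category, let $([X]\leftarrow[Z']\to[U'])$ be a reduced admissible fan in some tropical $\mathbf{G}$-diagram $[\mathcal{Z}']$, and let $\lambda>0$. Let $[\mathcal{X}]$ be the subdiagram of $[\mathcal Z']$ formed by $[X]$ and all its descendants (with all morphisms between them). Then there exists a tropical $\mathbf{G}$-diagram $[\mathcal{Z}]$ containing the copy of $[\mathcal{X}]$ (at the same indices), such that the corresponding admissible fan $([X]\leftarrow[Z]\to[U])$ in $[\mathcal Z]$ (at the same indices as the original fan) satisfies $$[Z\,|\,X]=\lambda\qquad\text{and}\qquad[\mathcal{X}\,|\,U]=[\mathcal{X}\,|\,U'].$$
   Context: **Probability spaces.** A finite probability space $X$ is a set with a probability measure supported on a finite set; $|X|$ is the number of atoms of positive weight, $x\in X$ means $x$ is an atom of positive weight, and $\mathrm{Ent}(X)$ is the Shannon entropy (natural logarithm). A morphism (reduction) $X\to Y$ is an equivalence class of measure-preserving maps, two maps being equivalent if they agree on a set of full measure. **Indexing categories.** A poset category is a finite category with at most one morphism between any two objects either way. If there is a morphism $k\to l$, then $k$ is an ancestor of $l$ and $l$ a descendant of $k$ (each object is an ancestor and a descendant of itself). An indexing category $\mathbf{G}$ is a poset category such that any two objects $i_1,i_2$ have a least common ancestor $i_3$: $i_3$ is a common ancestor of $i_1,i_2$, and every common ancestor of $i_1,i_2$ is an ancestor of $i_3$. It has a unique initial object, which is an ancestor of every object. **Diagrams.** A $\mathbf{G}$-diagram of probability spaces is a functor $\mathcal{X}=\{X_i;\chi_{ij}\}$ from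 $\mathbf{G}$ to the category of finite probability spaces and reductions; morphisms of $\mathbf{G}$-diagrams are natural transformations. Ancestors, descendants and the initial space of a diagram are understood through the indices. The tensor product $\otimes$ of two $\mathbf{G}$-diagrams is the objectwise independent product. A fan is a pair of morphisms with the same domain, $X\leftarrow Z\to U$. A fan of probability spaces is minimal if, whenever $X\leftarrow W\to U$ is a fan and $Z\to W$ is a morphism compatible with both fans, $Z\to W$ is an isomorphism; equivalently, distinct atoms of $Z$ have distinct images in $X\times U$. A diagram $\mathcal{X}$ is homogeneous if the automorphism group $\mathrm{Aut}(\mathcal X)$ acts transitively on (the atoms of) every space in $\mathcal X$. **Entropy distance.** For a $\mathbf{G}$-diagram, $\mathrm{Ent}_*\mathcal{X}=(\mathrm{Ent}(X_i))_{i}\in\mathbb{R}^{\mathbf{G}}$, with the $\ell^1$-norm on $\mathbb{R}^{\mathbf G}$ (functions on the objects of $\mathbf{G}$). The intrinsic entropy distance is $\mathbf{k}(\mathcal X,\mathcal Y)=\inf\{\|\mathrm{Ent}_*\mathcal Z-\mathrm{Ent}_*\mathcal X\|_1+\|\mathrm{Ent}_*\mathcal Z-\mathrm{Ent}_*\mathcal Y\|_1\}$, the infimum over all fans $\mathcal X\leftarrow\mathcal Z\to\mathcal Y$ of $\mathbf{G}$-diagrams. **Tropical diagrams.** Consider quasi-linear sequences $\bar{\mathcal X}=(\mathcal X(n))_{n}$ of $\mathbf{G}$-diagrams, i.e. sequences for which there is $C>0$ with $\mathbf{k}(\mathcal X(m)\otimes\mathcal X(n),\mathcal X(m+n))\le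 C(m+n)^{3/4}$ for all $m,n\in\mathbb N$. The asymptotic entropy distance is $\boldsymbol\kappa(\bar{\mathcal X},\bar{\mathcal Y})=\lim_{n\to\infty}\frac1n\mathbf{k}(\mathcal X(n),\mathcal Y(n))$. A tropical $\mathbf G$-diagram $[\mathcal X]$ is an equivalence class of such sequences, where sequences at distance $\boldsymbol\kappa=0$ are identified; equality of tropical diagrams means equality of classes. Spaces and subdiagrams of a tropical diagram are obtained by taking the corresponding ones termwise. The space of tropical $\mathbf G$-diagrams is complete for $\boldsymbol\kappa$, and the classes representable by quasi-linear sequences of homogeneous diagrams (tropical homogeneous diagrams) are dense in it. The entropy of a tropical space is $[X]:=\lim_n\frac1n\mathrm{Ent}(X(n))$, and tropical probability spaces are identified with nonnegative reals via entropy. For a reduction $[Z]\to[X]$ in a tropical diagram, $[Z\,|\,X]:=[Z]-[X]$; the reduction is an isomorphism of tropical spaces when $[Z\,|\,X]=0$. **Conditioning.** If a diagram $\mathcal X=\{X_i\}$ and a space $U$ are both contained in a diagram $\mathcal Z$ with initial space $Z_0$, then for $u\in U$ the diagram $\mathcal X\,|\,u$ consists of the spaces $X_i\,|\,u$, where $X_i\,|\,u$ carries the conditional distribution of $X_i$ given $u$ (the push-forward to $X_i$ of the distribution of $Z_0$ conditioned on the fiber over $u$), with the induced maps. For tropical homogeneous $[\mathcal Z]$ represented by homogeneous $\mathcal Z(n)$, $[\mathcal X\,|\,U]$ is the class of $(\mathcal X(n)\,|\,u_n)$, with $u_n\in U(n)$ arbitrary (up to isomorphism it does not depend on the choice). Conditioning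 is Lipschitz with respect to $\boldsymbol\kappa$ and is extended by continuity to all tropical diagrams. **Admissible and reduced fans.** An admissible fan in a $\mathbf G$-diagram $\mathcal Z$ is a minimal fan $X\leftarrow Z\to U$ of spaces in $\mathcal Z$ such that $Z$ is the initial space of $\mathcal Z$ and any space of $\mathcal Z$ belongs either to the set of descendants of $X$ or to the set of ancestors of $U$ (exactly one of the two). The same definition is used for tropical diagrams, where a fan is minimal if the diagram can be represented by a sequence whose corresponding fans are minimal. An admissible fan is reduced if the morphism $Z\to X$ is an isomorphism. *)

theory Defs
  imports "HOL-Probability.Probability_Mass_Function" "HOL-Library.Nat_Bijection"
begin

section \<open>Finite probability spaces\<close>

text \<open>
  A finite probability space is a \<^typ>\<open>nat pmf\<close> of finite support; its atoms are the elements of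
  \<^const>\<open>set_pmf\<close>. Every finite probability space is isomorphic to one of this form, so nothing is
  lost by fixing \<^typ>\<open>nat\<close> as the ambient set. A reduction is represented by a function; functions
  that agree on all atoms of the domain represent the same reduction, so every equation between
  reductions below is required on atoms only.
\<close>

definition reduction :: "nat pmf \<Rightarrow> nat pmf \<Rightarrow> (nat \<Rightarrow> nat) \<Rightarrow> bool" where
  "reduction X Y f \<longleftrightarrow> map_pmf f X = Y"

definition iso_reduction :: "nat pmf \<Rightarrow> nat pmf \<Rightarrow> (nat \<Rightarrow> nat) \<Rightarrow> bool" where
  "iso_reduction X Y f \<longleftrightarrow> reduction X Y f \<and>
     (\<exists>g. reduction Y X g \<and> (\<forall>a\<in>set_pmf X. g (f a) = a) \<and> (\<forall>b\<in>set_pmf Y. f (g b) = b))"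

definition Ent :: "nat pmf \<Rightarrow> real" where
  "Ent X = - (\<Sum>a\<in>set_pmf X. pmf X a * ln (pmf X a))"

definition minimal_fan ::
  "nat pmf \<Rightarrow> nat pmf \<Rightarrow> nat pmf \<Rightarrow> (nat \<Rightarrow> nat) \<Rightarrow> (nat \<Rightarrow> nat) \<Rightarrow> bool" where
  "minimal_fan Z X U f g \<longleftrightarrow> reduction Z X f \<and> reduction Z U g \<and>
     (\<forall>W p q h. finite (set_pmf W) \<and> reduction W X p \<and> reduction W U q \<and> reduction Z W h \<and>
        (\<forall>a\<in>set_pmf Z. p (h a) = f a \<and> q (h a) = g a) \<longrightarrow> iso_reduction Z W h)"


section \<open>Indexing categories\<close>

text \<open>
  A poset category is encoded by its relation: \<open>(k, l) \<in> G\<close> means that there is a morphism from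
  \<open>k\<close> to \<open>l\<close>, so that \<open>k\<close> is an ancestor of \<open>l\<close>. The objects are the elements of \<open>Field G\<close>.
\<close>

definition indexing_category :: "'i rel \<Rightarrow> bool" where
  "indexing_category G \<longleftrightarrow> finite (Field G) \<and> Field G \<noteq> {} \<and> Partial_order G \<and>
     (\<forall>i\<in>Field G. \<forall>j\<in>Field G. \<exists>k. (k, i) \<in> G \<and> (k, j) \<in> G \<and>
        (\<forall>l. (l, i) \<in> G \<and> (l, j) \<in> G \<longrightarrow> (l, k) \<in> G))"

definition initial :: "'i rel \<Rightarrow> 'i \<Rightarrow> bool" where
  "initial G z \<longleftrightarrow> z \<in> Field G \<and> (\<forall>i\<in>Field G. (z, i) \<in> G)"

definition initial_object :: "'i rel \<Rightarrow> 'i" where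
  "initial_object G = (THE z. initial G z)"

definition descendants :: "'i rel \<Rightarrow> 'i \<Rightarrow> 'i set" where
  "descendants G i = {j. (i, j) \<in> G}"


section \<open>Diagrams\<close>

text \<open>
  Only the components at objects and morphisms of \<open>G\<close> matter. In particular the subdiagram on a set
  \<open>S\<close> of objects is the same record, regarded as a diagram over \<open>Restr G S\<close>.
\<close>

record 'i diagram =
  sp :: "'i \<Rightarrow> nat pmf"
  red :: "'i \<Rightarrow> 'i \<Rightarrow> nat \<Rightarrow> nat"

definition is_diagram :: "'i rel \<Rightarrow> 'i diagram \<Rightarrow> bool" where
  "is_diagram G X \<longleftrightarrow>
     (\<forall>i\<in>Field G. finite (set_pmf (sp X i))) \<and>
     (\<forall>(i, j)\<in>G. reduction (sp X i) (sp X j) (red X i j)) \<and>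
     (\<forall>i\<in>Field G. \<forall>a\<in>set_pmf (sp X i). red X i i a = a) \<and>
     (\<forall>i j k. (i, j) \<in> G \<and> (j, k) \<in> G \<longrightarrow>
        (\<forall>a\<in>set_pmf (sp X i). red X j k (red X i j a) = red X i k a))"

definition diagram_mor :: "'i rel \<Rightarrow> 'i diagram \<Rightarrow> 'i diagram \<Rightarrow> ('i \<Rightarrow> nat \<Rightarrow> nat) \<Rightarrow> bool" where
  "diagram_mor G X Y f \<longleftrightarrow>
     (\<forall>i\<in>Field G. reduction (sp X i) (sp Y i) (f i)) \<and>
     (\<forall>(i, j)\<in>G. \<forall>a\<in>set_pmf (sp X i). f j (red X i j a) = red Y i j (f i a))"

definition diagram_aut :: "'i rel \<Rightarrow> 'i diagram \<Rightarrow> ('i \<Rightarrow> nat \<Rightarrow> nat) \<Rightarrow> bool" where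
  "diagram_aut G X f \<longleftrightarrow> diagram_mor G X X f \<and>
     (\<exists>g. diagram_mor G X X g \<and>
        (\<forall>i\<in>Field G. \<forall>a\<in>set_pmf (sp X i). g i (f i a) = a \<and> f i (g i a) = a))"

definition homogeneous :: "'i rel \<Rightarrow> 'i diagram \<Rightarrow> bool" where
  "homogeneous G X \<longleftrightarrow> (\<forall>i\<in>Field G. \<forall>a\<in>set_pmf (sp X i). \<forall>b\<in>set_pmf (sp X i).
     \<exists>f. diagram_aut G X f \<and> f i a = b)"

definition tensor :: "'i diagram \<Rightarrow> 'i diagram \<Rightarrow> 'i diagram" where
  "tensor X Y =
     \<lparr> sp = (\<lambda>i. map_pmf prod_encode (pair_pmf (sp X i) (sp Y i))),
       red = (\<lambda>i j. prod_encode \<circ> map_prod (red X i j) (red Y i j) \<circ> prod_decode) \<rparr>"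

definition ent_diff :: "'i rel \<Rightarrow> 'i diagram \<Rightarrow> 'i diagram \<Rightarrow> real" where
  "ent_diff G X Y = (\<Sum>i\<in>Field G. \<bar>Ent (sp X i) - Ent (sp Y i)\<bar>)"

definition entropy_dist :: "'i rel \<Rightarrow> 'i diagram \<Rightarrow> 'i diagram \<Rightarrow> real" where
  "entropy_dist G X Y = Inf {ent_diff G Z X + ent_diff G Z Y | Z f g.
     is_diagram G Z \<and> diagram_mor G Z X f \<and> diagram_mor G Z Y g}"

text \<open>
  The spaces at indices in \<open>S\<close>, conditioned on the atom \<open>a\<close> of the space at index \<open>u\<close>. The diagram
  \<open>Z\<close> is indexed by \<open>G\<close>; the result is to be regarded as a diagram over \<open>Restr G S\<close>, for the
  set \<open>S\<close> of interest.
\<close>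

definition cond_diagram :: "'i rel \<Rightarrow> 'i diagram \<Rightarrow> 'i \<Rightarrow> nat \<Rightarrow> 'i diagram" where
  "cond_diagram G Z u a = (let z = initial_object G in
     \<lparr> sp = (\<lambda>i. map_pmf (red Z z i) (cond_pmf (sp Z z) {c. red Z z u c = a})),
       red = red Z \<rparr>)"


section \<open>Tropical diagrams\<close>

definition quasi_linear :: "'i rel \<Rightarrow> (nat \<Rightarrow> 'i diagram) \<Rightarrow> bool" where
  "quasi_linear G X \<longleftrightarrow> (\<forall>n. is_diagram G (X n)) \<and>
     (\<exists>C>0. \<forall>m n. entropy_dist G (tensor (X m) (X n)) (X (m + n)) \<le> C * real (m + n) powr (3/4))"

definition asym_entropy_dist :: "'i rel \<Rightarrow> (nat \<Rightarrow> 'i diagram) \<Rightarrow> (nat \<Rightarrow> 'i diagram) \<Rightarrow> real" where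
  "asym_entropy_dist G X Y = lim (\<lambda>n. entropy_dist G (X n) (Y n) / real n)"

definition asym_eq :: "'i rel \<Rightarrow> (nat \<Rightarrow> 'i diagram) rel" where
  "asym_eq G = {(X, Y). quasi_linear G X \<and> quasi_linear G Y \<and> asym_entropy_dist G X Y = 0}"

type_synonym 'i tropical = "(nat \<Rightarrow> 'i diagram) set"

definition tropical :: "'i rel \<Rightarrow> 'i tropical set" where
  "tropical G = {X. quasi_linear G X} // asym_eq G"

text \<open>
  Operations on classes are defined on representatives. Where the value is a real number,
  \<^const>\<open>the_elem\<close> picks the common value on all representatives; where it is a class, the image
  under \<^const>\<open>asym_eq\<close> of all values on representatives is their common class.
\<close>

definition trop_dist :: "'i rel \<Rightarrow> 'i tropical \<Rightarrow> 'i tropical \<Rightarrow> real" where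
  "trop_dist G S T = the_elem {asym_entropy_dist G X Y | X Y. X \<in> S \<and> Y \<in> T}"

definition trop_ent :: "'i tropical \<Rightarrow> 'i \<Rightarrow> real" where
  "trop_ent T i = the_elem ((\<lambda>X. lim (\<lambda>n. Ent (sp (X n) i) / real n)) ` T)"

definition trop_cond_ent :: "'i tropical \<Rightarrow> 'i \<Rightarrow> 'i \<Rightarrow> real" where
  "trop_cond_ent T z x = trop_ent T z - trop_ent T x"

definition trop_sub :: "'i rel \<Rightarrow> 'i set \<Rightarrow> 'i tropical \<Rightarrow> 'i tropical" where
  "trop_sub G S T = asym_eq (Restr G S) `` T"

definition tropical_homogeneous :: "'i rel \<Rightarrow> 'i tropical set" where
  "tropical_homogeneous G = {T \<in> tropical G. \<exists>X\<in>T. \<forall>n. homogeneous G (X n)}"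

text \<open>
  Conditioning of the subdiagram on the objects in \<open>S\<close> by the space at index \<open>u\<close>: first for
  homogeneous tropical diagrams, then extended by continuity.
\<close>

definition hom_cond :: "'i rel \<Rightarrow> 'i set \<Rightarrow> 'i \<Rightarrow> 'i tropical \<Rightarrow> 'i tropical" where
  "hom_cond G S u T = asym_eq (Restr G S) ``
     {(\<lambda>n. cond_diagram G (X n) u (a n)) | X a. X \<in> T \<and> (\<forall>n. homogeneous G (X n)) \<and>
        (\<forall>n. a n \<in> set_pmf (sp (X n) u))}"

definition trop_cond :: "'i rel \<Rightarrow> 'i set \<Rightarrow> 'i \<Rightarrow> 'i tropical \<Rightarrow> 'i tropical" where
  "trop_cond G S u T = (THE C. C \<in> tropical (Restr G S) \<and>
     (\<forall>H. (\<forall>k. H k \<in> tropical_homogeneous G) \<and> (\<lambda>k. trop_dist G (H k) T) \<longlonglongrightarrow> 0 \<longrightarrow>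
        (\<lambda>k. trop_dist (Restr G S) (hom_cond G S u (H k)) C) \<longlonglongrightarrow> 0))"


section \<open>Admissible and reduced fans\<close>

text \<open>Fans in a diagram are given by the indices of their spaces, \<open>x \<leftarrow> z \<rightarrow> u\<close>.\<close>

definition trop_minimal_fan :: "'i tropical \<Rightarrow> 'i \<Rightarrow> 'i \<Rightarrow> 'i \<Rightarrow> bool" where
  "trop_minimal_fan T z x u \<longleftrightarrow> (\<exists>X\<in>T. \<forall>n.
     minimal_fan (sp (X n) z) (sp (X n) x) (sp (X n) u) (red (X n) z x) (red (X n) z u))"

definition trop_admissible_fan :: "'i rel \<Rightarrow> 'i tropical \<Rightarrow> 'i \<Rightarrow> 'i \<Rightarrow> 'i \<Rightarrow> bool" where
  "trop_admissible_fan G T z x u \<longleftrightarrow>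
     (z, x) \<in> G \<and> (z, u) \<in> G \<and> trop_minimal_fan T z x u \<and> initial G z \<and>
     (\<forall>i\<in>Field G. ((x, i) \<in> G) \<noteq> ((i, u) \<in> G))"

definition trop_reduced_fan :: "'i tropical \<Rightarrow> 'i \<Rightarrow> 'i \<Rightarrow> bool" where
  "trop_reduced_fan T z x \<longleftrightarrow> trop_cond_ent T z x = 0"

end

theory Submission
  imports Defs "HOL-Combinatorics.Permutations"
begin

text \<open>
  Take a sequence \<open>X\<close> representing the given tropical diagram with minimal fans, and let \<open>C n\<close> be the
  diagram with a uniform space of entropy about \<open>n l\<close> at every ancestor of \<open>u\<close> and a point at every
  descendant of \<open>x\<close>. Tensoring \<open>X n\<close> with \<open>C n\<close> does not change the descendants of \<open>x\<close>, adds \<open>l\<close> to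
  the entropy of the initial space, keeps the fan minimal, and does not affect the conditional spaces,
  the added noise being independent.

  Since conditioning is defined by continuity from homogeneous diagrams, the last point rests on two facts.
  First, conditioning is Lipschitz on homogeneous diagrams: given a coupling of \<open>X\<close> and \<open>Y\<close>, choose a
  typical pair \<open>(a, b)\<close> of atoms of the two conditioning spaces; the spaces \<open>X | (a, b)\<close> and \<open>Y | (a, b)\<close> are
  close, and \<open>X | a\<close> is close to \<open>X | (a, b)\<close> because few random translates of the latter under the
  automorphism group cover the former almost uniformly. Second, homogeneous diagrams are dense: a random
  word over \<open>X N\<close> is close to a random permutation of one typical word.
\<close>

section \<open>Entropy of finitely supported distributions\<close>

text \<open>The obstacle is that \<open>trop_cond\<close> is a description by limits: a class
  \<open>C\<close> is the conditional of \<open>T\<close> when it is the limit of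
  \<open>hom_cond\<close> along every homogeneous sequence tending to \<open>T\<close>. So the noise
  is added to homogeneous approximations of the old class, and the two limit conditions on
  \<open>C\<close> are shown to be equivalent; passing from the old class back to the new one is
  where density and the Lipschitz bound meet. The noise itself rests on two facts: an ancestor of an
  ancestor of \<open>u\<close> is an ancestor of \<open>u\<close>, so noise can be carried along by
  identity maps, and by admissibility no descendant of \<open>x\<close> is an ancestor of
  \<open>u\<close>, so none arrives there. All estimates must fit the defect
  \<open>n powr (3/4)\<close> of quasi-linearity: conditioning costs an additive term of order
  \<open>ln n\<close>, replacing random words by shuffled ones about \<open>sqrt n * ln n\<close>.
  The defect is 0 at \<open>n = 0\<close>, so index 0 demands distance exactly 0 and is treated
  apart.\<close>

definition ent :: "'a pmf \<Rightarrow> real" where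
  "ent p = - (\<Sum>a\<in>set_pmf p. pmf p a * ln (pmf p a))"

text \<open>A sum over the support, so that linearity and monotonicity hold unconditionally; for
  infinite support every value is 0.\<close>

definition expect :: "'a pmf \<Rightarrow> ('a \<Rightarrow> real) \<Rightarrow> real" where
  "expect p f = (\<Sum>a\<in>set_pmf p. pmf p a * f a)"

text \<open>\<open>Ent\<close> is fixed on the naturals; its copy \<open>ent\<close> at every type
  serves for joint laws of pairs and for laws of words.\<close>

lemma Ent_eq_ent: "Ent = ent"
  by (auto simp: Ent_def ent_def fun_eq_iff)

lemma expect_integral: "finite (set_pmf p) \<Longrightarrow> expect p f = measure_pmf.expectation p f"
  unfolding expect_def by (subst integral_measure_pmf[of "set_pmf p"]) auto

lemma expect_superset: "finite A \<Longrightarrow> set_pmf p \<subseteq> A \<Longrightarrow> expect p f = (\<Sum>a\<in>A. pmf p a * f a)"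
  unfolding expect_def by (rule sum.mono_neutral_left) (auto simp: set_pmf_iff)

lemma expect_cong: "(\<And>a. a \<in> set_pmf p \<Longrightarrow> f a = g a) \<Longrightarrow> expect p f = expect p g"
  unfolding expect_def by (rule sum.cong) auto

lemma expect_mono: "(\<And>a. a \<in> set_pmf p \<Longrightarrow> f a \<le> g a) \<Longrightarrow> expect p f \<le> expect p g"
  unfolding expect_def by (rule sum_mono) (auto intro: mult_left_mono)

lemma expect_const: "finite (set_pmf p) \<Longrightarrow> expect p (\<lambda>_. c) = c"
  unfolding expect_def by (simp add: sum_distrib_right[symmetric] sum_pmf_eq_1)

lemma expect_add: "expect p (\<lambda>a. f a + g a) = expect p f + expect p g"
  unfolding expect_def by (simp add: algebra_simps sum.distrib)

lemma expect_cmult: "expect p (\<lambda>a. c * f a) = c * expect p f"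
  unfolding expect_def by (simp add: algebra_simps sum_distrib_left)

lemma expect_uminus: "expect p (\<lambda>a. - f a) = - expect p f"
  unfolding expect_def by (simp add: sum_negf)

lemma expect_diff: "expect p (\<lambda>a. f a - g a) = expect p f - expect p g"
  using expect_add[of p f "\<lambda>a. - g a"] by (simp add: expect_uminus)

lemma expect_sum: "expect p (\<lambda>a. \<Sum>i\<in>I. f i a) = (\<Sum>i\<in>I. expect p (f i))"
  unfolding expect_def by (simp add: sum_distrib_left sum.swap[of _ I])

lemma expect_nonneg: "(\<And>a. a \<in> set_pmf p \<Longrightarrow> 0 \<le> f a) \<Longrightarrow> 0 \<le> expect p f"
  unfolding expect_def by (rule sum_nonneg) auto

lemma expect_map: "finite (set_pmf p) \<Longrightarrow> expect (map_pmf h p) f = expect p (\<lambda>a. f (h a))"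
  by (subst expect_integral) (auto simp: expect_integral)

lemma expect_bind:
  assumes "finite (set_pmf p)" "\<And>a. a \<in> set_pmf p \<Longrightarrow> finite (set_pmf (K a))"
  shows "expect (bind_pmf p K) f = expect p (\<lambda>a. expect (K a) f)"
proof -
  let ?B = "\<Union>a\<in>set_pmf p. set_pmf (K a)"
  have fB: "finite ?B" using assms by auto
  have "pmf (bind_pmf p K) b = (\<Sum>a\<in>set_pmf p. pmf p a * pmf (K a) b)" for b
    unfolding pmf_bind using assms(1) by (subst integral_measure_pmf[of "set_pmf p"]) auto
  hence "expect (bind_pmf p K) f = (\<Sum>b\<in>?B. (\<Sum>a\<in>set_pmf p. pmf p a * pmf (K a) b) * f b)"
    unfolding expect_def by simp
  also have "\<dots> = (\<Sum>a\<in>set_pmf p. pmf p a * (\<Sum>b\<in>?B. pmf (K a) b * f b))"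
    by (simp add: sum_distrib_left sum_distrib_right mult.assoc) (rule sum.swap)
  also have "\<dots> = expect p (\<lambda>a. expect (K a) f)"
    unfolding expect_def[of p]
    by (intro sum.cong refl arg_cong2[where f="(*)"] expect_superset[symmetric] fB) auto
  finally show ?thesis .
qed

lemma expect_pair:
  assumes "finite (set_pmf p)" "finite (set_pmf q)"
  shows "expect (pair_pmf p q) f = expect p (\<lambda>a. expect q (\<lambda>b. f (a, b)))"
proof -
  have "expect p (\<lambda>a. expect q (\<lambda>b. f (a, b))) = (\<Sum>(a, b)\<in>set_pmf p \<times> set_pmf q. pmf p a * (pmf q b * f (a, b)))"
    unfolding expect_def by (simp add: sum_distrib_left sum.cartesian_product)
  also have "\<dots> = expect (pair_pmf p q) f"
    unfolding expect_def by (auto simp: pmf_pair intro!: sum.cong)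
  finally show ?thesis by simp
qed

text \<open>First moment method: some atom does no worse than the average. It picks the translates,
  the typical word and the pair of conditioning atoms.\<close>

lemma expect_exists_le:
  assumes "finite (set_pmf p)" "expect p f \<le> c"
  shows "\<exists>a\<in>set_pmf p. f a \<le> c"
proof (rule ccontr)
  assume *: "\<not> ?thesis"
  hence less: "c < f a" if "a \<in> set_pmf p" for a
    using that * by force
  have "expect p (\<lambda>a. c) < expect p f" unfolding expect_def
  proof (rule sum_strict_mono)
    show "finite (set_pmf p)" "set_pmf p \<noteq> {}" using assms by (auto simp: set_pmf_not_empty)
  qed (use less in \<open>auto simp: pmf_positive\<close>)
  thus False using assms by (simp add: expect_const)
qed

lemma pmf_map_ge: "pmf p a \<le> pmf (map_pmf h p) (h a)"
  unfolding pmf_map by (subst measure_pmf_single[symmetric], rule measure_pmf.finite_measure_mono) auto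

lemma pmf_map_pos: "a \<in> set_pmf p \<Longrightarrow> 0 < pmf (map_pmf h p) (h a)"
  by (rule less_le_trans[OF pmf_positive pmf_map_ge])

lemma ent_expect: "ent p = expect p (\<lambda>a. - ln (pmf p a))"
  by (simp add: ent_def expect_def sum_negf)

lemma ent_map: "finite (set_pmf p) \<Longrightarrow> ent (map_pmf f p) = expect p (\<lambda>a. - ln (pmf (map_pmf f p) (f a)))"
  by (simp add: ent_expect expect_map)

lemma ent_nonneg: "0 \<le> ent p"
  unfolding ent_expect by (rule expect_nonneg) (simp add: pmf_le_1 pmf_positive)

lemma ent_return [simp]: "ent (return_pmf a) = 0"
  by (simp add: ent_def)

text \<open>Gibbs' inequality, from \<open>ln t \<le> t - 1\<close> at
  \<open>t = pmf q a / pmf p a\<close>.\<close>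

lemma ent_le_cross:
  assumes "finite (set_pmf p)" "set_pmf p \<subseteq> set_pmf q"
  shows "ent p \<le> expect p (\<lambda>a. - ln (pmf q a))"
proof -
  have "ent p - expect p (\<lambda>a. - ln (pmf q a)) = expect p (\<lambda>a. ln (pmf q a) - ln (pmf p a))"
    by (simp add: ent_expect expect_uminus expect_diff)
  also have "\<dots> \<le> expect p (\<lambda>a. pmf q a / pmf p a - 1)"
  proof (rule expect_mono)
    fix a assume a: "a \<in> set_pmf p"
    hence pos: "0 < pmf p a" "0 < pmf q a" using assms by (auto simp: pmf_positive)
    have "ln (pmf q a) - ln (pmf p a) = ln (pmf q a / pmf p a)" using pos by (simp add: ln_div)
    also have "\<dots> \<le> pmf q a / pmf p a - 1" using pos by (intro ln_le_minus_one) auto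
    finally show "ln (pmf q a) - ln (pmf p a) \<le> pmf q a / pmf p a - 1" .
  qed
  also have "\<dots> = (\<Sum>a\<in>set_pmf p. pmf q a) - 1"
    using assms(1) by (simp add: expect_diff expect_const) (simp add: expect_def set_pmf_iff)
  also have "\<dots> \<le> 0"
    using assms(1) by (simp add: measure_measure_pmf_finite[symmetric])
  finally show ?thesis by simp
qed

lemma ent_le_ln_card:
  assumes "finite A" "set_pmf p \<subseteq> A"
  shows "ent p \<le> ln (card A)"
proof -
  have ne: "A \<noteq> {}" using assms set_pmf_not_empty[of p] by auto
  have fp: "finite (set_pmf p)" using assms finite_subset by blast
  have "ent p \<le> expect p (\<lambda>a. - ln (pmf (pmf_of_set A) a))"
    using assms ne fp by (intro ent_le_cross) auto
  also have "\<dots> = expect p (\<lambda>a. ln (card A))"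
    using assms ne by (intro expect_cong) (auto simp: ln_div)
  finally show ?thesis using fp by (simp add: expect_const)
qed

lemma ent_pmf_of_set: "finite A \<Longrightarrow> A \<noteq> {} \<Longrightarrow> ent (pmf_of_set A) = ln (card A)"
  by (simp add: ent_def ln_div)

text \<open>Every upper bound on a conditional entropy below comes from a suitable choice of the kernel.\<close>

lemma ent_pair_le_kernel:
  assumes fin: "finite (set_pmf p)"
    and pos: "\<And>w. w \<in> set_pmf p \<Longrightarrow> 0 < pmf (K (f w)) (g w)"
  shows "ent (map_pmf (\<lambda>w. (f w, g w)) p) \<le> ent (map_pmf f p) + expect p (\<lambda>w. - ln (pmf (K (f w)) (g w)))"
proof -
  \<comment> \<open>The comparison law takes \<open>f w\<close> from its true law and then predicts
    \<open>g w\<close> by the kernel; Gibbs' inequality is applied to it.\<close>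
  let ?q = "bind_pmf (map_pmf f p) (\<lambda>x. map_pmf (Pair x) (K x))"
  have fin': "finite (set_pmf (map_pmf f p))" using fin by simp
  have q: "pmf ?q (x, y) = pmf (map_pmf f p) x * pmf (K x) y" for x y
  proof -
    have "pmf ?q (x, y) = (\<Sum>x'\<in>set_pmf (map_pmf f p). pmf (map_pmf f p) x' * pmf (map_pmf (Pair x') (K x')) (x, y))"
      unfolding pmf_bind using fin' by (subst integral_measure_pmf[of "set_pmf (map_pmf f p)"]) (auto simp del: set_map_pmf)
    also have "\<dots> = (\<Sum>x'\<in>set_pmf (map_pmf f p). if x' = x then pmf (map_pmf f p) x * pmf (K x) y else 0)"
    proof (rule sum.cong[OF refl])
      fix x'
      have "pmf (map_pmf (Pair x') (K x')) (x, y) = 0" if "x' \<noteq> x"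
        using that by (intro pmf_map_outside) auto
      moreover have "pmf (map_pmf (Pair x) (K x)) (x, y) = pmf (K x) y"
        by (rule pmf_map_inj') (simp add: inj_on_def)
      ultimately show "pmf (map_pmf f p) x' * pmf (map_pmf (Pair x') (K x')) (x, y) =
          (if x' = x then pmf (map_pmf f p) x * pmf (K x) y else 0)" by auto
    qed
    also have "\<dots> = pmf (map_pmf f p) x * pmf (K x) y"
      using fin' by (subst sum.delta) (auto simp: pmf_eq_0_set_pmf simp del: set_map_pmf)
    finally show ?thesis .
  qed
  have "ent (map_pmf (\<lambda>w. (f w, g w)) p) \<le> expect (map_pmf (\<lambda>w. (f w, g w)) p) (\<lambda>a. - ln (pmf ?q a))"
  proof (rule ent_le_cross)
    show "finite (set_pmf (map_pmf (\<lambda>w. (f w, g w)) p))" using fin by simp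
    show "set_pmf (map_pmf (\<lambda>w. (f w, g w)) p) \<subseteq> set_pmf ?q"
    proof
      fix a assume "a \<in> set_pmf (map_pmf (\<lambda>w. (f w, g w)) p)"
      then obtain w where w: "w \<in> set_pmf p" "a = (f w, g w)" by auto
      have "0 < pmf ?q a" unfolding w(2) q using w(1) pos pmf_map_pos[of w p f] by simp
      thus "a \<in> set_pmf ?q" by (metis less_irrefl set_pmf_iff)
    qed
  qed
  also have "\<dots> = expect p (\<lambda>w. - ln (pmf (map_pmf f p) (f w)) + - ln (pmf (K (f w)) (g w)))"
    unfolding expect_map[OF fin] q
  proof (rule expect_cong)
    fix w assume w: "w \<in> set_pmf p"
    show "- ln (pmf (map_pmf f p) (f w) * pmf (K (f w)) (g w)) =
         - ln (pmf (map_pmf f p) (f w)) + - ln (pmf (K (f w)) (g w))"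
      using pmf_map_pos[OF w, of f] pos[OF w] by (simp add: ln_mult)
  qed
  also have "\<dots> = ent (map_pmf f p) + expect p (\<lambda>w. - ln (pmf (K (f w)) (g w)))"
    by (simp only: expect_add ent_map[OF fin])
  finally show ?thesis .
qed

lemma ent_map_le: 
  assumes "finite (set_pmf p)" shows "ent (map_pmf f p) \<le> ent p"
  unfolding ent_map[OF assms] unfolding ent_expect
proof (rule expect_mono)
  fix a assume "a \<in> set_pmf p"
  thus "- ln (pmf (map_pmf f p) (f a)) \<le> - ln (pmf p a)"
    using pmf_map_ge[of p a f] pmf_positive[of a p] by simp
qed

text \<open>If \<open>g\<close> determines \<open>f\<close> on the atoms, \<open>f\<close> factors
  through \<open>g\<close> by a choice of preimages, and a function of a variable has no more
  entropy than the variable.\<close>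

lemma ent_mono:
  assumes "finite (set_pmf p)" "\<And>w w'. w \<in> set_pmf p \<Longrightarrow> w' \<in> set_pmf p \<Longrightarrow> g w = g w' \<Longrightarrow> f w = f w'"
  shows "ent (map_pmf f p) \<le> ent (map_pmf g p)"
proof -
  have "map_pmf f p = map_pmf (\<lambda>b. f (SOME w. w \<in> set_pmf p \<and> g w = b)) (map_pmf g p)"
    unfolding pmf.map_comp
  proof (rule map_pmf_cong[OF refl])
    fix w assume w: "w \<in> set_pmf p"
    let ?v = "SOME v. v \<in> set_pmf p \<and> g v = g w"
    have v: "?v \<in> set_pmf p \<and> g ?v = g w" by (rule someI[of _ w]) (use w in simp)
    have "f w = f ?v" by (rule assms(2)[OF w]) (use v in auto)
    thus "f w = ((\<lambda>b. f (SOME w. w \<in> set_pmf p \<and> g w = b)) \<circ> g) w" by (simp only: o_def)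
  qed
  thus ?thesis using ent_map_le[of "map_pmf g p"] assms(1) by simp
qed

text \<open>Variables that determine each other generate the same partition; this removes encodings
  and reorders tuples below.\<close>

lemma ent_cong:
  assumes "finite (set_pmf p)" "\<And>w w'. w \<in> set_pmf p \<Longrightarrow> w' \<in> set_pmf p \<Longrightarrow> g w = g w' \<longleftrightarrow> f w = f w'"
  shows "ent (map_pmf f p) = ent (map_pmf g p)"
  by (intro antisym ent_mono assms(1)) (simp_all add: assms(2))

lemma ent_inj: "finite (set_pmf p) \<Longrightarrow> inj_on f (set_pmf p) \<Longrightarrow> ent (map_pmf f p) = ent p"
  using ent_cong[of p id f] by (auto simp: inj_on_def)

text \<open>Submodularity in the form \<open>H(g | f) \<le> H(g | h f)\<close>: a kernel that looks
  only at \<open>h (f w)\<close> is one possible kernel given \<open>f w\<close>, and predicting by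
  the conditional law given \<open>h (f w)\<close> costs exactly the right-hand side.\<close>

lemma ent_submod:
  assumes fin: "finite (set_pmf p)"
  shows "ent (map_pmf (\<lambda>w. (f w, g w)) p) + ent (map_pmf (\<lambda>w. h (f w)) p)
    \<le> ent (map_pmf f p) + ent (map_pmf (\<lambda>w. (h (f w), g w)) p)"
proof -
  let ?K = "\<lambda>x. map_pmf g (cond_pmf p {w. h (f w) = h x})"
  have K: "pmf (?K (f w)) (g w) = pmf (map_pmf (\<lambda>w. (h (f w), g w)) p) (h (f w), g w) / pmf (map_pmf (\<lambda>w. h (f w)) p) (h (f w))"
    if w: "w \<in> set_pmf p" for w
  proof -
    let ?s = "{v. h (f v) = h (f w)}"
    have ne: "set_pmf p \<inter> ?s \<noteq> {}" using w by auto
    have "pmf (?K (f w)) (g w) = measure (cond_pmf p ?s) (g -` {g w})" by (simp add: pmf_map)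
    also have "\<dots> = measure p (g -` {g w} \<inter> ?s) / measure p ?s"
    proof -
      have m: "measure p A = (\<Sum>v\<in>set_pmf p \<inter> A. pmf p v)" for A
        using fin by (metis measure_Int_set_pmf measure_measure_pmf_finite finite_Int inf_commute)
      have "measure (cond_pmf p ?s) (g -` {g w}) = (\<Sum>v\<in>set_pmf p \<inter> ?s \<inter> g -` {g w}. pmf (cond_pmf p ?s) v)"
        using fin ne by (metis measure_Int_set_pmf measure_measure_pmf_finite finite_Int inf_commute set_cond_pmf)
      also have "\<dots> = (\<Sum>v\<in>set_pmf p \<inter> (g -` {g w} \<inter> ?s). pmf p v / measure p ?s)"
        by (rule sum.cong) (auto simp: pmf_cond[OF ne])
      finally show ?thesis by (simp add: m sum_divide_distrib)
    qed
    also have "g -` {g w} \<inter> ?s = (\<lambda>w. (h (f w), g w)) -` {(h (f w), g w)}" by auto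
    finally show ?thesis by (simp add: pmf_map vimage_def)
  qed
  note pos = pmf_map_pos[of _ p "\<lambda>w. (h (f w), g w)"] pmf_map_pos[of _ p "\<lambda>w. h (f w)"]
  have "ent (map_pmf (\<lambda>w. (f w, g w)) p) \<le> ent (map_pmf f p) + expect p (\<lambda>w. - ln (pmf (?K (f w)) (g w)))"
    by (rule ent_pair_le_kernel[OF fin]) (use K pos in auto)
  also have "expect p (\<lambda>w. - ln (pmf (?K (f w)) (g w))) =
    expect p (\<lambda>w. - ln (pmf (map_pmf (\<lambda>w. (h (f w), g w)) p) (h (f w), g w)) - - ln (pmf (map_pmf (\<lambda>w. h (f w)) p) (h (f w))))"
    by (rule expect_cong) (simp add: K ln_div less_imp_neq[OF pos(1), symmetric] less_imp_neq[OF pos(2), symmetric])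
  finally show ?thesis by (simp only: expect_diff ent_map[OF fin])
qed

lemma ent_pair_pmf:
  assumes "finite (set_pmf p)" "finite (set_pmf q)"
  shows "ent (pair_pmf p q) = ent p + ent q"
proof -
  have "ent (pair_pmf p q) = expect p (\<lambda>a. expect q (\<lambda>b. - ln (pmf p a) + - ln (pmf q b)))"
    unfolding ent_expect expect_pair[OF assms]
    by (intro expect_cong) (auto simp: pmf_pair ln_mult pmf_positive set_pmf_iff)
  thus ?thesis using assms by (simp only: expect_add expect_const ent_expect)
qed

text \<open>Subadditivity is submodularity with a constant \<open>h\<close>.\<close>

lemma ent_joint_le:
  assumes "finite (set_pmf p)"
  shows "ent (map_pmf (\<lambda>w. (f w, g w)) p) \<le> ent (map_pmf f p) + ent (map_pmf g p)"
  using ent_submod[OF assms, of f g "\<lambda>_. ()"] ent_cong[OF assms, of g "\<lambda>w. ((), g w)"]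
    ent_nonneg[of "map_pmf (\<lambda>_. ()) p"] by (simp add: map_pmf_const)

text \<open>Chain rule: \<open>p\<close> is the mixture of its conditional laws over the values of
  \<open>u\<close>, and each joint weight is a weight of \<open>u\<close> times a conditional
  weight.\<close>

lemma ent_chain:
  assumes fin: "finite (set_pmf p)"
  shows "ent (map_pmf (\<lambda>w. (u w, f w)) p) =
    ent (map_pmf u p) + expect (map_pmf u p) (\<lambda>a. ent (map_pmf f (cond_pmf p {w. u w = a})))"
proof -
  let ?c = "\<lambda>a. cond_pmf p {w. u w = a}"
  have ne: "set_pmf p \<inter> {w. u w = a} \<noteq> {}" if "a \<in> set_pmf (map_pmf u p)" for a using that by auto
  have mu: "measure p {w. u w = a} = pmf (map_pmf u p) a" for a
    by (simp add: pmf_map vimage_def)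
  have bc: "bind_pmf (map_pmf u p) ?c = p"
  proof (rule pmf_eqI)
    fix w
    have fin': "finite (set_pmf (map_pmf u p))" using fin by simp
    have "pmf (bind_pmf (map_pmf u p) ?c) w = (\<Sum>a\<in>set_pmf (map_pmf u p). pmf (map_pmf u p) a * pmf (?c a) w)"
      unfolding pmf_bind using fin' by (subst integral_measure_pmf[of "set_pmf (map_pmf u p)"]) (auto simp del: set_map_pmf)
    also have "\<dots> = (\<Sum>a\<in>set_pmf (map_pmf u p). if a = u w then pmf p w else 0)"
    proof (rule sum.cong[OF refl])
      fix a assume a: "a \<in> set_pmf (map_pmf u p)"
      hence "pmf (map_pmf u p) a > 0" by (rule pmf_positive)
      thus "pmf (map_pmf u p) a * pmf (?c a) w = (if a = u w then pmf p w else 0)"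
        by (auto simp: pmf_cond[OF ne[OF a]] mu)
    qed
    also have "\<dots> = pmf p w" using fin by (subst sum.delta) (auto simp: set_pmf_iff)
    finally show "pmf (bind_pmf (map_pmf u p) ?c) w = pmf p w" .
  qed
  have finc: "finite (set_pmf (?c a))" if "a \<in> set_pmf (map_pmf u p)" for a
    using set_cond_pmf[OF ne[OF that]] fin by simp
  let ?j = "\<lambda>w. pmf (map_pmf (\<lambda>w. (u w, f w)) p) (u w, f w)"
  have "ent (map_pmf (\<lambda>w. (u w, f w)) p) = expect (bind_pmf (map_pmf u p) ?c) (\<lambda>w. - ln (?j w))"
    by (simp add: bc ent_map[OF fin])
  also have "\<dots> = expect (map_pmf u p) (\<lambda>a. expect (?c a) (\<lambda>w. - ln (?j w)))"
    by (rule expect_bind) (use fin finc in auto)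
  also have "\<dots> = expect (map_pmf u p) (\<lambda>a. - ln (pmf (map_pmf u p) a) + ent (map_pmf f (?c a)))"
  proof (rule expect_cong)
    fix a assume a: "a \<in> set_pmf (map_pmf u p)"
    have pa: "pmf (map_pmf u p) a > 0" using a by (rule pmf_positive)
    have "expect (?c a) (\<lambda>w. - ln (?j w)) = expect (?c a) (\<lambda>w. - ln (pmf (map_pmf u p) a) + - ln (pmf (map_pmf f (?c a)) (f w)))"
    proof (rule expect_cong)
      fix w assume "w \<in> set_pmf (?c a)"
      hence w: "w \<in> set_pmf p" "u w = a" using set_cond_pmf[OF ne[OF a]] by auto
      have fw: "pmf (map_pmf f (?c a)) (f w) > 0" using \<open>w \<in> set_pmf (?c a)\<close> by (rule pmf_map_pos)
      have m: "measure p A = (\<Sum>v\<in>set_pmf p \<inter> A. pmf p v)" for A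
        using fin by (metis measure_Int_set_pmf measure_measure_pmf_finite finite_Int inf_commute)
      have "pmf (map_pmf f (?c a)) (f w) = (\<Sum>v\<in>set_pmf p \<inter> {w. u w = a} \<inter> f -` {f w}. pmf (?c a) v)"
        unfolding pmf_map
        using fin ne[OF a] by (metis measure_Int_set_pmf measure_measure_pmf_finite finite_Int inf_commute set_cond_pmf)
      also have "\<dots> = (\<Sum>v\<in>set_pmf p \<inter> ((\<lambda>w. (u w, f w)) -` {(a, f w)}). pmf p v / pmf (map_pmf u p) a)"
        by (rule sum.cong) (auto simp: pmf_cond[OF ne[OF a]] mu)
      also have "\<dots> = ?j w / pmf (map_pmf u p) a" by (simp add: m pmf_map sum_divide_distrib w(2))
      finally have "?j w = pmf (map_pmf u p) a * pmf (map_pmf f (?c a)) (f w)" using pa by simp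
      thus "- ln (?j w) = - ln (pmf (map_pmf u p) a) + - ln (pmf (map_pmf f (?c a)) (f w))"
        using fw pa by (simp add: ln_mult)
    qed
    also have "\<dots> = - ln (pmf (map_pmf u p) a) + ent (map_pmf f (?c a))"
      by (simp only: expect_add expect_const[OF finc[OF a]] ent_map[OF finc[OF a]])
    finally show "expect (?c a) (\<lambda>w. - ln (?j w)) = - ln (pmf (map_pmf u p) a) + ent (map_pmf f (?c a))" .
  qed
  finally show ?thesis by (simp only: expect_add ent_expect[symmetric])
qed


section \<open>The entropy distance through joint realizations\<close>

text \<open>
  Over an indexing category with initial object, a fan of diagrams amounts to two compatible families
  of random variables on one probability space.
\<close>

definition realizes :: "'i rel \<Rightarrow> 'w pmf \<Rightarrow> ('i \<Rightarrow> 'w \<Rightarrow> nat) \<Rightarrow> 'i diagram \<Rightarrow> bool" where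
  "realizes G p F X \<longleftrightarrow> (\<forall>i\<in>Field G. map_pmf (F i) p = sp X i) \<and>
     (\<forall>(i, j)\<in>G. \<forall>w\<in>set_pmf p. red X i j (F i w) = F j w)"

text \<open>Each summand is \<open>H(F i | F' i) + H(F' i | F i)\<close>: the cost of the smallest
  fan that carries the two families jointly.\<close>

definition coupling_cost :: "'i rel \<Rightarrow> 'w pmf \<Rightarrow> ('i \<Rightarrow> 'w \<Rightarrow> nat) \<Rightarrow> ('i \<Rightarrow> 'w \<Rightarrow> nat) \<Rightarrow> real" where
  "coupling_cost G p F F' = (\<Sum>i\<in>Field G. 2 * ent (map_pmf (\<lambda>w. (F i w, F' i w)) p)
     - ent (map_pmf (F i) p) - ent (map_pmf (F' i) p))"

lemma realizes_in:
  assumes "realizes G p F X" "i \<in> Field G" "w \<in> set_pmf p"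
  shows "F i w \<in> set_pmf (sp X i)"
proof -
  have "map_pmf (F i) p = sp X i" using assms by (simp add: realizes_def)
  thus ?thesis using assms(3) by (metis imageI set_map_pmf)
qed

lemma realizes_comp: "realizes G p F X \<Longrightarrow> p = map_pmf h q \<Longrightarrow> realizes G q (\<lambda>i w. F i (h w)) X"
  by (auto simp: realizes_def pmf.map_comp o_def)

lemma coupling_cost_comp:
  "p = map_pmf h q \<Longrightarrow> coupling_cost G q (\<lambda>i w. F i (h w)) (\<lambda>i w. F' i (h w)) = coupling_cost G p F F'"
  by (auto simp: coupling_cost_def pmf.map_comp o_def)

lemma is_diagram_finite: "is_diagram G X \<Longrightarrow> i \<in> Field G \<Longrightarrow> finite (set_pmf (sp X i))"
  by (auto simp: is_diagram_def)

lemma is_diagram_reduction: "is_diagram G X \<Longrightarrow> (i, j) \<in> G \<Longrightarrow> map_pmf (red X i j) (sp X i) = sp X j"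
  by (auto simp: is_diagram_def reduction_def)

lemma is_diagram_id: "is_diagram G X \<Longrightarrow> i \<in> Field G \<Longrightarrow> a \<in> set_pmf (sp X i) \<Longrightarrow> red X i i a = a"
  by (auto simp: is_diagram_def)

lemma is_diagram_comp: "is_diagram G X \<Longrightarrow> (i, j) \<in> G \<Longrightarrow> (j, k) \<in> G \<Longrightarrow> a \<in> set_pmf (sp X i) \<Longrightarrow>
    red X j k (red X i j a) = red X i k a"
  unfolding is_diagram_def by blast

lemma Ent_mor_le:
  assumes "diagram_mor G X Y f" "finite (set_pmf (sp X i))" "i \<in> Field G"
  shows "Ent (sp Y i) \<le> Ent (sp X i)"
  using assms ent_map_le[of "sp X i" "f i"] by (auto simp: diagram_mor_def reduction_def Ent_eq_ent)

lemma ent_diff_mor: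
  assumes "diagram_mor G X Y f" "is_diagram G X"
  shows "ent_diff G X Y = (\<Sum>i\<in>Field G. Ent (sp X i) - Ent (sp Y i))"
  unfolding ent_diff_def using Ent_mor_le[OF assms(1)] is_diagram_finite[OF assms(2)]
  by (intro sum.cong) auto

lemma ent_diff_nonneg: "0 \<le> ent_diff G X Y"
  unfolding ent_diff_def by (rule sum_nonneg) auto

lemma bdd_below_fans:
  "bdd_below {ent_diff G Z X + ent_diff G Z Y | Z f g. is_diagram G Z \<and> diagram_mor G Z X f \<and> diagram_mor G Z Y g}"
  by (rule bdd_belowI[of _ 0]) (auto simp: ent_diff_nonneg)

lemma entropy_dist_le_fan:
  assumes "is_diagram G Z" "diagram_mor G Z X f" "diagram_mor G Z Y g"
  shows "entropy_dist G X Y \<le> ent_diff G Z X + ent_diff G Z Y"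
  unfolding entropy_dist_def using assms by (intro cInf_lower bdd_below_fans) auto

lemma entropy_dist_commute: "entropy_dist G X Y = entropy_dist G Y X"
  unfolding entropy_dist_def by (rule arg_cong[where f=Inf]) (auto simp: add.commute)

lemma entropy_dist_le_mor:
  assumes "is_diagram G X" "diagram_mor G X Y f"
  shows "entropy_dist G X Y \<le> (\<Sum>i\<in>Field G. Ent (sp X i) - Ent (sp Y i))"
proof -
  have "diagram_mor G X X (\<lambda>_ a. a)" by (auto simp: diagram_mor_def reduction_def)
  from entropy_dist_le_fan[OF assms(1) this assms(2)] show ?thesis
    using ent_diff_mor[OF assms(2,1)] by (simp add: ent_diff_def)
qed

text \<open>The apex consists of the joint laws of the pairs \<open>(F i, F' i)\<close>, with
  coordinatewise reductions, so its cost is exactly the coupling cost.\<close>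

lemma fan_of_realizes:
  assumes fin: "finite (set_pmf p)" and tr: "trans G"
    and F: "realizes G p F X" and F': "realizes G p F' Y" and X: "is_diagram G X" and Y: "is_diagram G Y"
  shows "\<exists>Z f g. is_diagram G Z \<and> diagram_mor G Z X f \<and> diagram_mor G Z Y g \<and>
    ent_diff G Z X + ent_diff G Z Y = coupling_cost G p F F'"
proof -
  define Z where "Z = \<lparr> sp = (\<lambda>i. map_pmf (\<lambda>w. prod_encode (F i w, F' i w)) p),
    red = (\<lambda>i j. prod_encode \<circ> map_prod (red X i j) (red Y i j) \<circ> prod_decode) \<rparr>"
  have fld: "i \<in> Field G" "j \<in> Field G" if "(i, j) \<in> G" for i j using that by (auto simp: Field_def)
  have FX: "F i w \<in> set_pmf (sp X i)" "F' i w \<in> set_pmf (sp Y i)" if "i \<in> Field G" "w \<in> set_pmf p" for i w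
    using realizes_in F F' that by metis+
  have Fr: "red X i j (F i w) = F j w" "red Y i j (F' i w) = F' j w" if "(i, j) \<in> G" "w \<in> set_pmf p" for i j w
    using F F' that unfolding realizes_def by auto
  have Z: "is_diagram G Z"
    unfolding is_diagram_def reduction_def Z_def
    using fin fld FX X Y tr
    by (auto simp: pmf.map_comp o_def Fr is_diagram_id[OF X] is_diagram_id[OF Y] intro!: map_pmf_cong dest: transD)
  have mX: "diagram_mor G Z X (\<lambda>i. fst \<circ> prod_decode)" and mY: "diagram_mor G Z Y (\<lambda>i. snd \<circ> prod_decode)"
    using F F' by (auto simp: diagram_mor_def reduction_def Z_def pmf.map_comp o_def realizes_def)
  have "Ent (sp Z i) = ent (map_pmf (\<lambda>w. (F i w, F' i w)) p)" for i
    unfolding Ent_eq_ent Z_def diagram.simps by (rule ent_cong[OF fin]) auto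
  hence "ent_diff G Z X + ent_diff G Z Y = coupling_cost G p F F'"
    unfolding ent_diff_mor[OF mX Z] ent_diff_mor[OF mY Z] coupling_cost_def sum.distrib[symmetric]
    using F F' by (intro sum.cong) (auto simp: realizes_def Ent_eq_ent)
  with Z mX mY show ?thesis by blast
qed

lemma entropy_dist_le_cost:
  assumes "finite (set_pmf p)" "trans G" "realizes G p F X" "realizes G p F' Y" "is_diagram G X" "is_diagram G Y"
  shows "entropy_dist G X Y \<le> coupling_cost G p F F'"
proof -
  obtain Z f g where "is_diagram G Z" "diagram_mor G Z X f" "diagram_mor G Z Y g"
    "ent_diff G Z X + ent_diff G Z Y = coupling_cost G p F F'"
    using fan_of_realizes[OF assms] by blast
  thus ?thesis using entropy_dist_le_fan[of G Z X f Y g] by simp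
qed

lemma is_diagram_tensor:
  assumes "is_diagram G X" "is_diagram G Y" 
  shows "is_diagram G (tensor X Y)"
proof -
  have fld: "i \<in> Field G" "j \<in> Field G" if "(i, j) \<in> G" for i j using that by (auto simp: Field_def)
  have "map_pmf (\<lambda>x. prod_encode (map_prod (red X i j) (red Y i j) x)) (pair_pmf (sp X i) (sp Y i)) =
     map_pmf prod_encode (pair_pmf (sp X j) (sp Y j))" if "(i, j) \<in> G" for i j
  proof -
    have "pair_pmf (sp X j) (sp Y j) = map_pmf (map_prod (red X i j) (red Y i j)) (pair_pmf (sp X i) (sp Y i))"
      unfolding map_prod_def map_pair
      using is_diagram_reduction[OF assms(1) that] is_diagram_reduction[OF assms(2) that] by simp
    thus ?thesis by (simp add: pmf.map_comp o_def)
  qed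
  thus ?thesis
    unfolding is_diagram_def[where X="tensor X Y"] reduction_def unfolding tensor_def
    using assms[THEN is_diagram_finite] fld
    by (auto simp: pmf.map_comp o_def is_diagram_id[OF assms(1)] is_diagram_id[OF assms(2)]
      is_diagram_comp[OF assms(1)] is_diagram_comp[OF assms(2)])
qed

lemma set_sp_tensor: "set_pmf (sp (tensor X Y) i) = prod_encode ` (set_pmf (sp X i) \<times> set_pmf (sp Y i))"
  by (simp add: tensor_def)

lemma red_tensor: "red (tensor X Y) i j (prod_encode (a, b)) = prod_encode (red X i j a, red Y i j b)"
  by (simp add: tensor_def)

lemma Ent_tensor:
  assumes "finite (set_pmf (sp X i))" "finite (set_pmf (sp Y i))"
  shows "Ent (sp (tensor X Y) i) = Ent (sp X i) + Ent (sp Y i)"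
  unfolding Ent_eq_ent tensor_def diagram.simps
  using assms by (subst ent_inj) (auto simp: ent_pair_pmf inj_on_def)

lemma realizes_tensor:
  assumes "realizes G p F X" "realizes G q F' Y"
  shows "realizes G (pair_pmf p q) (\<lambda>i (v, w). prod_encode (F i v, F' i w)) (tensor X Y)"
proof -
  have "map_pmf (\<lambda>(v, w). prod_encode (F i v, F' i w)) (pair_pmf p q) = map_pmf prod_encode (pair_pmf (sp X i) (sp Y i))"
    if "i \<in> Field G" for i
  proof -
    have "pair_pmf (sp X i) (sp Y i) = map_pmf (\<lambda>(v, w). (F i v, F' i w)) (pair_pmf p q)"
      using assms that by (simp add: map_pair realizes_def)
    thus ?thesis by (simp add: pmf.map_comp o_def case_prod_unfold)
  qed
  thus ?thesis using assms by (auto simp: realizes_def tensor_def)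
qed

lemma ent_pair_map:
  assumes "finite (set_pmf p)" "finite (set_pmf q)"
  shows "ent (map_pmf (\<lambda>(v, w). (f v, g w)) (pair_pmf p q)) = ent (map_pmf f p) + ent (map_pmf g q)"
  using assms by (simp add: map_pair ent_pair_pmf)

lemma coupling_cost_tensor:
  assumes "finite (set_pmf p)" "finite (set_pmf q)"
  shows "coupling_cost G (pair_pmf p q) (\<lambda>i (v, w). prod_encode (F i v, H i w)) (\<lambda>i (v, w). prod_encode (F' i v, H' i w))
    = coupling_cost G p F F' + coupling_cost G q H H'"
proof -
  have fin: "finite (set_pmf (pair_pmf p q))" using assms by simp
  have 1: "ent (map_pmf (\<lambda>w. (case w of (v, w) \<Rightarrow> prod_encode (F i v, H i w), case w of (v, w) \<Rightarrow> prod_encode (F' i v, H' i w))) (pair_pmf p q))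
     = ent (map_pmf (\<lambda>v. (F i v, F' i v)) p) + ent (map_pmf (\<lambda>w. (H i w, H' i w)) q)" for i
    unfolding ent_pair_map[OF assms, symmetric] by (rule ent_cong[OF fin]) auto
  have 2: "ent (map_pmf (\<lambda>(v, w). prod_encode (f v, h w)) (pair_pmf p q)) = ent (map_pmf f p) + ent (map_pmf h q)" for f h
    unfolding ent_pair_map[OF assms, symmetric] by (rule ent_cong[OF fin]) auto
  show ?thesis unfolding coupling_cost_def 1 2 by (simp add: sum.distrib[symmetric] algebra_simps)
qed

section \<open>Metric properties of the entropy distance\<close>

locale initial_index =
  fixes G :: "'i rel" and z :: 'i
  assumes fin: "finite (Field G)" and po: "Partial_order G" and ini: "initial G z"
begin

lemma z_field: "z \<in> Field G" and z_to: "i \<in> Field G \<Longrightarrow> (z, i) \<in> G"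
  using ini by (auto simp: initial_def)

lemma transG: "trans G"
  using po by (simp add: partial_order_on_def preorder_on_def)

lemma reflG: "i \<in> Field G \<Longrightarrow> (i, i) \<in> G"
  using po by (simp add: partial_order_on_def preorder_on_def refl_on_def)

lemma initial_object_eq: "initial_object G = z"
  unfolding initial_object_def
proof (rule the_equality)
  show "initial G z" by (rule ini)
  fix y assume "initial G y"
  hence "(y, z) \<in> G" "(z, y) \<in> G" using ini by (auto simp: initial_def)
  thus "y = z" using po by (auto simp: partial_order_on_def antisym_def)
qed

lemma realizes_self:
  assumes "is_diagram G X" shows "realizes G (sp X z) (red X z) X"
  unfolding realizes_def using is_diagram_reduction[OF assms z_to] is_diagram_comp[OF assms z_to]
  by (auto simp: FieldI1)

text \<open>The independent coupling gives a fan, so the infimum is over a nonempty set.\<close>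

lemma fans_nonempty:
  assumes "is_diagram G X" "is_diagram G Y"
  shows "{ent_diff G Z X + ent_diff G Z Y | Z f g. is_diagram G Z \<and> diagram_mor G Z X f \<and> diagram_mor G Z Y g} \<noteq> {}"
proof -
  have "realizes G (pair_pmf (sp X z) (sp Y z)) (\<lambda>i w. red X z i (fst w)) X"
    by (rule realizes_comp[OF realizes_self[OF assms(1)]]) (simp add: map_fst_pair_pmf)
  moreover have "realizes G (pair_pmf (sp X z) (sp Y z)) (\<lambda>i w. red Y z i (snd w)) Y"
    by (rule realizes_comp[OF realizes_self[OF assms(2)]]) (simp add: map_snd_pair_pmf)
  moreover have "finite (set_pmf (pair_pmf (sp X z) (sp Y z)))"
    using assms z_field by (simp add: is_diagram_finite)
  ultimately show ?thesis using fan_of_realizes[OF _ transG _ _ assms] by blast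
qed

text \<open>Triangle inequality for real numbers through the entropies of the apex; hence entropies
  are 1-Lipschitz.\<close>

lemma ent_diff_le_entropy_dist:
  assumes "is_diagram G X" "is_diagram G Y"
  shows "ent_diff G X Y \<le> entropy_dist G X Y"
  unfolding entropy_dist_def
proof (rule cInf_greatest[OF fans_nonempty[OF assms]])
  fix t assume "t \<in> {ent_diff G Z X + ent_diff G Z Y | Z f g. is_diagram G Z \<and> diagram_mor G Z X f \<and> diagram_mor G Z Y g}"
  then obtain Z where t: "t = ent_diff G Z X + ent_diff G Z Y" by auto
  show "ent_diff G X Y \<le> t"
    unfolding t unfolding ent_diff_def sum.distrib[symmetric] by (rule sum_mono) auto
qed

lemma entropy_dist_nonneg: "is_diagram G X \<Longrightarrow> is_diagram G Y \<Longrightarrow> 0 \<le> entropy_dist G X Y"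
  using ent_diff_le_entropy_dist[of X Y] ent_diff_nonneg[of G X Y] by linarith

lemma Ent_diff_le:
  assumes "is_diagram G X" "is_diagram G Y" "i \<in> Field G"
  shows "\<bar>Ent (sp X i) - Ent (sp Y i)\<bar> \<le> entropy_dist G X Y"
proof -
  have "\<bar>Ent (sp X i) - Ent (sp Y i)\<bar> \<le> ent_diff G X Y"
    unfolding ent_diff_def by (rule member_le_sum[OF assms(3) _ fin]) auto
  thus ?thesis using ent_diff_le_entropy_dist[OF assms(1,2)] by linarith
qed

text \<open>With the source as apex the cost is the total drop of entropy, which is 0 here.
  Isomorphic diagrams are compared in this way with a map in one direction only.\<close>

lemma entropy_dist_eq_0:
  assumes "is_diagram G X" "is_diagram G Y" "diagram_mor G X Y f" "\<And>i. i \<in> Field G \<Longrightarrow> Ent (sp X i) \<le> Ent (sp Y i)"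
  shows "entropy_dist G X Y = 0"
proof -
  have "entropy_dist G X Y \<le> (\<Sum>i\<in>Field G. 0)"
    using assms(4) by (intro order.trans[OF entropy_dist_le_mor[OF assms(1,3)]] sum_mono) auto
  thus ?thesis using entropy_dist_nonneg[OF assms(1,2)] by simp
qed

lemma entropy_dist_self: "is_diagram G X \<Longrightarrow> entropy_dist G X X = 0"
  by (rule entropy_dist_eq_0[where f="\<lambda>_ a. a"]) (auto simp: diagram_mor_def reduction_def)

text \<open>A fan is pulled back to the initial space of its apex. The pair of images at
  \<open>i\<close> is a function of the apex space at \<open>i\<close>, so the coupling costs no
  more than the fan.\<close>

lemma coupling_exists:
  assumes X: "is_diagram G X" and Y: "is_diagram G Y" and c: "entropy_dist G X Y < c"
  shows "\<exists>(p::nat pmf) F F'. finite (set_pmf p) \<and> realizes G p F X \<and> realizes G p F' Y \<and> coupling_cost G p F F' < c"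
proof -
  from cInf_lessD[OF fans_nonempty[OF X Y] c[unfolded entropy_dist_def]]
  obtain Z f g where Z: "is_diagram G Z" and f: "diagram_mor G Z X f" and g: "diagram_mor G Z Y g"
    and less: "ent_diff G Z X + ent_diff G Z Y < c" by auto
  let ?p = "sp Z z" let ?F = "\<lambda>i w. f i (red Z z i w)" let ?F' = "\<lambda>i w. g i (red Z z i w)"
  have real: "realizes G ?p (\<lambda>i w. h i (red Z z i w)) W" if h: "diagram_mor G Z W h" for W h
  proof -
    have "map_pmf (\<lambda>w. h i (red Z z i w)) ?p = sp W i" if "i \<in> Field G" for i
    proof -
      have "map_pmf (\<lambda>w. h i (red Z z i w)) ?p = map_pmf (h i) (map_pmf (red Z z i) ?p)"
        by (simp add: pmf.map_comp o_def)
      thus ?thesis using h is_diagram_reduction[OF Z z_to[OF that]] that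
        by (simp add: diagram_mor_def reduction_def)
    qed
    moreover have "red W i j (h i (red Z z i w)) = h j (red Z z j w)" if ij: "(i, j) \<in> G" and w: "w \<in> set_pmf ?p" for i j w
    proof -
      have "i \<in> Field G" using ij by (auto simp: Field_def)
      hence "red Z z i w \<in> set_pmf (sp Z i)" using is_diagram_reduction[OF Z z_to, of i] w by (metis imageI set_map_pmf)
      hence "red W i j (h i (red Z z i w)) = h j (red Z i j (red Z z i w))" using h ij by (auto simp: diagram_mor_def)
      thus ?thesis using is_diagram_comp[OF Z z_to[OF \<open>i \<in> Field G\<close>] ij w] by simp
    qed
    ultimately show ?thesis by (auto simp: realizes_def)
  qed
  have "coupling_cost G ?p ?F ?F' \<le> ent_diff G Z X + ent_diff G Z Y"
    unfolding ent_diff_mor[OF f Z] ent_diff_mor[OF g Z] coupling_cost_def sum.distrib[symmetric]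
  proof (rule sum_mono)
    fix i assume i: "i \<in> Field G"
    have "map_pmf (\<lambda>w. (?F i w, ?F' i w)) ?p = map_pmf (\<lambda>a. (f i a, g i a)) (map_pmf (red Z z i) ?p)"
      by (simp add: pmf.map_comp o_def)
    also have "\<dots> = map_pmf (\<lambda>a. (f i a, g i a)) (sp Z i)" using is_diagram_reduction[OF Z z_to[OF i]] by simp
    finally have "ent (map_pmf (\<lambda>w. (?F i w, ?F' i w)) ?p) \<le> ent (sp Z i)"
      using ent_map_le[OF is_diagram_finite[OF Z i]] by metis
    moreover have "map_pmf (?F i) ?p = sp X i" "map_pmf (?F' i) ?p = sp Y i"
      using real[OF f] real[OF g] i by (auto simp: realizes_def)
    ultimately show "2 * ent (map_pmf (\<lambda>w. (?F i w, ?F' i w)) ?p) - ent (map_pmf (?F i) ?p) - ent (map_pmf (?F' i) ?p)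
       \<le> Ent (sp Z i) - Ent (sp X i) + (Ent (sp Z i) - Ent (sp Y i))" by (simp add: Ent_eq_ent)
  qed
  with real[OF f] real[OF g] less is_diagram_finite[OF Z z_field] show ?thesis
    by (intro exI[of _ ?p] exI[of _ ?F] exI[of _ ?F']) auto
qed

text \<open>The fibre product over \<open>Y\<close>: after \<open>v\<close>, the second point is
  drawn conditionally on having the same image at \<open>z\<close>. Agreement at \<open>z\<close>
  passes to all \<open>i\<close> by the reductions.\<close>

lemma glue_realizations:
  assumes p: "finite (set_pmf p)" and q: "finite (set_pmf q)" and F: "realizes G p F Y" and H: "realizes G q H Y"
  shows "\<exists>r. map_pmf fst r = p \<and> map_pmf snd r = q \<and> (\<forall>(v, w)\<in>set_pmf r. \<forall>i\<in>Field G. F i v = H i w)"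
proof -
  let ?c = "\<lambda>v. cond_pmf q {w. F z v = H z w}"
  define r where "r = bind_pmf p (\<lambda>v. map_pmf (Pair v) (?c v))"
  have F: "map_pmf (F z) p = sp Y z" "\<And>i v. i \<in> Field G \<Longrightarrow> v \<in> set_pmf p \<Longrightarrow> red Y z i (F z v) = F i v"
    and H: "map_pmf (H z) q = sp Y z" "\<And>i v. i \<in> Field G \<Longrightarrow> v \<in> set_pmf q \<Longrightarrow> red Y z i (H z v) = H i v"
    using F H z_field z_to unfolding realizes_def by blast+
  have sets: "F z ` set_pmf p = H z ` set_pmf q" using F(1) H(1) by (metis set_map_pmf)
  have ne: "set_pmf q \<inter> {w. F z v = H z w} \<noteq> {}" if "v \<in> set_pmf p" for v
  proof -
    have "F z v \<in> H z ` set_pmf q" using that sets by (metis imageI)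
    thus ?thesis by auto
  qed
  have ne': "set_pmf p \<inter> {v. F z v = H z w} \<noteq> {}" if "w \<in> set_pmf q" for w
  proof -
    have "H z w \<in> F z ` set_pmf p" using that sets by (metis imageI)
    thus ?thesis by auto
  qed
  have fst: "map_pmf fst r = p"
    by (simp add: r_def map_bind_pmf pmf.map_comp o_def map_pmf_const bind_return_pmf')
  \<comment> \<open>Both laws give the same weight to the fibre over each atom of \<open>Y\<close>
    at \<open>z\<close>, hence the second marginal is \<open>q\<close>.\<close>
  have "bind_pmf p ?c = q"
  proof (rule bind_cond_pmf_cancel[where R="\<lambda>v w. F z v = H z w", OF ne ne'])
    fix v w assume "F z v = H z w"
    hence "{w'. F z v = H z w'} = H z -` {H z w}" "{v'. F z v' = H z w} = F z -` {H z w}" by auto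
    moreover have "measure p (F z -` {H z w}) = measure q (H z -` {H z w})"
      using F(1) H(1) by (metis pmf_map)
    ultimately show "measure q {w'. F z v = H z w'} = measure p {v'. F z v' = H z w}" by simp
  qed
  hence snd: "map_pmf snd r = q"
    by (simp add: r_def map_bind_pmf pmf.map_comp o_def)
  have "F i v = H i w" if "(v, w) \<in> set_pmf r" "i \<in> Field G" for v w i
  proof -
    have v: "v \<in> set_pmf p" and w: "w \<in> set_pmf (?c v)" using that by (auto simp: r_def)
    hence w: "w \<in> set_pmf q" "F z v = H z w" using set_cond_pmf[OF ne[OF v]] by auto
    show ?thesis using F(2)[OF that(2) v] H(2)[OF that(2) w(1)] w(2) by simp
  qed
  with fst snd show ?thesis by blast
qed

text \<open>Two near-optimal couplings are glued along \<open>Y\<close>. At each object,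
  submodularity over the middle variable, \<open>H(A,B,C) + H(B) \<le> H(A,B) + H(B,C)\<close>,
  bounds the cost of the outer pair.\<close>

lemma entropy_dist_triangle:
  assumes X: "is_diagram G X" and Y: "is_diagram G Y" and Z: "is_diagram G Z"
  shows "entropy_dist G X Z \<le> entropy_dist G X Y + entropy_dist G Y Z"
proof (rule field_le_epsilon)
  fix e :: real assume e: "e > 0"
  from coupling_exists[OF X Y, of "entropy_dist G X Y + e / 2"] e obtain p :: "nat pmf" and F F'
    where p: "finite (set_pmf p)" "realizes G p F X" "realizes G p F' Y" "coupling_cost G p F F' < entropy_dist G X Y + e / 2" by auto
  from coupling_exists[OF Y Z, of "entropy_dist G Y Z + e / 2"] e obtain q :: "nat pmf" and H H'
    where q: "finite (set_pmf q)" "realizes G q H Y" "realizes G q H' Z" "coupling_cost G q H H' < entropy_dist G Y Z + e / 2" by auto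
  from glue_realizations[OF p(1) q(1) p(3) q(2)] obtain r where r: "p = map_pmf fst r" "q = map_pmf snd r"
    and eq: "\<And>v w i. (v, w) \<in> set_pmf r \<Longrightarrow> i \<in> Field G \<Longrightarrow> F' i v = H i w" by blast
  have finr: "finite (set_pmf r)"
  proof (rule finite_subset)
    show "set_pmf r \<subseteq> set_pmf p \<times> set_pmf q" unfolding r by (auto intro: rev_image_eqI)
  qed (use p q in auto)
  let ?A = "\<lambda>i w. F i (fst w)" and ?B = "\<lambda>i w. F' i (fst w)" and ?B' = "\<lambda>i w. H i (snd w)" and ?C = "\<lambda>i w. H' i (snd w)"
  have "entropy_dist G X Z \<le> coupling_cost G r ?A ?C"
    by (rule entropy_dist_le_cost[OF finr transG realizes_comp[OF p(2) r(1)] realizes_comp[OF q(3) r(2)] X Z])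
  also have "\<dots> \<le> coupling_cost G r ?A ?B + coupling_cost G r ?B' ?C"
    unfolding coupling_cost_def sum.distrib[symmetric]
  proof (rule sum_mono)
    fix i assume i: "i \<in> Field G"
    have B: "map_pmf (?B' i) r = map_pmf (?B i) r" "map_pmf (\<lambda>w. (?B' i w, ?C i w)) r = map_pmf (\<lambda>w. (?B i w, ?C i w)) r"
      by (auto intro!: map_pmf_cong simp: eq[OF _ i])
    have "ent (map_pmf (\<lambda>w. (?A i w, ?C i w)) r) \<le> ent (map_pmf (\<lambda>w. ((?A i w, ?B i w), ?C i w)) r)"
      by (rule ent_mono[OF finr]) auto
    moreover have "ent (map_pmf (\<lambda>w. ((?A i w, ?B i w), ?C i w)) r) + ent (map_pmf (?B i) r) \<le>
       ent (map_pmf (\<lambda>w. (?A i w, ?B i w)) r) + ent (map_pmf (\<lambda>w. (?B i w, ?C i w)) r)"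
      using ent_submod[OF finr, of "\<lambda>w. (?A i w, ?B i w)" "?C i" snd] by simp
    ultimately show "2 * ent (map_pmf (\<lambda>w. (?A i w, ?C i w)) r) - ent (map_pmf (?A i) r) - ent (map_pmf (?C i) r)
      \<le> 2 * ent (map_pmf (\<lambda>w. (?A i w, ?B i w)) r) - ent (map_pmf (?A i) r) - ent (map_pmf (?B i) r) +
       (2 * ent (map_pmf (\<lambda>w. (?B' i w, ?C i w)) r) - ent (map_pmf (?B' i) r) - ent (map_pmf (?C i) r))"
      unfolding B by linarith
  qed
  also have "\<dots> = coupling_cost G p F F' + coupling_cost G q H H'"
    using coupling_cost_comp[OF r(1)] coupling_cost_comp[OF r(2)] by metis
  also have "\<dots> \<le> entropy_dist G X Y + entropy_dist G Y Z + e" using p(4) q(4) by simp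
  finally show "entropy_dist G X Z \<le> entropy_dist G X Y + entropy_dist G Y Z + e" .
qed

text \<open>Costs add for the independent product of two couplings.\<close>

lemma entropy_dist_tensor:
  assumes X: "is_diagram G X" and Y: "is_diagram G Y" and X': "is_diagram G X'" and Y': "is_diagram G Y'"
  shows "entropy_dist G (tensor X X') (tensor Y Y') \<le> entropy_dist G X Y + entropy_dist G X' Y'"
proof (rule field_le_epsilon)
  fix e :: real assume e: "e > 0"
  from coupling_exists[OF X Y, of "entropy_dist G X Y + e / 2"] e obtain p :: "nat pmf" and F F'
    where p: "finite (set_pmf p)" "realizes G p F X" "realizes G p F' Y" "coupling_cost G p F F' < entropy_dist G X Y + e / 2" by auto
  from coupling_exists[OF X' Y', of "entropy_dist G X' Y' + e / 2"] e obtain q :: "nat pmf" and H H'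
    where q: "finite (set_pmf q)" "realizes G q H X'" "realizes G q H' Y'" "coupling_cost G q H H' < entropy_dist G X' Y' + e / 2" by auto
  have "entropy_dist G (tensor X X') (tensor Y Y') \<le> coupling_cost G p F F' + coupling_cost G q H H'"
    unfolding coupling_cost_tensor[OF p(1) q(1), symmetric]
    by (rule entropy_dist_le_cost[OF _ transG]) (use assms p q in \<open>auto intro!: realizes_tensor is_diagram_tensor\<close>)
  thus "entropy_dist G (tensor X X') (tensor Y Y') \<le> entropy_dist G X Y + entropy_dist G X' Y' + e"
    using p(4) q(4) by simp
qed

lemma Field_Restr: "Field (Restr G S) = S \<inter> Field G"
  using reflG by (auto simp: Field_def)

text \<open>A fan restricts to the remaining objects, and forgetting objects drops nonnegative terms
  from its cost.\<close>

lemma entropy_dist_Restr: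
  assumes X: "is_diagram G X" and Y: "is_diagram G Y"
  shows "entropy_dist (Restr G S) X Y \<le> entropy_dist G X Y"
  unfolding entropy_dist_def
proof (rule cInf_mono[OF fans_nonempty[OF X Y] bdd_below_fans])
  fix b assume "b \<in> {ent_diff G Z X + ent_diff G Z Y | Z f g. is_diagram G Z \<and> diagram_mor G Z X f \<and> diagram_mor G Z Y g}"
  then obtain Z f g where *: "b = ent_diff G Z X + ent_diff G Z Y" "is_diagram G Z" "diagram_mor G Z X f" "diagram_mor G Z Y g" by auto
  have "is_diagram (Restr G S) Z" using *(2) unfolding is_diagram_def Field_Restr by blast
  moreover have "diagram_mor (Restr G S) Z X f" "diagram_mor (Restr G S) Z Y g"
    using *(3,4) unfolding diagram_mor_def Field_Restr by blast+
  moreover have "ent_diff (Restr G S) Z X + ent_diff (Restr G S) Z Y \<le> b"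
    unfolding *(1) ent_diff_def Field_Restr by (intro add_mono sum_mono2 fin) auto
  ultimately show "\<exists>a\<in>{ent_diff (Restr G S) Z X + ent_diff (Restr G S) Z Y | Z f g. is_diagram (Restr G S) Z \<and>
      diagram_mor (Restr G S) Z X f \<and> diagram_mor (Restr G S) Z Y g}. a \<le> b" by blast
qed

lemma is_diagram_Restr: "is_diagram G X \<Longrightarrow> is_diagram (Restr G S) X"
  unfolding is_diagram_def Field_Restr by blast

text \<open>\<open>x\<close> is initial among its descendants, so what is proved here for
  \<open>G\<close> is also available over the descendants of \<open>x\<close>, where the subdiagram
  and the conditional diagram live.\<close>

lemma initial_index_Restr: "x \<in> Field G \<Longrightarrow> initial_index (Restr G (descendants G x)) x"
  using reflG[of x] fin Partial_order_Restr[OF po]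
  by (intro initial_index.intro) (auto simp: Field_Restr initial_def descendants_def)

end


section \<open>Almost subadditive sequences\<close>

text \<open>\<open>(11/10)^4 = 1.4641\<close>. The factor \<open>11/10\<close> is the gain from
  splitting a number into two parts of ratio at most 2.\<close>

lemma powr_quarter_ge: "11 / 10 \<le> (3 / 2 :: real) powr (1 / 4)"
proof -
  have "(11 / 10 :: real) = ((11 / 10) powr 4) powr (1 / 4)" by (simp only: powr_powr) simp
  also have "\<dots> \<le> (3 / 2) powr (1 / 4)"
    by (rule powr_mono2) (auto simp: powr_numeral power4_eq_xxxx)
  finally show ?thesis .
qed

text \<open>Each part is at most two thirds of the total, so its power \<open>-1/4\<close> is at
  least \<open>(3/2) powr (1/4)\<close> times that of the total.\<close>

lemma powr_three_quarters_split:
  fixes p q :: real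
  assumes "p > 0" "q > 0" "p \<le> 2 * q" "q \<le> 2 * p"
  shows "11 / 10 * (p + q) powr (3/4) \<le> p powr (3/4) + q powr (3/4)"
proof -
  have *: "x * (11 / 10 * (p + q) powr (-1/4)) \<le> x powr (3/4)" if x: "x > 0" "x \<le> 2 / 3 * (p + q)" for x
  proof -
    have "11 / 10 * (p + q) powr (-1/4) \<le> (3 / 2) powr (1 / 4) * (p + q) powr (-1/4)"
      by (intro mult_right_mono powr_quarter_ge) auto
    also have "\<dots> = (2 / 3 * (p + q)) powr (-1/4)"
    proof -
      have "(2 / 3 :: real) powr (-1/4) = (3 / 2) powr (1 / 4)"
        by (simp add: powr_minus powr_divide)
      moreover have "(2 / 3 * (p + q)) powr (-1/4) = (2 / 3) powr (-1/4) * (p + q) powr (-1/4)"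
        using assms by (subst powr_mult) auto
      ultimately show ?thesis by simp
    qed
    also have "\<dots> \<le> x powr (-1/4)" using x assms by (intro powr_mono2') auto
    finally have "x * (11 / 10 * (p + q) powr (-1/4)) \<le> x powr 1 * x powr (-1/4)"
      using x by (intro mult_mono) auto
    also have "\<dots> = x powr (3/4)" unfolding powr_add[symmetric] by simp
    finally show ?thesis .
  qed
  have "(p + q) powr (3/4) = (p + q) * (p + q) powr (-1/4)"
    using assms powr_add[of "p + q" 1 "-1/4"] by simp
  hence "11 / 10 * (p + q) powr (3/4) = p * (11 / 10 * (p + q) powr (-1/4)) + q * (11 / 10 * (p + q) powr (-1/4))"
    by (simp add: algebra_simps)
  also have "\<dots> \<le> p powr (3/4) + q powr (3/4)"
    using assms by (intro add_mono *) auto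
  finally show ?thesis .
qed

text \<open>Induction by halving. The term \<open>- 10 C q powr (3/4)\<close> is carried along to
  pay for the new error: splitting gains a tenth of \<open>10 C q powr (3/4)\<close>, which is the
  defect of one step.\<close>

lemma almost_subadditive_multiple:
  fixes a :: "nat \<Rightarrow> real"
  assumes sub: "\<And>m n. a (m + n) \<le> a m + a n + C * real (m + n) powr (3/4)" and C: "C \<ge> 0" and q: "q \<ge> 1"
  shows "a q \<le> q * a 1 + 10 * C * (q - q powr (3/4))"
  using q
proof (induction q rule: less_induct)
  case (less q)
  show ?case
  proof (cases "q = 1")
    case False
    \<comment> \<open>For \<open>q \<ge> 2\<close> the two halves have ratio at most 2; the extreme
      case is \<open>3 = 1 + 2\<close>.\<close>
    define p r where "p = q div 2" and "r = q - p"
    have pr: "q = p + r" "p \<ge> 1" "r \<ge> 1" "p < q" "r < q" "p \<le> 2 * r" "r \<le> 2 * p"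
      using less.prems False by (auto simp: p_def r_def)
    have "a q \<le> a p + a r + C * real q powr (3/4)" unfolding pr(1) by (rule sub)
    also have "\<dots> \<le> (p * a 1 + 10 * C * (p - p powr (3/4))) + (r * a 1 + 10 * C * (r - r powr (3/4))) + C * real q powr (3/4)"
      using less.IH[of p] less.IH[of r] pr by (intro add_mono order.refl) auto
    also have "\<dots> = q * a 1 + 10 * C * q - 10 * C * (p powr (3/4) + r powr (3/4) - 1/10 * q powr (3/4))"
      unfolding pr(1) by (simp add: algebra_simps)
    also have "\<dots> \<le> q * a 1 + 10 * C * q - 10 * C * q powr (3/4)"
    proof -
      have "11 / 10 * real q powr (3/4) \<le> p powr (3/4) + r powr (3/4)"
        unfolding pr(1) of_nat_add by (rule powr_three_quarters_split) (use pr in linarith)+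
      hence "10 * C * q powr (3/4) \<le> 10 * C * (p powr (3/4) + r powr (3/4) - 1/10 * q powr (3/4))"
        using C by (intro mult_left_mono) auto
      thus ?thesis by simp
    qed
    finally show ?thesis by (simp add: algebra_simps)
  qed simp
qed

text \<open>The sequence sampled at multiples of \<open>N\<close> satisfies the hypothesis with
  constant \<open>C * N powr (3/4)\<close>, so each block of length \<open>N\<close> contributes an
  error of that order, however many blocks there are.\<close>

lemma almost_subadditive_multiple':
  fixes a :: "nat \<Rightarrow> real"
  assumes sub: "\<And>m n. a (m + n) \<le> a m + a n + C * real (m + n) powr (3/4)" and C: "C \<ge> 0" and q: "q \<ge> 1"
  shows "a (q * N) \<le> q * (a N + 10 * C * real N powr (3/4))"
proof -
  have "a (q * N) \<le> q * a (1 * N) + 10 * (C * real N powr (3/4)) * (q - q powr (3/4))"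
  proof (rule almost_subadditive_multiple[OF _ _ q])
    fix m n
    have "a (m * N + n * N) \<le> a (m * N) + a (n * N) + C * real (m * N + n * N) powr (3/4)" by (rule sub)
    also have "real (m * N + n * N) powr (3/4) = real N powr (3/4) * real (m + n) powr (3/4)"
      by (subst powr_mult[symmetric]) (auto simp: algebra_simps)
    finally show "a ((m + n) * N) \<le> a (m * N) + a (n * N) + C * real N powr (3/4) * real (m + n) powr (3/4)"
      by (simp add: distrib_right mult.assoc)
  qed (use C in auto)
  also have "\<dots> \<le> q * a N + 10 * (C * real N powr (3/4)) * q"
    using C by (intro add_mono mult_left_mono) auto
  finally show ?thesis by (simp add: algebra_simps)
qed

text \<open>Fekete's argument; the limit is the infimum of corrected averages.\<close>

lemma almost_subadditive_convergent:
  fixes a :: "nat \<Rightarrow> real"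
  assumes sub: "\<And>m n. a (m + n) \<le> a m + a n + C * real (m + n) powr (3/4)" and C: "C \<ge> 0"
    and nn: "\<And>n. a n \<ge> 0"
  shows "convergent (\<lambda>n. a n / real n)"
proof -
  \<comment> \<open>\<open>c N\<close> bounds \<open>a (q * N) / (q * N)\<close> for all
    \<open>q \<ge> 1\<close>. Its infimum is the limit: from above by division with remainder, from
    below because \<open>a n / n\<close> is \<open>c n\<close> less a vanishing term.\<close>
  define c where "c N = a N / real N + 10 * C * real N powr (-1/4)" for N
  define L where "L = Inf (c ` {1..})"
  have c0: "c N \<ge> 0" for N unfolding c_def using nn C by simp
  have Lle: "L \<le> c N" if "N \<ge> 1" for N
    unfolding L_def using that c0 by (intro cInf_lower bdd_belowI[of _ 0]) auto
  have small: "(\<lambda>n. K * real n powr (-1/4)) \<longlonglongrightarrow> 0" for K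
    by (rule tendsto_mult_right_zero, rule tendsto_neg_powr, simp, rule filterlim_real_sequentially)
  have "(\<lambda>n. a n / real n) \<longlonglongrightarrow> L"
  proof (rule LIMSEQ_I)
    fix e :: real assume e: "e > 0"
    have "Inf (c ` {1..}) < L + e / 3" unfolding L_def using e by simp
    from cInf_lessD[OF _ this] obtain N where N: "N \<ge> 1" "c N < L + e / 3" by auto
    \<comment> \<open>\<open>A\<close> bounds \<open>a r\<close> for every remainder
      \<open>r < N\<close>.\<close>
    define A where "A = (\<Sum>r<N. a r)"
    have up: "a n / real n \<le> c N + A / real n + C * real n powr (-1/4)" if n: "n \<ge> N" for n
    proof -
      define q r where "q = n div N" and "r = n mod N"
      have qr: "n = q * N + r" "q \<ge> 1" "r < N"
        using N n by (auto simp: q_def r_def div_greater_zero_iff Suc_le_eq)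
      have n0: "real n > 0" using n N by simp
      have "a r \<le> A" unfolding A_def using qr nn by (intro member_le_sum) auto
      moreover have "a n \<le> a (q * N) + a r + C * real n powr (3/4)" unfolding qr(1) by (rule sub)
      moreover have "a (q * N) \<le> q * (a N + 10 * C * real N powr (3/4))"
        by (rule almost_subadditive_multiple'[OF sub C qr(2)])
      moreover have "a N + 10 * C * real N powr (3/4) = N * c N"
        using N by (simp add: c_def field_simps powr_add[symmetric] powr_mult_base)
      ultimately have "a n \<le> (q * N) * c N + A + C * real n powr (3/4)" by simp
      also have "\<dots> \<le> n * c N + A + C * real n powr (3/4)"
        using c0 qr(1) by (intro add_mono mult_right_mono) (auto simp flip: of_nat_mult)
      also have "\<dots> = n * (c N + A / real n + C * real n powr (-1/4))"
        using n0 by (simp add: field_simps powr_mult_base)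
      finally show ?thesis using n0 by (simp add: pos_divide_le_eq mult.commute)
    qed
    have lo: "L - 10 * C * real n powr (-1/4) \<le> a n / real n" if "n \<ge> 1" for n
      using Lle[OF that] by (simp add: c_def)
    have "(\<lambda>n. A / real n) \<longlonglongrightarrow> 0" by (rule lim_const_over_n)
    from LIMSEQ_D[OF this, of "e/3"] e obtain n1 where n1: "\<And>n. n \<ge> n1 \<Longrightarrow> \<bar>A / real n\<bar> < e / 3" by auto
    from LIMSEQ_D[OF small[of C], of "e/3"] e obtain n2 where n2: "\<And>n. n \<ge> n2 \<Longrightarrow> \<bar>C * real n powr (-1/4)\<bar> < e / 3" by auto
    from LIMSEQ_D[OF small[of "10 * C"], of "e/3"] e obtain n3 where n3: "\<And>n. n \<ge> n3 \<Longrightarrow> \<bar>10 * C * real n powr (-1/4)\<bar> < e / 3" by auto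
    show "\<exists>no. \<forall>n\<ge>no. norm (a n / real n - L) < e"
    proof (intro exI allI impI)
      fix n assume n: "n \<ge> Max {N, n1, n2, n3}"
      hence ge: "n \<ge> N" "n \<ge> n1" "n \<ge> n2" "n \<ge> n3" "n \<ge> 1" using N by auto
      show "norm (a n / real n - L) < e"
        using up[OF ge(1)] lo[OF ge(5)] n1[OF ge(2)] n2[OF ge(3)] n3[OF ge(4)] N(2) e
        unfolding real_norm_def by linarith
    qed
  qed
  thus ?thesis by (rule convergentI)
qed


section \<open>Quasi-linear sequences and their classes\<close>

lemma powr_three_quarters_mono: "m \<le> n \<Longrightarrow> real m powr (3/4) \<le> real n powr (3/4)"
  by (intro powr_mono2) auto

context initial_index begin

lemma quasi_linear_diagram: "quasi_linear G X \<Longrightarrow> is_diagram G (X n)"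
  by (auto simp: quasi_linear_def)

lemma quasi_linearD:
  "quasi_linear G X \<Longrightarrow> \<exists>C>0. \<forall>m n. entropy_dist G (tensor (X m) (X n)) (X (m + n)) \<le> C * real (m + n) powr (3/4)"
  by (simp add: quasi_linear_def)

text \<open>The path goes from \<open>X (m + n)\<close> to the tensor of its parts, across to the
  parts of \<open>Y\<close>, and on to \<open>Y (m + n)\<close>. This makes the limit in the
  asymptotic distance exist.\<close>

lemma entropy_dist_almost_subadditive:
  assumes X: "quasi_linear G X" and Y: "quasi_linear G Y"
  shows "\<exists>C\<ge>0. \<forall>m n. entropy_dist G (X (m + n)) (Y (m + n)) \<le>
    entropy_dist G (X m) (Y m) + entropy_dist G (X n) (Y n) + C * real (m + n) powr (3/4)"
proof -
  obtain C1 where C1: "C1 > 0" "\<And>m n. entropy_dist G (tensor (X m) (X n)) (X (m + n)) \<le> C1 * real (m + n) powr (3/4)"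
    using quasi_linearD[OF X] by blast
  obtain C2 where C2: "C2 > 0" "\<And>m n. entropy_dist G (tensor (Y m) (Y n)) (Y (m + n)) \<le> C2 * real (m + n) powr (3/4)"
    using quasi_linearD[OF Y] by blast
  note d = quasi_linear_diagram[OF X] quasi_linear_diagram[OF Y]
  show ?thesis
  proof (intro exI[of _ "C1 + C2"] conjI allI)
    fix m n
    have "entropy_dist G (X (m + n)) (Y (m + n)) \<le> entropy_dist G (X (m + n)) (tensor (X m) (X n)) +
      (entropy_dist G (tensor (X m) (X n)) (tensor (Y m) (Y n)) + entropy_dist G (tensor (Y m) (Y n)) (Y (m + n)))"
      by (intro order.trans[OF entropy_dist_triangle[of _ "tensor (X m) (X n)"]] add_left_mono entropy_dist_triangle d is_diagram_tensor)
    also have "\<dots> \<le> C1 * real (m + n) powr (3/4) + ((entropy_dist G (X m) (Y m) + entropy_dist G (X n) (Y n)) + C2 * real (m + n) powr (3/4))"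
      by (intro add_mono C2 entropy_dist_tensor d) (subst entropy_dist_commute, rule C1)
    finally show "entropy_dist G (X (m + n)) (Y (m + n)) \<le> entropy_dist G (X m) (Y m) + entropy_dist G (X n) (Y n)
      + (C1 + C2) * real (m + n) powr (3/4)" by (simp add: algebra_simps)
  qed (use C1 C2 in auto)
qed

lemma asym_entropy_dist_lim:
  assumes X: "quasi_linear G X" and Y: "quasi_linear G Y"
  shows "(\<lambda>n. entropy_dist G (X n) (Y n) / real n) \<longlonglongrightarrow> asym_entropy_dist G X Y"
proof -
  obtain C where C: "C \<ge> 0" "\<And>m n. entropy_dist G (X (m + n)) (Y (m + n)) \<le>
    entropy_dist G (X m) (Y m) + entropy_dist G (X n) (Y n) + C * real (m + n) powr (3/4)"
    using entropy_dist_almost_subadditive[OF X Y] by blast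
  have "convergent (\<lambda>n. entropy_dist G (X n) (Y n) / real n)"
    by (rule almost_subadditive_convergent[OF C(2,1)]) (intro entropy_dist_nonneg quasi_linear_diagram X Y)
  thus ?thesis unfolding asym_entropy_dist_def by (simp add: convergent_LIMSEQ_iff)
qed

lemma asym_entropy_dist_le:
  assumes X: "quasi_linear G X" and Y: "quasi_linear G Y"
    and "\<And>n. entropy_dist G (X n) (Y n) \<le> f n" and "(\<lambda>n. f n / real n) \<longlonglongrightarrow> c"
  shows "asym_entropy_dist G X Y \<le> c"
  by (rule LIMSEQ_le[OF asym_entropy_dist_lim[OF X Y] assms(4)]) (use assms(3) in \<open>auto intro!: divide_right_mono\<close>)

lemma asym_entropy_dist_nonneg: "quasi_linear G X \<Longrightarrow> quasi_linear G Y \<Longrightarrow> 0 \<le> asym_entropy_dist G X Y"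
  by (rule LIMSEQ_le_const[OF asym_entropy_dist_lim]) (auto intro!: divide_nonneg_nonneg entropy_dist_nonneg quasi_linear_diagram)

lemma asym_entropy_dist_commute: "asym_entropy_dist G X Y = asym_entropy_dist G Y X"
  unfolding asym_entropy_dist_def by (simp add: entropy_dist_commute)

lemma asym_entropy_dist_eq_0:
  assumes X: "quasi_linear G X" and Y: "quasi_linear G Y" and "\<And>n. entropy_dist G (X n) (Y n) = 0"
  shows "asym_entropy_dist G X Y = 0"
  by (rule antisym[OF asym_entropy_dist_le[OF X Y, of "\<lambda>_. 0"] asym_entropy_dist_nonneg[OF X Y]]) (auto simp: assms(3))

lemma asym_entropy_dist_triangle:
  assumes X: "quasi_linear G X" and Y: "quasi_linear G Y" and Z: "quasi_linear G Z"
  shows "asym_entropy_dist G X Z \<le> asym_entropy_dist G X Y + asym_entropy_dist G Y Z"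
proof (rule asym_entropy_dist_le[OF X Z])
  show "(\<lambda>n. (entropy_dist G (X n) (Y n) + entropy_dist G (Y n) (Z n)) / real n)
     \<longlonglongrightarrow> asym_entropy_dist G X Y + asym_entropy_dist G Y Z"
    unfolding add_divide_distrib by (intro tendsto_add asym_entropy_dist_lim X Y Z)
qed (intro entropy_dist_triangle quasi_linear_diagram X Y Z)

lemma equiv_asym_eq: "equiv {X. quasi_linear G X} (asym_eq G)"
proof (rule equivI)
  show "refl_on {X. quasi_linear G X} (asym_eq G)"
    unfolding refl_on_def asym_eq_def
    by (auto intro!: asym_entropy_dist_eq_0 entropy_dist_self quasi_linear_diagram)
  show "sym (asym_eq G)" by (auto simp: sym_def asym_eq_def asym_entropy_dist_commute)
  show "trans (asym_eq G)"
  proof (rule transI)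
    fix X Y Z assume "(X, Y) \<in> asym_eq G" "(Y, Z) \<in> asym_eq G"
    thus "(X, Z) \<in> asym_eq G"
      using asym_entropy_dist_triangle[of X Y Z] asym_entropy_dist_nonneg[of X Z] by (auto simp: asym_eq_def)
  qed
qed (auto simp: asym_eq_def)

section \<open>Classes of quasi-linear sequences, their distance, entropy and restriction\<close>

abbreviation cls :: "(nat \<Rightarrow> 'i diagram) \<Rightarrow> 'i tropical" where "cls X \<equiv> asym_eq G `` {X}"

lemma cls_tropical: "quasi_linear G X \<Longrightarrow> cls X \<in> tropical G"
  unfolding tropical_def by (rule quotientI) simp

lemma cls_self: "quasi_linear G X \<Longrightarrow> X \<in> cls X"
  using equiv_class_self[OF equiv_asym_eq] by simp

lemma tropical_cls: "T \<in> tropical G \<Longrightarrow> X \<in> T \<Longrightarrow> T = cls X"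
  unfolding tropical_def by (erule quotientE) (simp add: equiv_class_eq[OF equiv_asym_eq])

lemma tropical_quasi_linear: "T \<in> tropical G \<Longrightarrow> X \<in> T \<Longrightarrow> quasi_linear G X"
  using in_quotient_imp_subset[OF equiv_asym_eq] unfolding tropical_def by blast

lemma tropical_nonempty: "T \<in> tropical G \<Longrightarrow> \<exists>X. X \<in> T"
  using in_quotient_imp_non_empty[OF equiv_asym_eq] unfolding tropical_def by blast

lemma cls_eq: "quasi_linear G X \<Longrightarrow> quasi_linear G Y \<Longrightarrow> asym_entropy_dist G X Y = 0 \<Longrightarrow> cls X = cls Y"
  by (rule equiv_class_eq[OF equiv_asym_eq]) (simp add: asym_eq_def)

lemma tropical_dist_0: "T \<in> tropical G \<Longrightarrow> X \<in> T \<Longrightarrow> Y \<in> T \<Longrightarrow> asym_entropy_dist G X Y = 0"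
  using quotient_eq_iff[OF equiv_asym_eq, of T T X Y] by (auto simp: tropical_def asym_eq_def)

text \<open>All pairs of representatives give the same value by the triangle inequality, so
  \<open>the_elem\<close> is applied to a singleton.\<close>

lemma trop_dist_eq:
  assumes S: "S \<in> tropical G" "X \<in> S" and T: "T \<in> tropical G" "Y \<in> T"
  shows "trop_dist G S T = asym_entropy_dist G X Y"
proof -
  have "asym_entropy_dist G X' Y' \<le> asym_entropy_dist G X Y"
    if "X \<in> S" "Y \<in> T" "X' \<in> S" "Y' \<in> T" for X Y X' Y'
    using asym_entropy_dist_triangle[of X' X Y'] asym_entropy_dist_triangle[of X Y Y']
      tropical_dist_0[OF S(1), of X' X] tropical_dist_0[OF T(1), of Y Y'] that
      tropical_quasi_linear[OF S(1)] tropical_quasi_linear[OF T(1)] by fastforce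
  hence "{asym_entropy_dist G X Y | X Y. X \<in> S \<and> Y \<in> T} = {asym_entropy_dist G X Y}"
    using S(2) T(2) by (auto intro!: antisym)
  thus ?thesis by (simp add: trop_dist_def)
qed

lemma trop_dist_cls: "quasi_linear G X \<Longrightarrow> quasi_linear G Y \<Longrightarrow> trop_dist G (cls X) (cls Y) = asym_entropy_dist G X Y"
  by (intro trop_dist_eq cls_tropical cls_self)

lemma trop_dist_nonneg: "S \<in> tropical G \<Longrightarrow> T \<in> tropical G \<Longrightarrow> 0 \<le> trop_dist G S T"
  using tropical_nonempty[of S] tropical_nonempty[of T]
  by (auto simp: trop_dist_eq intro!: asym_entropy_dist_nonneg intro: tropical_quasi_linear)

lemma trop_dist_commute: "S \<in> tropical G \<Longrightarrow> T \<in> tropical G \<Longrightarrow> trop_dist G S T = trop_dist G T S"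
  using tropical_nonempty[of S] tropical_nonempty[of T]
  by (auto simp: trop_dist_eq intro: asym_entropy_dist_commute)

lemma trop_dist_triangle:
  assumes "R \<in> tropical G" "S \<in> tropical G" "T \<in> tropical G"
  shows "trop_dist G R T \<le> trop_dist G R S + trop_dist G S T"
proof -
  obtain X Y Z where "X \<in> R" "Y \<in> S" "Z \<in> T" using tropical_nonempty assms by metis
  thus ?thesis using assms by (simp add: trop_dist_eq asym_entropy_dist_triangle tropical_quasi_linear)
qed

lemma Ent_convergent:
  assumes X: "quasi_linear G X" and i: "i \<in> Field G"
  shows "convergent (\<lambda>n. Ent (sp (X n) i) / real n)"
proof -
  obtain C where C: "C > 0" "\<And>m n. entropy_dist G (tensor (X m) (X n)) (X (m + n)) \<le> C * real (m + n) powr (3/4)"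
    using quasi_linearD[OF X] by blast
  note d = quasi_linear_diagram[OF X]
  show ?thesis
  proof (rule almost_subadditive_convergent)
    fix m n
    have "\<bar>Ent (sp (tensor (X m) (X n)) i) - Ent (sp (X (m + n)) i)\<bar> \<le> C * real (m + n) powr (3/4)"
      by (rule order.trans[OF Ent_diff_le C(2)]) (intro d is_diagram_tensor i)+
    thus "Ent (sp (X (m + n)) i) \<le> Ent (sp (X m) i) + Ent (sp (X n) i) + C * real (m + n) powr (3/4)"
      using Ent_tensor[of "X m" i "X n"] is_diagram_finite[OF d i] by simp
  qed (use C in \<open>auto simp: Ent_eq_ent ent_nonneg\<close>)
qed

lemma trop_ent_lim:
  assumes T: "T \<in> tropical G" "X \<in> T" and i: "i \<in> Field G"
  shows "(\<lambda>n. Ent (sp (X n) i) / real n) \<longlonglongrightarrow> trop_ent T i"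
proof -
  have lim: "(\<lambda>n. Ent (sp (Y n) i) / real n) \<longlonglongrightarrow> lim (\<lambda>n. Ent (sp (Y n) i) / real n)" if "Y \<in> T" for Y
    using Ent_convergent[OF tropical_quasi_linear[OF T(1) that] i] by (simp add: convergent_LIMSEQ_iff)
  define L where "L = lim (\<lambda>n. Ent (sp (X n) i) / real n)"
  have "lim (\<lambda>n. Ent (sp (Y n) i) / real n) = L" if Y: "Y \<in> T" for Y
  proof -
    note q = tropical_quasi_linear[OF T] tropical_quasi_linear[OF T(1) Y]
    have "(\<lambda>n. Ent (sp (Y n) i) / real n - Ent (sp (X n) i) / real n) \<longlonglongrightarrow> 0"
    proof (rule Lim_null_comparison)
      show "(\<lambda>n. entropy_dist G (Y n) (X n) / real n) \<longlonglongrightarrow> 0"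
        using asym_entropy_dist_lim[OF q(2,1)] tropical_dist_0[OF T(1) Y T(2)] by simp
      show "\<forall>\<^sub>F n in sequentially. norm (Ent (sp (Y n) i) / real n - Ent (sp (X n) i) / real n) \<le> entropy_dist G (Y n) (X n) / real n"
        using Ent_diff_le[OF quasi_linear_diagram[OF q(2)] quasi_linear_diagram[OF q(1)] i]
        by (auto simp flip: diff_divide_distrib intro!: always_eventually divide_right_mono)
    qed
    from LIMSEQ_unique[OF tendsto_diff[OF lim[OF Y] lim[OF T(2)]] this] show ?thesis by (simp add: L_def)
  qed
  hence "(\<lambda>X. lim (\<lambda>n. Ent (sp (X n) i) / real n)) ` T = {L}"
    using T(2) by auto
  thus ?thesis using lim[OF T(2)] by (simp add: trop_ent_def flip: L_def)
qed

text \<open>A perturbation of the order of the allowed defect is harmless. It enters at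
  \<open>m\<close>, at \<open>n\<close> and at \<open>m + n\<close>, whence
  \<open>C + 3 * K\<close>.\<close>

lemma quasi_linear_close:
  assumes X: "quasi_linear G X" and Y: "\<And>n. is_diagram G (Y n)"
    and close: "\<And>n. entropy_dist G (X n) (Y n) \<le> K * real n powr (3/4)" and K: "K \<ge> 0"
  shows "quasi_linear G Y"
proof -
  obtain C where C: "C > 0" "\<And>m n. entropy_dist G (tensor (X m) (X n)) (X (m + n)) \<le> C * real (m + n) powr (3/4)"
    using quasi_linearD[OF X] by blast
  note d = quasi_linear_diagram[OF X] Y
  have "entropy_dist G (tensor (Y m) (Y n)) (Y (m + n)) \<le> (C + 3 * K) * real (m + n) powr (3/4)" for m n
  proof -
    have "entropy_dist G (tensor (Y m) (Y n)) (Y (m + n)) \<le> entropy_dist G (tensor (Y m) (Y n)) (tensor (X m) (X n))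
      + (entropy_dist G (tensor (X m) (X n)) (X (m + n)) + entropy_dist G (X (m + n)) (Y (m + n)))"
      by (intro order.trans[OF entropy_dist_triangle[of _ "tensor (X m) (X n)"]] add_left_mono entropy_dist_triangle d is_diagram_tensor)
    also have "\<dots> \<le> (K * real m powr (3/4) + K * real n powr (3/4)) + (C * real (m + n) powr (3/4) + K * real (m + n) powr (3/4))"
      using close by (intro add_mono C close order.trans[OF entropy_dist_tensor] d) (auto simp: entropy_dist_commute)
    also have "\<dots> \<le> (K * real (m + n) powr (3/4) + K * real (m + n) powr (3/4)) + (C * real (m + n) powr (3/4) + K * real (m + n) powr (3/4))"
      using K by (intro add_mono mult_left_mono powr_three_quarters_mono order.refl) auto
    finally show ?thesis by (simp add: algebra_simps)
  qed
  thus ?thesis unfolding quasi_linear_def using Y C(1) K by (intro conjI allI exI[of _ "C + 3 * K"]) auto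
qed

text \<open>Exchanging the two middle factors is a morphism that preserves all entropies.\<close>

lemma tensor_interchange:
  assumes "is_diagram G A" "is_diagram G B" "is_diagram G C" "is_diagram G D"
  shows "entropy_dist G (tensor (tensor A B) (tensor C D)) (tensor (tensor A C) (tensor B D)) = 0"
proof (rule entropy_dist_eq_0)
  let ?f = "\<lambda>((a, b), (c, d)). ((a, c), (b, d))"
  let ?e = "prod_encode \<circ> map_prod prod_encode prod_encode" and ?d = "map_prod prod_decode prod_decode \<circ> prod_decode"
  have swap: "map_pmf ?f (pair_pmf (pair_pmf p q) (pair_pmf r s)) = pair_pmf (pair_pmf p r) (pair_pmf q s)"
    for p q r s :: "nat pmf"
  proof (rule pmf_eqI)
    fix w :: "(nat \<times> nat) \<times> (nat \<times> nat)"
    obtain a c b d where w: "w = ((a, c), (b, d))" by (cases w) auto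
    have "pmf (map_pmf ?f (pair_pmf (pair_pmf p q) (pair_pmf r s))) (?f ((a, b), (c, d))) =
      pmf (pair_pmf (pair_pmf p q) (pair_pmf r s)) ((a, b), (c, d))"
      by (rule pmf_map_inj') (auto simp: inj_on_def)
    thus "pmf (map_pmf ?f (pair_pmf (pair_pmf p q) (pair_pmf r s))) w = pmf (pair_pmf (pair_pmf p r) (pair_pmf q s)) w"
      by (simp add: w pmf_pair)
  qed
  have enc: "map_pmf prod_encode (pair_pmf (map_pmf prod_encode (pair_pmf p q)) (map_pmf prod_encode (pair_pmf r s))) =
     map_pmf ?e (pair_pmf (pair_pmf p q) (pair_pmf r s))" for p q r s :: "nat pmf"
    unfolding map_pair[symmetric] by (simp add: pmf.map_comp o_def map_prod_def case_prod_unfold)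
  have "map_pmf (?e \<circ> ?f \<circ> ?d) (sp (tensor (tensor A B) (tensor C D)) i) = sp (tensor (tensor A C) (tensor B D)) i" for i
  proof -
    have "map_pmf (?e \<circ> ?f \<circ> ?d) (sp (tensor (tensor A B) (tensor C D)) i) =
      map_pmf (?e \<circ> ?f) (pair_pmf (pair_pmf (sp A i) (sp B i)) (pair_pmf (sp C i) (sp D i)))"
    proof -
      have "?d (?e w) = w" for w by (cases w) simp
      thus ?thesis unfolding tensor_def diagram.simps enc by (simp only: pmf.map_comp o_def)
    qed
    also have "\<dots> = map_pmf ?e (pair_pmf (pair_pmf (sp A i) (sp C i)) (pair_pmf (sp B i) (sp D i)))"
      by (subst swap[symmetric]) (simp only: pmf.map_comp)
    finally show ?thesis unfolding tensor_def diagram.simps enc .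
  qed
  thus "diagram_mor G (tensor (tensor A B) (tensor C D)) (tensor (tensor A C) (tensor B D)) (\<lambda>_. ?e \<circ> ?f \<circ> ?d)"
    by (auto simp: diagram_mor_def reduction_def set_sp_tensor red_tensor simp del: o_apply) (auto simp: red_tensor)
  fix i assume i: "i \<in> Field G"
  show "Ent (sp (tensor (tensor A B) (tensor C D)) i) \<le> Ent (sp (tensor (tensor A C) (tensor B D)) i)"
    using assms[THEN is_diagram_finite, OF i] by (simp add: Ent_tensor set_sp_tensor)
qed (intro assms is_diagram_tensor)+

text \<open>Once the middle factors are exchanged, the two defects add.\<close>

lemma quasi_linear_tensor:
  assumes X: "quasi_linear G X" and Y: "quasi_linear G Y"
  shows "quasi_linear G (\<lambda>n. tensor (X n) (Y n))"
proof -
  obtain C1 where C1: "C1 > 0" "\<And>m n. entropy_dist G (tensor (X m) (X n)) (X (m + n)) \<le> C1 * real (m + n) powr (3/4)"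
    using quasi_linearD[OF X] by blast
  obtain C2 where C2: "C2 > 0" "\<And>m n. entropy_dist G (tensor (Y m) (Y n)) (Y (m + n)) \<le> C2 * real (m + n) powr (3/4)"
    using quasi_linearD[OF Y] by blast
  note d = quasi_linear_diagram[OF X] quasi_linear_diagram[OF Y]
  have "entropy_dist G (tensor (tensor (X m) (Y m)) (tensor (X n) (Y n))) (tensor (X (m + n)) (Y (m + n)))
     \<le> (C1 + C2) * real (m + n) powr (3/4)" for m n
  proof -
    have "entropy_dist G (tensor (tensor (X m) (Y m)) (tensor (X n) (Y n))) (tensor (X (m + n)) (Y (m + n)))
      \<le> 0 + entropy_dist G (tensor (tensor (X m) (X n)) (tensor (Y m) (Y n))) (tensor (X (m + n)) (Y (m + n)))"
      by (rule order.trans[OF entropy_dist_triangle[of _ "tensor (tensor (X m) (X n)) (tensor (Y m) (Y n))"]])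
        (intro add_mono d is_diagram_tensor order.refl eq_refl[OF tensor_interchange])+
    also have "\<dots> \<le> 0 + (C1 * real (m + n) powr (3/4) + C2 * real (m + n) powr (3/4))"
      by (intro add_mono order.refl order.trans[OF entropy_dist_tensor] C1 C2 d is_diagram_tensor)
    finally show ?thesis by (simp add: algebra_simps)
  qed
  thus ?thesis unfolding quasi_linear_def using d C1(1) C2(1)
    by (intro conjI allI exI[of _ "C1 + C2"] is_diagram_tensor) auto
qed

lemma quasi_linear_Restr:
  assumes "quasi_linear G X" shows "quasi_linear (Restr G S) X"
proof -
  obtain C where C: "C > 0" "\<And>m n. entropy_dist G (tensor (X m) (X n)) (X (m + n)) \<le> C * real (m + n) powr (3/4)"
    using quasi_linearD[OF assms] by blast
  have "entropy_dist (Restr G S) (tensor (X m) (X n)) (X (m + n)) \<le> C * real (m + n) powr (3/4)" for m n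
    by (rule order.trans[OF entropy_dist_Restr C(2)]) (intro is_diagram_tensor quasi_linear_diagram assms)+
  thus ?thesis unfolding quasi_linear_def using quasi_linear_diagram[OF assms] is_diagram_Restr C(1) by blast
qed

lemma asym_entropy_dist_Restr:
  assumes "x \<in> Field G" and X: "quasi_linear G X" and Y: "quasi_linear G Y"
  shows "asym_entropy_dist (Restr G (descendants G x)) X Y \<le> asym_entropy_dist G X Y"
proof -
  interpret R: initial_index "Restr G (descendants G x)" x by (rule initial_index_Restr) fact
  show ?thesis
    by (rule R.asym_entropy_dist_le[OF quasi_linear_Restr[OF X] quasi_linear_Restr[OF Y] _ asym_entropy_dist_lim[OF X Y]])
      (intro entropy_dist_Restr quasi_linear_diagram X Y)
qed

lemma trop_sub_eq:
  assumes x: "x \<in> Field G" and T: "T \<in> tropical G" "X \<in> T"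
  shows "trop_sub G (descendants G x) T = asym_eq (Restr G (descendants G x)) `` {X}"
proof -
  let ?R = "Restr G (descendants G x)"
  interpret R: initial_index ?R x by (rule initial_index_Restr) fact
  have "asym_eq ?R `` {Y} = asym_eq ?R `` {X}" if Y: "Y \<in> T" for Y
  proof (rule R.cls_eq)
    note q = tropical_quasi_linear[OF T] tropical_quasi_linear[OF T(1) Y]
    show "quasi_linear ?R Y" "quasi_linear ?R X" using q by (auto intro: quasi_linear_Restr)
    thus "asym_entropy_dist ?R Y X = 0"
      using asym_entropy_dist_Restr[OF x q(2,1)] tropical_dist_0[OF T(1) Y T(2)] R.asym_entropy_dist_nonneg by fastforce
  qed
  hence "asym_eq ?R `` T = asym_eq ?R `` {X}" using T(2) by blast
  thus ?thesis by (simp add: trop_sub_def)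
qed

end


section \<open>Sampling, noise and total variation\<close>

lemma expect_return: "expect (return_pmf a) f = f a"
  by (simp add: expect_def)

lemma finite_replicate_pmf: "finite (set_pmf p) \<Longrightarrow> finite (set_pmf (replicate_pmf n p))"
  using finite_lists_length_eq[of "set_pmf p" n] by (simp add: set_replicate_pmf lists_eq_set)

lemma expect_replicate_Suc:
  assumes "finite (set_pmf p)"
  shows "expect (replicate_pmf (Suc n) p) f = expect p (\<lambda>x. expect (replicate_pmf n p) (\<lambda>xs. f (x # xs)))"
  using assms finite_replicate_pmf[OF assms] by (simp add: expect_bind expect_return)

lemma expect_replicate_sum:
  assumes "finite (set_pmf p)"
  shows "expect (replicate_pmf n p) (\<lambda>xs. \<Sum>x\<leftarrow>xs. \<phi> x) = n * expect p \<phi>"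
proof (induction n)
  case (Suc n)
  show ?case
    unfolding expect_replicate_Suc[OF assms] using assms finite_replicate_pmf[OF assms]
    by (simp add: expect_add expect_const Suc distrib_right)
qed (simp add: expect_return)

text \<open>The cross terms vanish since \<open>\<phi>\<close> has mean 0.\<close>

lemma expect_replicate_square:
  assumes "finite (set_pmf p)" "expect p \<phi> = 0"
  shows "expect (replicate_pmf n p) (\<lambda>xs. (\<Sum>x\<leftarrow>xs. \<phi> x)\<^sup>2) = n * expect p (\<lambda>x. (\<phi> x)\<^sup>2)"
proof (induction n)
  case (Suc n)
  have "expect (replicate_pmf n p) (\<lambda>xs. (\<Sum>y\<leftarrow>x # xs. \<phi> y)\<^sup>2) = (\<phi> x)\<^sup>2 + n * expect p (\<lambda>x. (\<phi> x)\<^sup>2)" for x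
  proof -
    have "expect (replicate_pmf n p) (\<lambda>xs. (\<Sum>y\<leftarrow>x # xs. \<phi> y)\<^sup>2) =
      expect (replicate_pmf n p) (\<lambda>xs. ((\<phi> x)\<^sup>2 + 2 * \<phi> x * (\<Sum>y\<leftarrow>xs. \<phi> y)) + (\<Sum>y\<leftarrow>xs. \<phi> y)\<^sup>2)"
      by (simp add: power2_sum algebra_simps)
    thus ?thesis using assms finite_replicate_pmf[OF assms(1)]
      by (simp add: expect_add expect_const expect_cmult expect_replicate_sum Suc)
  qed
  thus ?case unfolding expect_replicate_Suc[OF assms(1)] using assms
    by (simp add: expect_add expect_const distrib_right)
qed (simp add: expect_return)

text \<open>A second moment controls the first by
  \<open>|f| \<le> f^2 / (2 t) + t / 2\<close>.\<close>

lemma expect_abs_le: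
  assumes "finite (set_pmf p)" "t > 0" "expect p (\<lambda>x. (f x)\<^sup>2) \<le> t\<^sup>2"
  shows "expect p (\<lambda>x. \<bar>f x\<bar>) \<le> t"
proof -
  have "\<bar>f x\<bar> \<le> (f x)\<^sup>2 * (1 / (2 * t)) + t / 2" for x
  proof -
    have "2 * t * \<bar>f x\<bar> \<le> (f x)\<^sup>2 + t\<^sup>2"
      using zero_le_power2[of "\<bar>f x\<bar> - t"] by (simp add: power2_diff algebra_simps)
    thus ?thesis using assms(2) by (simp add: field_simps power2_eq_square)
  qed
  hence "expect p (\<lambda>x. \<bar>f x\<bar>) \<le> expect p (\<lambda>x. 1 / (2 * t) * (f x)\<^sup>2 + t / 2)"
    by (intro expect_mono) (simp add: mult.commute)
  also have "\<dots> = 1 / (2 * t) * expect p (\<lambda>x. (f x)\<^sup>2) + t / 2"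
    using assms(1) by (simp only: expect_add expect_cmult expect_const)
  also have "\<dots> \<le> 1 / (2 * t) * t\<^sup>2 + t / 2"
    using assms by (intro add_mono mult_left_mono) auto
  also have "\<dots> = t" using assms(2) by (simp add: power2_eq_square)
  finally show ?thesis .
qed

section \<open>Noisy predictions and Fano-type bounds\<close>

definition noisy :: "real \<Rightarrow> 'a set \<Rightarrow> 'a \<Rightarrow> 'a pmf" where
  "noisy e A x = bind_pmf (bernoulli_pmf e) (\<lambda>b. if b then pmf_of_set A else return_pmf x)"

lemma pmf_noisy:
  assumes "0 \<le> e" "e \<le> 1" "finite A" "y \<in> A"
  shows "pmf (noisy e A x) y = e / card A + (if x = y then 1 - e else 0)"
proof -
  have "A \<noteq> {}" using assms by auto
  thus ?thesis using assms by (auto simp: noisy_def pmf_bind indicator_def)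
qed

lemma pmf_noisy_pos:
  assumes "0 < e" "e \<le> 1/2" "finite A" "y \<in> A"
  shows "0 < pmf (noisy e A x) y"
proof -
  have "card A > 0" using assms by (auto simp: card_gt_0_iff)
  thus ?thesis using assms by (subst pmf_noisy) (auto intro!: add_pos_nonneg)
qed

text \<open>The kernel guesses \<open>x\<close> and spreads weight \<open>e\<close> uniformly over
  \<open>A\<close>, so that a wrong guess costs only \<open>ln (card A / e)\<close>; a right one
  costs at most \<open>- ln (1 - e) \<le> e + 2 e^2 \<le> 2 e\<close>, as
  \<open>e \<le> 1/2\<close>.\<close>

lemma noisy_cost:
  assumes e: "0 < e" "e \<le> 1/2" and A: "finite A" "y \<in> A"
  shows "- ln (pmf (noisy e A x) y) \<le> 2 * e + (if x = y then 0 else ln (card A / e))"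
proof -
  have c: "card A > 0" using A by (auto simp: card_gt_0_iff)
  hence e': "0 < e / card A" using e by simp
  show ?thesis
  proof (cases "x = y")
    case True
    have "ln (1 - e) \<le> ln (pmf (noisy e A x) y)"
      using e A e' True by (subst pmf_noisy) (auto intro!: ln_mono)
    moreover have "- e - 2 * e\<^sup>2 \<le> ln (1 - e)" using e by (intro ln_one_minus_pos_lower_bound) auto
    moreover have "2 * e\<^sup>2 \<le> e" using e mult_right_mono[of "2 * e" 1 e] by (simp add: power2_eq_square)
    ultimately show ?thesis using True by simp
  next
    case False
    hence "- ln (pmf (noisy e A x) y) = ln (card A / e)"
      using e A c by (simp add: pmf_noisy ln_div)
    thus ?thesis using False e by simp
  qed
qed

lemma cost_le_conditional:
  assumes fin: "finite (set_pmf q)"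
    and 1: "ent (map_pmf (\<lambda>w. (f w, g w)) q) \<le> ent (map_pmf f q) + c"
    and 2: "ent (map_pmf (\<lambda>w. (g w, f w)) q) \<le> ent (map_pmf g q) + c"
  shows "2 * ent (map_pmf (\<lambda>w. (f w, g w)) q) - ent (map_pmf f q) - ent (map_pmf g q) \<le> 2 * c"
proof -
  have "ent (map_pmf (\<lambda>w. (g w, f w)) q) = ent (map_pmf (\<lambda>w. (f w, g w)) q)"
    by (rule ent_cong[OF fin]) auto
  thus ?thesis using 1 2 by linarith
qed

text \<open>Fano's inequality: guessing \<open>g\<close> to be equal to \<open>f\<close> is a good
  prediction when the two rarely differ.\<close>

lemma ent_noisy_pair:
  assumes fin: "finite (set_pmf q)" and A: "finite A" "\<And>w. w \<in> set_pmf q \<Longrightarrow> g w \<in> A" and e: "0 < e" "e \<le> 1/2"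
  shows "ent (map_pmf (\<lambda>w. (f w, g w)) q) \<le> ent (map_pmf f q) +
    (2 * e + ln (card A / e) * expect q (\<lambda>w. if f w = g w then 0 else 1))"
proof -
  have "expect q (\<lambda>w. - ln (pmf (noisy e A (f w)) (g w))) \<le> expect q (\<lambda>w. 2 * e + ln (card A / e) * (if f w = g w then 0 else 1))"
    using A e by (intro expect_mono order.trans[OF noisy_cost]) auto
  also have "\<dots> = 2 * e + ln (card A / e) * expect q (\<lambda>w. if f w = g w then 0 else 1)"
    by (simp only: expect_add expect_cmult expect_const[OF fin])
  finally show ?thesis
    using ent_pair_le_kernel[OF fin, of "noisy e A" f g] pmf_noisy_pos[OF e A(1)] A(2) by fastforce
qed

text \<open>The maximal coupling: the common mass \<open>m\<close> stays in place, and the excess of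
  \<open>p\<close> is redistributed along the excess of \<open>q\<close>. The points differ with
  probability at most \<open>\<delta>\<close>, which is half of the sum on the right.\<close>

lemma tv_coupling:
  fixes p q :: "'a pmf"
  assumes A: "finite A" "set_pmf p \<subseteq> A" "set_pmf q \<subseteq> A"
  shows "\<exists>r. map_pmf fst r = p \<and> map_pmf snd r = q \<and>
    expect r (\<lambda>w. if fst w = snd w then 0 else 1) \<le> (\<Sum>a\<in>A. \<bar>pmf p a - pmf q a\<bar>)"
proof -
  define m where "m a = min (pmf p a) (pmf q a)" for a
  define \<delta> where "\<delta> = 1 - sum m A"
  have sp: "sum (pmf p) A = 1" and sq: "sum (pmf q) A = 1"
    using A by (auto simp: sum_pmf_eq_1)
  have d1: "\<delta> = (\<Sum>a\<in>A. pmf p a - m a)" and d2: "\<delta> = (\<Sum>a\<in>A. pmf q a - m a)"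
    by (simp_all add: \<delta>_def sum_subtractf sp sq)
  have mle: "0 \<le> m a" "m a \<le> pmf p a" "m a \<le> pmf q a" for a by (auto simp: m_def)
  have dle: "\<delta> \<le> (\<Sum>a\<in>A. \<bar>pmf p a - pmf q a\<bar>)"
    unfolding d1 by (intro sum_mono) (auto simp: m_def)
  have d0: "\<delta> \<ge> 0" unfolding d1 using mle by (intro sum_nonneg) auto
  have fp: "finite (set_pmf p)" using A finite_subset by blast
  show ?thesis
  \<comment> \<open>Without excess mass there is nothing to normalise; the two laws then
    coincide.\<close>
  proof (cases "\<delta> = 0")
    case True
    have "\<forall>a\<in>A. pmf p a - m a = 0" using True[unfolded d1] mle A(1) by (subst (asm) sum_nonneg_eq_0_iff) auto
    moreover have "\<forall>a\<in>A. pmf q a - m a = 0" using True[unfolded d2] mle A(1) by (subst (asm) sum_nonneg_eq_0_iff) auto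
    ultimately have "pmf p a = pmf q a" if "a \<in> A" for a using that by simp
    moreover have "pmf p a = pmf q a" if "a \<notin> A" for a
    proof -
      have "a \<notin> set_pmf p" "a \<notin> set_pmf q" using that A by auto
      thus ?thesis by (simp add: set_pmf_iff)
    qed
    ultimately have "pmf p a = pmf q a" for a by blast
    hence "p = q" by (rule pmf_eqI)
    moreover have "expect (map_pmf (\<lambda>a. (a, a)) p) (\<lambda>w. if fst w = snd w then 0 else 1) = 0"
      by (subst expect_map[OF fp]) (simp add: expect_const[OF fp])
    ultimately show ?thesis
      by (intro exI[of _ "map_pmf (\<lambda>a. (a, a)) p"]) (auto simp: pmf.map_comp o_def intro!: sum_nonneg)
  next
    case False
    hence dpos: "\<delta> > 0" using d0 by simp
    \<comment> \<open>The excess of \<open>q\<close>, normalised to a probability law.\<close>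
    define f where "f b = (pmf q b - m b) / \<delta>" for b
    have f0: "f b \<ge> 0" for b using mle dpos by (simp add: f_def)
    have fA: "f b = 0" if "b \<notin> A" for b
    proof -
      have "pmf q b = 0" using A(3) that by (auto simp: set_pmf_iff)
      thus ?thesis by (simp add: f_def m_def)
    qed
    have sf: "sum f A = 1" using dpos d2 by (simp add: f_def sum_divide_distrib[symmetric])
    have "(\<integral>\<^sup>+ x. ennreal (f x) \<partial>count_space UNIV) = (\<Sum>x\<in>A. ennreal (f x))"
      by (rule nn_integral_count_space'[OF A(1)]) (auto simp: fA)
    hence nu1: "(\<integral>\<^sup>+ x. ennreal (f x) \<partial>count_space UNIV) = 1" using f0 sf by (simp add: sum_ennreal)
    define \<nu> where "\<nu> = embed_pmf f"
    have \<nu>: "pmf \<nu> b = f b" for b unfolding \<nu>_def using f0 nu1 by (rule pmf_embed_pmf)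
    have s\<nu>: "set_pmf \<nu> \<subseteq> A" 
    proof
      fix x assume "x \<in> set_pmf \<nu>"
      hence "f x \<noteq> 0" using \<nu>[of x] by (simp add: set_pmf_iff)
      thus "x \<in> A" using fA[of x] by blast
    qed
    \<comment> \<open>Stay at \<open>a\<close> with the probability that keeps exactly the common
      mass; otherwise move to a point drawn from the normalised excess of \<open>q\<close>.\<close>
    define K where "K a = bind_pmf (bernoulli_pmf (m a / pmf p a)) (\<lambda>b. if b then return_pmf a else \<nu>)" for a
    have mp: "0 \<le> m a / pmf p a" "m a / pmf p a \<le> 1" for a
      using mle by (auto simp: divide_le_eq_1)
    have K: "pmf (K a) b = m a / pmf p a * (if a = b then 1 else 0) + (1 - m a / pmf p a) * f b" for a b
      using mp[of a] by (simp add: K_def pmf_bind \<nu> indicator_def)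
    have fK: "set_pmf (K a) \<subseteq> insert a A" for a using s\<nu> by (auto simp: K_def split: if_splits)
    have finK: "finite (set_pmf (K a))" for a using finite_subset[OF fK] A by auto
    define r where "r = bind_pmf p (\<lambda>a. map_pmf (Pair a) (K a))"
    have "map_pmf fst r = p" by (simp add: r_def map_bind_pmf pmf.map_comp o_def map_pmf_const bind_return_pmf')
    moreover have "map_pmf snd r = q"
    proof (rule pmf_eqI)
      fix b
      have "map_pmf snd r = bind_pmf p K" by (simp add: r_def map_bind_pmf pmf.map_comp o_def)
      hence "pmf (map_pmf snd r) b = (\<Sum>a\<in>A. pmf p a * pmf (K a) b)"
        unfolding pmf_bind using A by (simp add: pmf_bind integral_measure_pmf[of A] subset_iff)
      also have "\<dots> = (\<Sum>a\<in>A. (if a = b then m a else 0) + (pmf p a - m a) * f b)"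
      proof (rule sum.cong[OF refl])
        fix a
        have "pmf p a = 0 \<Longrightarrow> m a = 0" using mle[of a] by simp
        thus "pmf p a * pmf (K a) b = (if a = b then m a else 0) + (pmf p a - m a) * f b"
          unfolding K by (cases "pmf p a = 0") (auto simp: field_simps)
      qed
      also have "\<dots> = (if b \<in> A then m b else 0) + \<delta> * f b"
        using A(1) by (simp add: sum.distrib d1 sum_distrib_right)
      also have "\<dots> = pmf q b"
      proof (cases "b \<in> A")
        case True thus ?thesis using dpos by (simp add: f_def)
      next
        case False
        hence "pmf q b = 0" using A(3) by (auto simp: set_pmf_iff)
        thus ?thesis using False fA by simp
      qed
      finally show "pmf (map_pmf snd r) b = pmf q b" .
    qed
    moreover have "expect r (\<lambda>w. if fst w = snd w then 0 else 1) \<le> \<delta>"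
    proof -
      have "expect r (\<lambda>w. if fst w = snd w then 0 else 1) = expect p (\<lambda>a. expect (K a) (\<lambda>b. if a = b then 0 else 1))"
        unfolding r_def using fp finK by (subst expect_bind) (auto simp: expect_map)
      also have "\<dots> \<le> expect p (\<lambda>a. 1 - m a / pmf p a)"
      proof (rule expect_mono)
        fix a assume a: "a \<in> set_pmf p"
        have "expect (K a) (\<lambda>b. if a = b then 0 else 1) = (\<Sum>b\<in>A. pmf (K a) b * (if a = b then 0 else 1))"
          using fK a A by (intro expect_superset) auto
        also have "\<dots> = (\<Sum>b\<in>A. if a = b then 0 else (1 - m a / pmf p a) * f b)"
          by (rule sum.cong) (auto simp: K)
        also have "\<dots> \<le> (\<Sum>b\<in>A. (1 - m a / pmf p a) * f b)"
          using mp f0 by (intro sum_mono) auto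
        also have "\<dots> = 1 - m a / pmf p a" using sf by (simp add: sum_distrib_left[symmetric])
        finally show "expect (K a) (\<lambda>b. if a = b then 0 else 1) \<le> 1 - m a / pmf p a" .
      qed
      also have "\<dots> = (\<Sum>a\<in>set_pmf p. pmf p a - m a)"
        unfolding expect_def by (rule sum.cong) (auto simp: field_simps set_pmf_iff)
      also have "\<dots> \<le> \<delta>"
        unfolding d1 using A mle by (intro sum_mono2) auto
      finally show ?thesis .
    qed
    ultimately show ?thesis using dle by (intro exI[of _ r]) auto
  qed
qed


section \<open>Random translates of a density\<close>

text \<open>
  By the second moment method: at each point the density of a random translate has mean \<open>1 / card A\<close>
  and variance at most \<open>D / (card A)\<^sup>2\<close>.
\<close>

lemma average_of_translates:
  fixes \<Gamma> :: "('a \<Rightarrow> 'a) set" and p :: "'a pmf" and M :: nat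
  assumes A: "finite A" "A \<noteq> {}" and \<Gamma>: "finite \<Gamma>" "\<Gamma> \<noteq> {}"
    and inj: "\<And>g. g \<in> \<Gamma> \<Longrightarrow> inj_on g A"
    and unif: "\<And>a b. a \<in> A \<Longrightarrow> b \<in> A \<Longrightarrow> card {g \<in> \<Gamma>. g b = a} * card A = card \<Gamma>"
    and p: "set_pmf p \<subseteq> A" "\<And>a. a \<in> A \<Longrightarrow> pmf p a \<le> D / card A" and D: "D > 0" and M: "M > 0"
  shows "\<exists>gs. length gs = M \<and> set gs \<subseteq> \<Gamma> \<and>
    (\<Sum>a\<in>A. \<bar>(\<Sum>g\<leftarrow>gs. pmf (map_pmf g p) a) / M - 1 / card A\<bar>) \<le> sqrt (D / M)"
proof -
  let ?u = "pmf_of_set \<Gamma>" and ?n = "real (card A)"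
  define \<phi> where "\<phi> a g = pmf (map_pmf g p) a - 1 / ?n" for a :: 'a and g :: "'a \<Rightarrow> 'a"
  have n: "?n > 0" using A by (simp add: card_gt_0_iff)
  have c\<Gamma>: "real (card \<Gamma>) > 0" using \<Gamma> by (simp add: card_gt_0_iff)
  have finu: "finite (set_pmf ?u)" using \<Gamma> by simp
  have exu: "expect ?u f = (\<Sum>g\<in>\<Gamma>. f g) / card \<Gamma>" for f
    unfolding expect_def using \<Gamma> by (simp add: sum_divide_distrib)
  \<comment> \<open>The image of any fixed \<open>b\<close> under a random member of
    \<open>\<Gamma>\<close> is uniform on \<open>A\<close>.\<close>
  have ind: "expect ?u (\<lambda>g. if g b = a then 1 else 0) = 1 / ?n" if "a \<in> A" "b \<in> A" for a b
  proof -
    define k where "k = real (card {g \<in> \<Gamma>. g b = a})"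
    have "expect ?u (\<lambda>g. if g b = a then 1 else 0) = k / card \<Gamma>"
      unfolding k_def exu using \<Gamma> by (simp add: sum.If_cases Int_def)
    also have k: "real (card \<Gamma>) = k * ?n" using arg_cong[OF unif[OF that], of real] by (simp add: k_def)
    also have "k / (k * ?n) = 1 / ?n" using c\<Gamma> k by auto
    finally show ?thesis .
  qed
  have pm: "pmf (map_pmf g p) a = (\<Sum>b\<in>A. pmf p b * (if g b = a then 1 else 0))" if "g \<in> \<Gamma>" for g a
  proof -
    have "pmf (map_pmf g p) a = measure p (g -` {a} \<inter> A)"
      unfolding pmf_map using p(1) by (intro measure_prob_cong_0) (auto simp: set_pmf_iff)
    also have "\<dots> = (\<Sum>b\<in>g -` {a} \<inter> A. pmf p b)" using A by (intro measure_measure_pmf_finite) auto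
    also have "\<dots> = (\<Sum>b\<in>A. pmf p b * (if g b = a then 1 else 0))"
      using A by (intro sum.mono_neutral_cong_left) auto
    finally show ?thesis .
  qed
  \<comment> \<open>By injectivity at most one \<open>b\<close> is sent to \<open>a\<close>, so the
    square has no cross terms.\<close>
  have pm2: "(pmf (map_pmf g p) a)\<^sup>2 = (\<Sum>b\<in>A. (pmf p b)\<^sup>2 * (if g b = a then 1 else 0))" if g: "g \<in> \<Gamma>" for g a
  proof (cases "\<exists>b\<in>A. g b = a")
    case True
    then obtain b where b: "b \<in> A" "g b = a" by auto
    have *: "g c = a \<longleftrightarrow> c = b" if "c \<in> A" for c using b inj[OF g] that by (auto dest: inj_onD)
    have "(\<Sum>c\<in>A. h c * (if g c = a then 1 else 0)) = (\<Sum>c\<in>A. if c = b then h c else 0)" for h :: "'a \<Rightarrow> real"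
      by (rule sum.cong) (auto simp: *)
    thus ?thesis using A b by (simp add: pm[OF g])
  next
    case False
    thus ?thesis by (auto simp: pm[OF g] intro!: sum.neutral)
  qed
  have sp: "(\<Sum>b\<in>A. pmf p b) = 1" using A p by (simp add: sum_pmf_eq_1)
  have mean: "expect ?u (\<lambda>g. pmf (map_pmf g p) a) = 1 / ?n" if a: "a \<in> A" for a
  proof -
    have "expect ?u (\<lambda>g. pmf (map_pmf g p) a) = expect ?u (\<lambda>g. \<Sum>b\<in>A. pmf p b * (if g b = a then 1 else 0))"
      using \<Gamma> by (intro expect_cong pm) auto
    also have "\<dots> = (\<Sum>b\<in>A. pmf p b * (1 / ?n))"
      unfolding expect_sum expect_cmult by (intro sum.cong refl) (simp add: ind a)
    finally show ?thesis by (simp add: sum_divide_distrib[symmetric] sp)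
  qed
  have var: "expect ?u (\<lambda>g. (\<phi> a g)\<^sup>2) \<le> D / ?n\<^sup>2" if a: "a \<in> A" for a
  proof -
    have "expect ?u (\<lambda>g. (\<phi> a g)\<^sup>2) = expect ?u (\<lambda>g. (pmf (map_pmf g p) a)\<^sup>2 - (2 / ?n) * pmf (map_pmf g p) a + (1 / ?n)\<^sup>2)"
      by (simp add: \<phi>_def power2_diff algebra_simps)
    also have "\<dots> = expect ?u (\<lambda>g. (pmf (map_pmf g p) a)\<^sup>2) - (1 / ?n)\<^sup>2"
      by (simp only: expect_add expect_diff expect_cmult expect_const[OF finu] mean[OF a]) (simp add: power2_eq_square)
    also have "\<dots> \<le> expect ?u (\<lambda>g. (pmf (map_pmf g p) a)\<^sup>2)" by simp
    also have "\<dots> = expect ?u (\<lambda>g. \<Sum>b\<in>A. (pmf p b)\<^sup>2 * (if g b = a then 1 else 0))"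
      using \<Gamma> by (intro expect_cong pm2) auto
    also have "\<dots> = (\<Sum>b\<in>A. (pmf p b)\<^sup>2 * (1 / ?n))"
      unfolding expect_sum expect_cmult by (intro sum.cong refl) (simp add: ind a)
    also have "\<dots> \<le> (\<Sum>b\<in>A. (pmf p b * (D / ?n)) * (1 / ?n))"
      unfolding power2_eq_square using n p by (intro sum_mono mult_right_mono mult_left_mono) auto
    also have "\<dots> = D / ?n\<^sup>2" by (simp add: sum_distrib_right[symmetric] sum_divide_distrib[symmetric] sp power2_eq_square)
    finally show ?thesis .
  qed
  \<comment> \<open>The bound for the mean deviation at one point; summed over the
    \<open>card A\<close> points it gives \<open>sqrt (D / M)\<close>.\<close>
  define t where "t = sqrt (D / M) / ?n"
  have t: "t > 0" using D M n by (simp add: t_def)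
  let ?rep = "replicate_pmf M ?u"
  have finr: "finite (set_pmf ?rep)" by (rule finite_replicate_pmf[OF finu])
  have "expect ?rep (\<lambda>gs. \<bar>(\<Sum>g\<leftarrow>gs. \<phi> a g) / M\<bar>) \<le> t" if a: "a \<in> A" for a
  proof (rule expect_abs_le[OF finr t])
    have m0: "expect ?u (\<phi> a) = 0"
      unfolding \<phi>_def by (simp add: expect_diff expect_const[OF finu] mean[OF a])
    have "expect ?rep (\<lambda>gs. ((\<Sum>g\<leftarrow>gs. \<phi> a g) / M)\<^sup>2) = expect ?rep (\<lambda>gs. (1 / M)\<^sup>2 * (\<Sum>g\<leftarrow>gs. \<phi> a g)\<^sup>2)"
      by (simp add: power_divide)
    also have "\<dots> = (1 / M)\<^sup>2 * (M * expect ?u (\<lambda>g. (\<phi> a g)\<^sup>2))"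
      by (simp only: expect_cmult expect_replicate_square[OF finu m0])
    also have "\<dots> \<le> (1 / M)\<^sup>2 * (M * (D / ?n\<^sup>2))" using var[OF a] by (intro mult_left_mono) auto
    also have "\<dots> = t\<^sup>2" using M D by (simp add: t_def power_divide power2_eq_square)
    finally show "expect ?rep (\<lambda>gs. ((\<Sum>g\<leftarrow>gs. \<phi> a g) / M)\<^sup>2) \<le> t\<^sup>2" .
  qed
  hence "expect ?rep (\<lambda>gs. \<Sum>a\<in>A. \<bar>(\<Sum>g\<leftarrow>gs. \<phi> a g) / M\<bar>) \<le> (\<Sum>a\<in>A. t)"
    unfolding expect_sum by (rule sum_mono)
  also have "\<dots> = sqrt (D / M)" using n by (simp add: t_def)
  finally obtain gs where gs: "gs \<in> set_pmf ?rep" "(\<Sum>a\<in>A. \<bar>(\<Sum>g\<leftarrow>gs. \<phi> a g) / M\<bar>) \<le> sqrt (D / M)"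
    using expect_exists_le[OF finr] by blast
  have len: "length gs = M" "set gs \<subseteq> \<Gamma>" using gs(1) \<Gamma> by (auto simp: set_replicate_pmf)
  have "(\<Sum>g\<leftarrow>gs. \<phi> a g) / M = (\<Sum>g\<leftarrow>gs. pmf (map_pmf g p) a) / M - 1 / ?n" for a
    using M len(1) by (simp add: \<phi>_def sum_list_subtractf sum_list_triv diff_divide_distrib)
  with gs(2) len show ?thesis by (intro exI[of _ gs]) auto
qed


section \<open>Perturbing the distribution of the initial space\<close>

text \<open>Conditioning changes the law of the initial space and keeps the reductions, and so does
  averaging over symmetries; both are compared in this form.\<close>

definition push :: "'i \<Rightarrow> 'i diagram \<Rightarrow> nat pmf \<Rightarrow> 'i diagram" where
  "push z X p = \<lparr> sp = (\<lambda>i. map_pmf (red X z i) p), red = red X \<rparr>"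

lemma push_simps [simp]: "sp (push z X p) i = map_pmf (red X z i) p" "red (push z X p) = red X"
  by (simp_all add: push_def)

context initial_index begin

lemma realizes_push:
  assumes X: "is_diagram G X" and p: "set_pmf p \<subseteq> set_pmf (sp X z)" "map_pmf f q = p"
  shows "realizes G q (\<lambda>i w. red X z i (f w)) (push z X p)"
proof -
  have "red X i j (red X z i (f w)) = red X z j (f w)" if "(i, j) \<in> G" "w \<in> set_pmf q" for i j w
  proof (rule is_diagram_comp[OF X z_to])
    show "i \<in> Field G" using that by (auto simp: Field_def)
    show "f w \<in> set_pmf (sp X z)" using that(2) p by auto
  qed (rule that)
  thus ?thesis using p(2) by (auto simp: realizes_def pmf.map_comp o_def)
qed

lemma is_diagram_push:
  assumes X: "is_diagram G X" and p: "set_pmf p \<subseteq> set_pmf (sp X z)"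
  shows "is_diagram G (push z X p)"
proof -
  note r = realizes_push[OF X p, of id, simplified]
  have fld: "i \<in> Field G" "j \<in> Field G" if "(i, j) \<in> G" for i j using that by (auto simp: Field_def)
  have sub: "set_pmf (sp (push z X p) i) \<subseteq> set_pmf (sp X i)" if "i \<in> Field G" for i
    using p by (auto intro!: realizes_in[OF realizes_self[OF X] that])
  have "finite (set_pmf p)" using p is_diagram_finite[OF X z_field] finite_subset by blast
  moreover have "map_pmf (red X i j) (sp (push z X p) i) = sp (push z X p) j" if "(i, j) \<in> G" for i j
    unfolding push_simps pmf.map_comp
    by (rule map_pmf_cong[OF refl]) (use r that in \<open>auto simp: realizes_def\<close>)
  moreover have "red X i i a = a" if "i \<in> Field G" "a \<in> set_pmf (sp (push z X p) i)" for i a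
    using is_diagram_id[OF X that(1)] sub[OF that(1)] that(2) by blast
  moreover have "red X j k (red X i j a) = red X i k a"
    if "(i, j) \<in> G" "(j, k) \<in> G" "a \<in> set_pmf (sp (push z X p) i)" for i j k a
    using is_diagram_comp[OF X that(1,2)] sub[OF fld(1)[OF that(1)]] that(3) by blast
  ultimately show ?thesis
    unfolding is_diagram_def reduction_def by (simp only: push_simps set_map_pmf) auto
qed

text \<open>A disagreement costs at most \<open>2 * (2 + ln (card A))\<close> and has probability at
  most \<open>1 / (2 + ln (card A))\<close>, so each conditional entropy is bounded by the constant
  3.\<close>

lemma entropy_dist_push_tv:
  assumes X: "is_diagram G X" and A: "A = set_pmf (sp X z)" and p: "set_pmf p \<subseteq> A" and q: "set_pmf q \<subseteq> A"
    and tv: "(\<Sum>a\<in>A. \<bar>pmf p a - pmf q a\<bar>) \<le> 1 / (2 + ln (card A))"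
  shows "entropy_dist G (push z X p) (push z X q) \<le> card (Field G) * 6"
proof -
  define L where "L = ln (card A)"
  \<comment> \<open>\<open>e\<close> is both the bound for the probability of disagreement and the
    noise level of the kernel.\<close>
  define e where "e = 1 / (2 + L)"
  have finA: "finite A" using is_diagram_finite[OF X z_field] A by simp
  have neA: "A \<noteq> {}" using A by (simp add: set_pmf_not_empty)
  have cA: "card A \<ge> 1" using finA neA by (simp add: Suc_le_eq card_gt_0_iff)
  have L: "L \<ge> 0" using cA by (simp add: L_def)
  have e: "0 < e" "e \<le> 1/2" using L by (auto simp: e_def field_simps)
  obtain r where r: "map_pmf fst r = p" "map_pmf snd r = q"
    "expect r (\<lambda>w. if fst w = snd w then 0 else 1) \<le> e"
    using tv_coupling[OF finA p q] tv unfolding e_def L_def by force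
  have sub: "set_pmf r \<subseteq> A \<times> A"
    using p q unfolding r(1,2)[symmetric] by force
  have finr: "finite (set_pmf r)" using sub finA finite_subset by blast
  let ?F = "\<lambda>i w. red X z i (fst w)" and ?F' = "\<lambda>i w. red X z i (snd w)"
  have "entropy_dist G (push z X p) (push z X q) \<le> coupling_cost G r ?F ?F'"
    using p q A by (intro entropy_dist_le_cost[OF finr transG] realizes_push is_diagram_push X r) auto
  also have "\<dots> \<le> (\<Sum>i\<in>Field G. 2 * 3)"
    unfolding coupling_cost_def
  proof (intro sum_mono cost_le_conditional[OF finr])
    fix i
    have c: "2 * e + ln (card (red X z i ` A) / e) * expect r (\<lambda>w. if f w = g w then 0 else 1) \<le> 3"
      if fg: "\<And>w. w \<in> set_pmf r \<Longrightarrow> fst w = snd w \<Longrightarrow> f w = g w" for f g :: "_ \<Rightarrow> nat"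
    proof -
      have c1: "card (red X z i ` A) \<le> card A" "card (red X z i ` A) > 0"
        using finA neA by (auto simp: card_image_le card_gt_0_iff)
      have "ln (card (red X z i ` A) / e) \<le> ln (card A / e)"
        using c1 e by (intro ln_mono divide_right_mono) auto
      also have "card A / e = card A * (2 + L)" by (simp add: e_def)
      also have "ln \<dots> = L + ln (2 + L)"
      proof -
        have "ln (card A * (2 + L)) = ln (card A) + ln (2 + L)" using cA L by (intro ln_mult_pos) auto
        thus ?thesis by (simp only: L_def)
      qed
      also have "\<dots> \<le> L + (1 + L)" using L ln_le_minus_one[of "2 + L"] by simp
      finally have l: "ln (card (red X z i ` A) / e) \<le> 2 * (2 + L)" by simp
      have l0: "0 \<le> ln (card (red X z i ` A) / e)" using c1 e by (simp add: field_simps)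
      have "expect r (\<lambda>w. if f w = g w then 0 else 1) \<le> expect r (\<lambda>w. if fst w = snd w then 0 else 1)"
        by (rule expect_mono) (use fg in auto)
      hence "expect r (\<lambda>w. if f w = g w then 0 else 1) \<le> e" using r(3) by simp
      hence "ln (card (red X z i ` A) / e) * expect r (\<lambda>w. if f w = g w then 0 else 1) \<le> 2 * (2 + L) * e"
        using l l0 L by (intro mult_mono expect_nonneg) auto
      also have "\<dots> = 2" using L by (simp add: e_def field_simps)
      finally show ?thesis using e by simp
    qed
    have im: "red X z i (fst w) \<in> red X z i ` A" "red X z i (snd w) \<in> red X z i ` A" if "w \<in> set_pmf r" for w
      using sub that by auto
    show "ent (map_pmf (\<lambda>w. (?F i w, ?F' i w)) r) \<le> ent (map_pmf (?F i) r) + 3"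
      by (rule order.trans[OF ent_noisy_pair[OF finr finite_imageI[OF finA] im(2) e]]) (auto intro!: c)
    show "ent (map_pmf (\<lambda>w. (?F' i w, ?F i w)) r) \<le> ent (map_pmf (?F' i) r) + 3"
      by (rule order.trans[OF ent_noisy_pair[OF finr finite_imageI[OF finA] im(1) e]]) (auto intro!: c)
  qed
  finally show ?thesis by simp
qed

text \<open>
  Translating by a random one of \<open>M\<close> symmetries costs at most \<open>ln M\<close> in each conditional entropy, because
  the symmetries respect the fibres of all reductions; the result is nearly uniform in total variation.
\<close>

lemma entropy_dist_push_translates:
  fixes \<Gamma> :: "(nat \<Rightarrow> nat) set"
  assumes X: "is_diagram G X" and A: "A = set_pmf (sp X z)" and Xu: "\<And>a. a \<in> A \<Longrightarrow> pmf (sp X z) a = 1 / card A"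
    and \<Gamma>: "finite \<Gamma>" "\<Gamma> \<noteq> {}" and perm: "\<And>g. g \<in> \<Gamma> \<Longrightarrow> g permutes A"
    and unif: "\<And>a b. a \<in> A \<Longrightarrow> b \<in> A \<Longrightarrow> card {g \<in> \<Gamma>. g b = a} * card A = card \<Gamma>"
    and resp: "\<And>g i c d. g \<in> \<Gamma> \<Longrightarrow> i \<in> Field G \<Longrightarrow> c \<in> A \<Longrightarrow> d \<in> A \<Longrightarrow>
       red X z i (g c) = red X z i (g d) \<longleftrightarrow> red X z i c = red X z i d"
    and p: "set_pmf p \<subseteq> A" "\<And>a. a \<in> A \<Longrightarrow> pmf p a \<le> D / card A" and D: "D \<ge> 1"
  shows "entropy_dist G (push z X p) (push z X (sp X z)) \<le> card (Field G) * (2 * ln D + 4 * ln (2 + ln (card A)) + 8)"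
proof -
  define L where "L = ln (card A)"
  have finA: "finite A" using is_diagram_finite[OF X z_field] A by simp
  have neA: "A \<noteq> {}" using A by (simp add: set_pmf_not_empty)
  have cA: "card A \<ge> 1" using finA neA by (simp add: Suc_le_eq card_gt_0_iff)
  have L: "L \<ge> 0" using cA by (simp add: L_def)
  \<comment> \<open>Enough translates to bring \<open>sqrt (D / M)\<close> below the threshold
    \<open>1 / (2 + L)\<close>, while \<open>ln M\<close> exceeds \<open>ln D\<close> by at most
    \<open>2 * ln (2 + L)\<close> and a constant.\<close>
  define M where "M = nat \<lceil>D * (2 + L)\<^sup>2\<rceil>"
  have DL: "D * (2 + L)\<^sup>2 \<ge> 1" using D L mult_mono[of 1 D 1 "(2 + L)\<^sup>2"] by (simp add: one_le_power)
  have M: "real M \<ge> D * (2 + L)\<^sup>2" "real M \<le> 2 * (D * (2 + L)\<^sup>2)" "M > 0"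
    using DL unfolding M_def by linarith+
  have "sqrt (D / M) \<le> sqrt ((1 / (2 + L))\<^sup>2)"
    using M D L by (intro real_sqrt_le_mono) (simp add: field_simps)
  hence sq: "sqrt (D / M) \<le> 1 / (2 + L)" using L by simp
  obtain gs where gs: "length gs = M" "set gs \<subseteq> \<Gamma>"
    "(\<Sum>a\<in>A. \<bar>(\<Sum>g\<leftarrow>gs. pmf (map_pmf g p) a) / M - 1 / card A\<bar>) \<le> 1 / (2 + L)"
    using average_of_translates[OF finA neA \<Gamma> permutes_inj_on[OF perm] unif p _ M(3)] D sq by force
  let ?J = "pmf_of_set {..<M}"
  have J: "finite {..<M}" "{..<M} \<noteq> {}" using M(3) by auto
  let ?W = "pair_pmf p ?J"
  let ?h = "\<lambda>w. (gs ! snd w) (fst w)"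
  \<comment> \<open>The law of a point of \<open>p\<close> moved by an independent random choice
    among the \<open>M\<close> symmetries, that is, the average of the translates of
    \<open>p\<close>.\<close>
  define r where "r = map_pmf ?h ?W"
  have finp: "finite (set_pmf p)" using p(1) finA finite_subset by blast
  have finW: "finite (set_pmf ?W)" using finp J by simp
  have gsj: "gs ! j \<in> \<Gamma>" if "j < M" for j using gs that by auto
  have WA: "fst w \<in> A" "snd w < M" "?h w \<in> A" if "w \<in> set_pmf ?W" for w
    using that p(1) J perm[OF gsj, of "snd w"] by (auto simp: permutes_in_image)
  have rA: "set_pmf r \<subseteq> A" using WA by (auto simp: r_def)
  have "pmf r a = (\<Sum>g\<leftarrow>gs. pmf (map_pmf g p) a) / M" for a
  proof -
    have "r = bind_pmf ?J (\<lambda>j. map_pmf (gs ! j) p)"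
      unfolding r_def pair_pmf_def by (subst bind_commute_pmf) (simp add: map_bind_pmf map_pmf_def bind_assoc_pmf bind_return_pmf)
    hence "pmf r a = (\<Sum>j<M. pmf (map_pmf (gs ! j) p) a) / M"
      using J by (simp add: pmf_bind integral_pmf_of_set)
    thus ?thesis using gs(1) by (simp add: sum_list_sum_nth atLeast0LessThan)
  qed
  hence "(\<Sum>a\<in>A. \<bar>pmf r a - pmf (sp X z) a\<bar>) \<le> 1 / (2 + ln (card A))"
    using gs(3) Xu unfolding L_def by (simp cong: sum.cong)
  hence k2: "entropy_dist G (push z X r) (push z X (sp X z)) \<le> card (Field G) * 6"
    using entropy_dist_push_tv[OF X A rA] A by blast
  let ?F = "\<lambda>i w. red X z i (fst w)" and ?F' = "\<lambda>i w. red X z i (?h w)"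
  have "entropy_dist G (push z X p) (push z X r) \<le> coupling_cost G ?W ?F ?F'"
    using p rA A by (intro entropy_dist_le_cost[OF finW transG] realizes_push is_diagram_push X)
      (auto simp: map_fst_pair_pmf r_def)
  also have "\<dots> \<le> (\<Sum>i\<in>Field G. 2 * ln M)"
    unfolding coupling_cost_def
  proof (intro sum_mono cost_le_conditional[OF finW])
    fix i assume i: "i \<in> Field G"
    have snd: "ent (map_pmf snd ?W) = ln M" using J by (simp add: map_snd_pair_pmf ent_pmf_of_set)
    have eq: "?F' i v = ?F' i w \<longleftrightarrow> ?F i v = ?F i w" if "v \<in> set_pmf ?W" "w \<in> set_pmf ?W" "snd v = snd w" for v w
      using resp[OF gsj i, of "snd w" "fst v" "fst w"] WA[OF that(1)] WA[OF that(2)] that(3) by simp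
    have "ent (map_pmf (\<lambda>w. (?F i w, ?F' i w)) ?W) \<le> ent (map_pmf (\<lambda>w. (?F i w, snd w)) ?W)"
      by (rule ent_mono[OF finW]) (use eq in auto)
    also have "\<dots> \<le> ent (map_pmf (?F i) ?W) + ln M" using ent_joint_le[OF finW, of "?F i" snd] snd by simp
    finally show "ent (map_pmf (\<lambda>w. (?F i w, ?F' i w)) ?W) \<le> ent (map_pmf (?F i) ?W) + ln M" .
    have "ent (map_pmf (\<lambda>w. (?F' i w, ?F i w)) ?W) \<le> ent (map_pmf (\<lambda>w. (?F' i w, snd w)) ?W)"
      by (rule ent_mono[OF finW]) (use eq in auto)
    also have "\<dots> \<le> ent (map_pmf (?F' i) ?W) + ln M" using ent_joint_le[OF finW, of "?F' i" snd] snd by simp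
    finally show "ent (map_pmf (\<lambda>w. (?F' i w, ?F i w)) ?W) \<le> ent (map_pmf (?F' i) ?W) + ln M" .
  qed
  also have "\<dots> = card (Field G) * (2 * ln M)" by simp
  finally have k1: "entropy_dist G (push z X p) (push z X r) \<le> card (Field G) * (2 * ln M)" .
  have "ln (real M) \<le> ln (2 * (D * (2 + L)\<^sup>2))" using M by (intro ln_mono) auto
  also have "\<dots> = ln 2 + ln D + 2 * ln (2 + L)" using D L by (simp add: ln_mult ln_realpow)
  finally have lnM: "2 * ln M \<le> 2 * ln D + 4 * ln (2 + L) + 2" using ln2_le_25_over_36 by simp
  have "entropy_dist G (push z X p) (push z X (sp X z)) \<le> card (Field G) * (2 * ln M) + card (Field G) * 6"
    by (rule order.trans[OF entropy_dist_triangle[of _ "push z X r"]], (intro is_diagram_push X; use p rA A in simp)+)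
      (intro add_mono k1 k2)
  also have "\<dots> = card (Field G) * (2 * ln M + 6)" by (simp add: distrib_left)
  also have "\<dots> \<le> card (Field G) * (2 * ln D + 4 * ln (2 + L) + 8)" using lnM by (intro mult_left_mono) auto
  finally show ?thesis unfolding L_def .
qed

end


text \<open>On average over \<open>W\<close>, the cost at an object is
  \<open>H(f | g, W) + H(g | f, W)\<close>, and knowing \<open>W\<close> in addition only lowers
  both terms.\<close>

lemma coupling_cost_conditional:
  assumes q: "finite (set_pmf q)"
  shows "expect (map_pmf W q) (\<lambda>v. coupling_cost G (cond_pmf q {w. W w = v}) F F') \<le> coupling_cost G q F F'"
proof -
  let ?Q = "\<lambda>v. cond_pmf q {w. W w = v}" and ?r = "map_pmf W q"
  have "expect ?r (\<lambda>v. coupling_cost G (?Q v) F F') = (\<Sum>i\<in>Field G. 2 * expect ?r (\<lambda>v. ent (map_pmf (\<lambda>w. (F i w, F' i w)) (?Q v)))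
     - expect ?r (\<lambda>v. ent (map_pmf (F i) (?Q v))) - expect ?r (\<lambda>v. ent (map_pmf (F' i) (?Q v))))"
    unfolding coupling_cost_def expect_sum by (simp only: expect_diff expect_cmult)
  also have "\<dots> \<le> coupling_cost G q F F'"
    unfolding coupling_cost_def
  proof (rule sum_mono)
    fix i
    let ?f = "F i" and ?g = "F' i"
    have 1: "ent (map_pmf (\<lambda>w. (W w, f w)) q) = ent ?r + expect ?r (\<lambda>v. ent (map_pmf f (?Q v)))" for f :: "_ \<Rightarrow> 'z"
      by (rule ent_chain[OF q])
    have 2: "ent (map_pmf (\<lambda>w. (W w, f w, g w)) q) + ent (map_pmf f q) \<le> ent (map_pmf (\<lambda>w. (W w, f w)) q) + ent (map_pmf (\<lambda>w. (f w, g w)) q)"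
      for f g :: "_ \<Rightarrow> nat"
      using ent_submod[OF q, of "\<lambda>w. (W w, f w)" g snd]
        ent_cong[OF q, of "\<lambda>w. ((W w, f w), g w)" "\<lambda>w. (W w, f w, g w)"] by auto
    have 3: "ent (map_pmf (\<lambda>w. (W w, ?g w, ?f w)) q) = ent (map_pmf (\<lambda>w. (W w, ?f w, ?g w)) q)"
      "ent (map_pmf (\<lambda>w. (?g w, ?f w)) q) = ent (map_pmf (\<lambda>w. (?f w, ?g w)) q)"
      by (rule ent_cong[OF q]; auto)+
    show "2 * expect ?r (\<lambda>v. ent (map_pmf (\<lambda>w. (?f w, ?g w)) (?Q v))) - expect ?r (\<lambda>v. ent (map_pmf ?f (?Q v)))
      - expect ?r (\<lambda>v. ent (map_pmf ?g (?Q v))) \<le> 2 * ent (map_pmf (\<lambda>w. (?f w, ?g w)) q) - ent (map_pmf ?f q) - ent (map_pmf ?g q)"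
      using 1[of "\<lambda>w. (?f w, ?g w)"] 1[of ?f] 1[of ?g] 2[of ?f ?g] 2[of ?g ?f] 3 by linarith
  qed
  finally show ?thesis .
qed


section \<open>Conditioning homogeneous diagrams\<close>

lemma (in initial_index) cond_diagram_push:
  "cond_diagram G X u a = push z X (cond_pmf (sp X z) {c. red X z u c = a})"
  by (simp add: cond_diagram_def push_def initial_object_eq)

locale conditioning = initial_index +
  fixes u assumes u: "u \<in> Field G"
begin

definition fibre :: "'a diagram \<Rightarrow> nat \<Rightarrow> nat set" where
  "fibre X a = {c \<in> set_pmf (sp X z). red X z u c = a}"

abbreviation cnd :: "'a diagram \<Rightarrow> nat \<Rightarrow> nat pmf" where
  "cnd X a \<equiv> cond_pmf (sp X z) {c. red X z u c = a}"

lemma fibre_nonempty: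
  assumes "is_diagram G X" "a \<in> set_pmf (sp X u)" shows "fibre X a \<noteq> {}"
proof -
  have "a \<in> red X z u ` set_pmf (sp X z)"
    using is_diagram_reduction[OF assms(1) z_to[OF u]] assms(2) by (metis set_map_pmf)
  thus ?thesis by (auto simp: fibre_def)
qed

lemma fibre_inter: "set_pmf (sp X z) \<inter> {c. red X z u c = a} = fibre X a"
  by (auto simp: fibre_def)

lemma set_cnd: "is_diagram G X \<Longrightarrow> a \<in> set_pmf (sp X u) \<Longrightarrow> set_pmf (cnd X a) = fibre X a"
  using fibre_nonempty[of X a] by (subst set_cond_pmf) (auto simp: fibre_inter)

lemma is_diagram_cond:
  assumes "is_diagram G X" "a \<in> set_pmf (sp X u)" shows "is_diagram G (cond_diagram G X u a)"
  unfolding cond_diagram_push by (rule is_diagram_push[OF assms(1)]) (auto simp: set_cnd assms fibre_def)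

lemma aut_commute:
  "diagram_aut G X f \<Longrightarrow> i \<in> Field G \<Longrightarrow> c \<in> set_pmf (sp X z) \<Longrightarrow> f i (red X z i c) = red X z i (f z c)"
  using z_to[of i] by (auto simp: diagram_aut_def diagram_mor_def)

lemma aut_in:
  assumes "diagram_aut G X f" "i \<in> Field G" "c \<in> set_pmf (sp X i)"
  shows "f i c \<in> set_pmf (sp X i)"
proof -
  have "map_pmf (f i) (sp X i) = sp X i"
    using assms by (auto simp: diagram_aut_def diagram_mor_def reduction_def)
  thus ?thesis using assms(3) by (metis imageI set_map_pmf)
qed

lemma aut_inverse:
  assumes "diagram_aut G X f"
  shows "\<exists>g. diagram_aut G X g \<and> (\<forall>i\<in>Field G. \<forall>c\<in>set_pmf (sp X i). g i (f i c) = c \<and> f i (g i c) = c)"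
proof -
  obtain g where g: "diagram_mor G X X f" "diagram_mor G X X g"
    "\<forall>i\<in>Field G. \<forall>c\<in>set_pmf (sp X i). g i (f i c) = c \<and> f i (g i c) = c"
    using assms unfolding diagram_aut_def by blast
  thus ?thesis by (intro exI[of _ g] conjI) (auto simp: diagram_aut_def)
qed

lemma aut_inj:
  assumes "diagram_aut G X f" "i \<in> Field G" shows "inj_on (f i) (set_pmf (sp X i))"
proof -
  obtain g where "\<forall>i\<in>Field G. \<forall>c\<in>set_pmf (sp X i). g i (f i c) = c \<and> f i (g i c) = c"
    using aut_inverse[OF assms(1)] by blast
  thus ?thesis using assms(2) by (intro inj_on_inverseI[of _ "g i"]) auto
qed

lemma aut_fibre:
  assumes f: "diagram_aut G X f" and fa: "f u a = b" and a: "a \<in> set_pmf (sp X u)"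
  shows "f z ` fibre X a = fibre X b"
proof -
  obtain g where g: "diagram_aut G X g"
    and inv: "\<forall>i\<in>Field G. \<forall>c\<in>set_pmf (sp X i). g i (f i c) = c \<and> f i (g i c) = c"
    using aut_inverse[OF f] by blast
  show ?thesis
  proof (intro antisym subsetI)
    fix d assume "d \<in> f z ` fibre X a"
    then obtain c where c: "c \<in> set_pmf (sp X z)" "red X z u c = a" "d = f z c" by (auto simp: fibre_def)
    thus "d \<in> fibre X b" using aut_in[OF f z_field c(1)] aut_commute[OF f u c(1)] fa by (simp add: fibre_def)
  next
    fix d assume "d \<in> fibre X b"
    hence d: "d \<in> set_pmf (sp X z)" "red X z u d = b" by (auto simp: fibre_def)
    have "g u b = a" using fa[symmetric] inv u a by simp
    hence "red X z u (g z d) = a" using aut_commute[OF g u d(1)] d(2) by simp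
    hence "g z d \<in> fibre X a" using aut_in[OF g z_field d(1)] by (simp add: fibre_def)
    moreover have "d = f z (g z d)" using inv z_field d(1) by simp
    ultimately show "d \<in> f z ` fibre X a" by blast
  qed
qed

lemma homogeneousD:
  "homogeneous G X \<Longrightarrow> i \<in> Field G \<Longrightarrow> a \<in> set_pmf (sp X i) \<Longrightarrow> b \<in> set_pmf (sp X i) \<Longrightarrow> \<exists>f. diagram_aut G X f \<and> f i a = b"
  unfolding homogeneous_def by blast

text \<open>Automorphisms preserve weights, and they act transitively on the atoms.\<close>

lemma homogeneous_uniform:
  assumes X: "is_diagram G X" and h: "homogeneous G X"
  shows "sp X z = pmf_of_set (set_pmf (sp X z))"
proof -
  let ?A = "set_pmf (sp X z)"
  have A: "finite ?A" "?A \<noteq> {}" using is_diagram_finite[OF X z_field] by (auto simp: set_pmf_not_empty)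
  have eq: "pmf (sp X z) c = pmf (sp X z) d" if cd: "c \<in> ?A" "d \<in> ?A" for c d
  proof -
    obtain f where f: "diagram_aut G X f" "f z c = d" using homogeneousD[OF h z_field cd] by blast
    have "map_pmf (f z) (sp X z) = sp X z"
      using f(1) z_field by (auto simp: diagram_aut_def diagram_mor_def reduction_def)
    thus ?thesis using pmf_map_inj[OF aut_inj[OF f(1) z_field] cd(1)] f(2) by simp
  qed
  obtain d where d: "d \<in> ?A" using A by auto
  have "1 = (\<Sum>c\<in>?A. pmf (sp X z) c)" using A by (simp add: sum_pmf_eq_1)
  also have "\<dots> = (\<Sum>c\<in>?A. pmf (sp X z) d)" by (rule sum.cong[OF refl eq[OF _ d]])
  also have "\<dots> = card ?A * pmf (sp X z) d" by simp
  finally have pd: "pmf (sp X z) d = 1 / card ?A"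
    using A by (subst nonzero_eq_divide_eq) (auto simp: mult.commute)
  show ?thesis
  proof (rule pmf_eqI)
    fix c
    show "pmf (sp X z) c = pmf (pmf_of_set ?A) c"
    proof (cases "c \<in> ?A")
      case True
      thus ?thesis using A eq[OF True d] pd by (simp add: indicator_def)
    next
      case False
      thus ?thesis using A by (simp add: set_pmf_iff)
    qed
  qed
qed

lemma cnd_uniform:
  assumes X: "is_diagram G X" and h: "homogeneous G X" and a: "a \<in> set_pmf (sp X u)"
  shows "cnd X a = pmf_of_set (fibre X a)"
proof -
  let ?A = "set_pmf (sp X z)"
  have A: "finite ?A" "?A \<noteq> {}" using is_diagram_finite[OF X z_field] by (auto simp: set_pmf_not_empty)
  have ne: "?A \<inter> {c. red X z u c = a} \<noteq> {}" using fibre_nonempty[OF X a] by (simp add: fibre_inter)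
  have "cond_pmf (pmf_of_set ?A) {c. red X z u c = a} = pmf_of_set ({c. red X z u c = a} \<inter> ?A)"
  proof (rule pmf_eqI)
    fix c
    have "set_pmf (pmf_of_set ?A) \<inter> {c. red X z u c = a} \<noteq> {}" using A ne by simp
    thus "pmf (cond_pmf (pmf_of_set ?A) {c. red X z u c = a}) c = pmf (pmf_of_set ({c. red X z u c = a} \<inter> ?A)) c"
      using A ne by (subst pmf_cond) (auto simp: measure_pmf_of_set Int_commute indicator_def)
  qed
  thus ?thesis using homogeneous_uniform[OF X h] fibre_inter[of X a] by (metis Int_commute)
qed

lemma card_fibre:
  assumes "is_diagram G X" "a \<in> set_pmf (sp X u)"
  shows "finite (fibre X a)" "1 \<le> card (fibre X a)" "card (fibre X a) \<le> card (set_pmf (sp X z))"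
proof -
  have f: "finite (set_pmf (sp X z))" by (rule is_diagram_finite[OF assms(1) z_field])
  have s: "fibre X a \<subseteq> set_pmf (sp X z)" by (auto simp: fibre_def)
  show fin: "finite (fibre X a)" using f s finite_subset by blast
  show "card (fibre X a) \<le> card (set_pmf (sp X z))" by (rule card_mono[OF f s])
  show "1 \<le> card (fibre X a)" using fin fibre_nonempty[OF assms] by (simp add: Suc_le_eq card_gt_0_iff)
qed

text \<open>The automorphism that moves \<open>a\<close> to \<open>b\<close> carries the fibre over
  \<open>a\<close> onto the fibre over \<open>b\<close>, and on both fibres the conditional law is
  uniform.\<close>

lemma cond_mor:
  assumes X: "is_diagram G X" and h: "homogeneous G X" and a: "a \<in> set_pmf (sp X u)" and b: "b \<in> set_pmf (sp X u)"
  shows "\<exists>f. diagram_mor G (cond_diagram G X u a) (cond_diagram G X u b) f"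
proof -
  obtain f where f: "diagram_aut G X f" "f u a = b" using homogeneousD[OF h u a b] by blast
  have "map_pmf (f z) (cnd X a) = cnd X b"
    unfolding cnd_uniform[OF X h a] cnd_uniform[OF X h b] aut_fibre[OF f a, symmetric]
    by (rule map_pmf_of_set_inj[OF inj_on_subset[OF aut_inj[OF f(1) z_field]]])
      (use fibre_nonempty[OF X a] card_fibre[OF X a] in \<open>auto simp: fibre_def\<close>)
  moreover have com: "f i (red X z i c) = red X z i (f z c)" if "i \<in> Field G" "c \<in> set_pmf (sp X z)" for i c
    using aut_commute[OF f(1) that] .
  ultimately have "map_pmf (f i) (map_pmf (red X z i) (cnd X a)) = map_pmf (red X z i) (cnd X b)" if i: "i \<in> Field G" for i
  proof -
    have "map_pmf (f i) (map_pmf (red X z i) (cnd X a)) = map_pmf (red X z i) (map_pmf (f z) (cnd X a))"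
      unfolding pmf.map_comp o_def
      by (rule map_pmf_cong[OF refl]) (use com[OF i] in \<open>auto simp: set_cnd[OF X a] fibre_def\<close>)
    thus ?thesis using \<open>map_pmf (f z) (cnd X a) = cnd X b\<close> by simp
  qed
  moreover have "f j (red X i j d) = red X i j (f i d)"
    if "(i, j) \<in> G" "d \<in> set_pmf (sp (cond_diagram G X u a) i)" for i j d
  proof -
    have i: "i \<in> Field G" using that(1) by (auto simp: Field_def)
    have "d \<in> set_pmf (sp X i)"
      using that(2) by (auto simp: cond_diagram_push set_cnd[OF X a] fibre_def intro!: realizes_in[OF realizes_self[OF X] i])
    thus ?thesis using f(1) that(1) by (auto simp: diagram_aut_def diagram_mor_def)
  qed
  ultimately show ?thesis
    by (intro exI[of _ f]) (auto simp: diagram_mor_def reduction_def cond_diagram_push)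
qed

text \<open>Morphisms in both directions force equal entropies, hence distance 0.\<close>

lemma cond_independent_of_atom:
  assumes X: "is_diagram G X" and h: "homogeneous G X" and a: "a \<in> set_pmf (sp X u)" and b: "b \<in> set_pmf (sp X u)"
  shows "entropy_dist G (cond_diagram G X u a) (cond_diagram G X u b) = 0"
proof -
  obtain f g where f: "diagram_mor G (cond_diagram G X u a) (cond_diagram G X u b) f"
    and g: "diagram_mor G (cond_diagram G X u b) (cond_diagram G X u a) g"
    using cond_mor[OF X h a b] cond_mor[OF X h b a] by blast
  show ?thesis
    by (rule entropy_dist_eq_0[OF is_diagram_cond[OF X a] is_diagram_cond[OF X b] f])
      (rule Ent_mor_le[OF g is_diagram_finite[OF is_diagram_cond[OF X b]]])
qed

text \<open>Random symmetries of the fibre spread \<open>p\<close> out over it, and the logarithm of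
  the density bound \<open>D\<close> measures how many are needed.\<close>

lemma cond_translates:
  assumes X: "is_diagram G X" and h: "homogeneous G X" and a: "a \<in> set_pmf (sp X u)"
    and p: "set_pmf p \<subseteq> fibre X a" "\<And>c. c \<in> fibre X a \<Longrightarrow> pmf p c \<le> D / card (fibre X a)" and D: "D \<ge> 1"
  shows "entropy_dist G (push z X p) (cond_diagram G X u a) \<le> card (Field G) * (2 * ln D + 4 * ln (2 + Ent (sp X z)) + 8)"
proof -
  let ?F = "fibre X a" and ?Y = "cond_diagram G X u a"
  note F = card_fibre[OF X a] fibre_nonempty[OF X a]
  have spz: "sp ?Y z = pmf_of_set ?F"
  proof -
    have "map_pmf (red X z z) (cnd X a) = map_pmf id (cnd X a)"
      by (rule map_pmf_cong[OF refl]) (auto simp: set_cnd[OF X a] fibre_def is_diagram_id[OF X z_field])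
    thus ?thesis by (simp add: cond_diagram_push cnd_uniform[OF X h a])
  qed
  have redY: "red ?Y = red X" by (simp add: cond_diagram_push)
  \<comment> \<open>The symmetries are the permutations of the fibre that preserve its partition
    into level sets of each reduction. They form a finite set closed under composition, which
    contains the restriction of every automorphism fixing \<open>a\<close>.\<close>
  define \<Gamma> where "\<Gamma> = {g. g permutes ?F \<and> (\<forall>i\<in>Field G. \<forall>c\<in>?F. \<forall>d\<in>?F.
    red X z i (g c) = red X z i (g d) \<longleftrightarrow> red X z i c = red X z i d)}"
  have fin\<Gamma>: "finite \<Gamma>" unfolding \<Gamma>_def using finite_permutations[OF F(1)] by (rule rev_finite_subset) auto
  have id\<Gamma>: "id \<in> \<Gamma>" by (simp add: \<Gamma>_def permutes_id)
  have comp\<Gamma>: "g \<circ> k \<in> \<Gamma>" if "g \<in> \<Gamma>" "k \<in> \<Gamma>" for g k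
    using that permutes_in_image[of k ?F] unfolding \<Gamma>_def by (auto intro: permutes_compose)
  have trans\<Gamma>: "\<exists>g\<in>\<Gamma>. g c = d" if cd: "c \<in> ?F" "d \<in> ?F" for c d
  proof -
    have "c \<in> set_pmf (sp X z)" "d \<in> set_pmf (sp X z)" using cd by (auto simp: fibre_def)
    then obtain f where f: "diagram_aut G X f" "f z c = d" using homogeneousD[OF h z_field] by blast
    have com: "f i (red X z i c) = red X z i (f z c)" if "i \<in> Field G" "c \<in> set_pmf (sp X z)" for i c
      using aut_commute[OF f(1) that] .
    \<comment> \<open>An automorphism that takes a point of the fibre to another one fixes
      \<open>a\<close>, so it maps the fibre onto itself.\<close>
    have fa: "f u a = a" using com[OF u, of c] cd f(2) by (simp add: fibre_def)
    define g where "g x = (if x \<in> ?F then f z x else x)" for x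
    have inj: "inj_on (f z) ?F" by (rule inj_on_subset[OF aut_inj[OF f(1) z_field]]) (auto simp: fibre_def)
    have "bij_betw g ?F ?F"
      using inj aut_fibre[OF f(1) fa a] by (simp add: bij_betw_def g_def inj_on_def image_def)
    hence "g permutes ?F" by (rule bij_imp_permutes) (simp add: g_def)
    moreover have "red X z i (g c) = red X z i (g d) \<longleftrightarrow> red X z i c = red X z i d"
      if i: "i \<in> Field G" and cd: "c \<in> ?F" "d \<in> ?F" for i c d
    proof -
      have "c \<in> set_pmf (sp X z)" "d \<in> set_pmf (sp X z)" using cd by (auto simp: fibre_def)
      moreover from this have "red X z i c \<in> set_pmf (sp X i)" "red X z i d \<in> set_pmf (sp X i)"
        by (auto intro: realizes_in[OF realizes_self[OF X] i])
      ultimately show ?thesis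
        using cd com[OF i] inj_on_eq_iff[OF aut_inj[OF f(1) i]] by (simp add: g_def flip: com[OF i])
    qed
    ultimately have "g \<in> \<Gamma>" by (simp add: \<Gamma>_def)
    moreover have "g c = d" using cd f(2) by (simp add: g_def)
    ultimately show ?thesis by blast
  qed
  have unif: "card {g \<in> \<Gamma>. g b = c} * card ?F = card \<Gamma>" if c: "c \<in> ?F" and b: "b \<in> ?F" for b c
  proof -
    \<comment> \<open>Composition with a symmetry taking \<open>c\<close> to \<open>d\<close>
      injects one set into the other, so all of them have the same size.\<close>
    have le: "card {g \<in> \<Gamma>. g b = c} \<le> card {g \<in> \<Gamma>. g b = d}" if cd: "c \<in> ?F" "d \<in> ?F" for c d
    proof -
      obtain k where k: "k \<in> \<Gamma>" "k c = d" using trans\<Gamma>[OF cd] by blast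
      have "inj k" using k(1) by (auto simp: \<Gamma>_def dest: permutes_inj)
      show ?thesis
      proof (rule card_inj_on_le[of "\<lambda>g. k \<circ> g"])
        show "inj_on (\<lambda>g. k \<circ> g) {g \<in> \<Gamma>. g b = c}"
          using \<open>inj k\<close> by (auto simp: inj_on_def fun_eq_iff dest: injD)
        show "(\<lambda>g. k \<circ> g) ` {g \<in> \<Gamma>. g b = c} \<subseteq> {g \<in> \<Gamma>. g b = d}" using comp\<Gamma>[OF k(1)] k(2) by auto
        show "finite {g \<in> \<Gamma>. g b = d}" using fin\<Gamma> by simp
      qed
    qed
    have "card \<Gamma> = (\<Sum>d\<in>?F. card {g \<in> \<Gamma>. g b = d})"
    proof -
      have "\<Gamma> = (\<Union>d\<in>?F. {g \<in> \<Gamma>. g b = d})"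
        using b by (auto simp: \<Gamma>_def permutes_in_image)
      hence "card \<Gamma> = card (\<Union>d\<in>?F. {g \<in> \<Gamma>. g b = d})" by simp
      also have "\<dots> = (\<Sum>d\<in>?F. card {g \<in> \<Gamma>. g b = d})"
        using fin\<Gamma> F(1) by (intro card_UN_disjoint) auto
      finally show ?thesis .
    qed
    also have "\<dots> = (\<Sum>d\<in>?F. card {g \<in> \<Gamma>. g b = c})"
      by (rule sum.cong[OF refl], rule antisym) (use le c in auto)
    finally show ?thesis by simp
  qed
  have "entropy_dist G (push z ?Y p) (push z ?Y (sp ?Y z)) \<le> card (Field G) * (2 * ln D + 4 * ln (2 + ln (card ?F)) + 8)"
  proof (rule entropy_dist_push_translates[OF is_diagram_cond[OF X a] _ _ fin\<Gamma> _ _ unif _ p D])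
    show "?F = set_pmf (sp ?Y z)" using F by (simp add: spz)
    show "pmf (sp ?Y z) c = 1 / card ?F" if "c \<in> ?F" for c using that F by (simp add: spz)
    show "\<Gamma> \<noteq> {}" using id\<Gamma> by blast
    show "g permutes ?F" if "g \<in> \<Gamma>" for g using that by (simp add: \<Gamma>_def)
    show "red ?Y z i (g c) = red ?Y z i (g d) \<longleftrightarrow> red ?Y z i c = red ?Y z i d"
      if "g \<in> \<Gamma>" "i \<in> Field G" "c \<in> ?F" "d \<in> ?F" for g i c d using that by (simp add: \<Gamma>_def redY)
  qed
  moreover have "push z ?Y p = push z X p" by (simp add: push_def redY)
  moreover have "push z ?Y (sp ?Y z) = ?Y"
    unfolding spz by (simp add: cond_diagram_push cnd_uniform[OF X h a]) (simp add: push_def)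
  moreover have "ln (2 + ln (card ?F)) \<le> ln (2 + Ent (sp X z))"
  proof (rule ln_mono)
    have "Ent (sp X z) = ent (pmf_of_set (set_pmf (sp X z)))"
      unfolding Ent_eq_ent by (rule arg_cong[where f=ent, OF homogeneous_uniform[OF X h]])
    also have "\<dots> = ln (card (set_pmf (sp X z)))"
      by (rule ent_pmf_of_set[OF is_diagram_finite[OF X z_field] set_pmf_not_empty])
    finally have "ln (card ?F) \<le> Ent (sp X z)" using F by simp
    thus "2 + ln (card ?F) \<le> 2 + Ent (sp X z)" by simp
    show "0 < 2 + ln (card ?F)" using F by (intro add_pos_nonneg) auto
  qed
  hence "card (Field G) * (2 * ln D + 4 * ln (2 + ln (card ?F)) + 8) \<le> card (Field G) * (2 * ln D + 4 * ln (2 + Ent (sp X z)) + 8)"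
    by (intro mult_left_mono) auto
  ultimately show ?thesis by simp
qed

end


section \<open>Conditional laws, products and linear growth of entropy\<close>

lemma measure_expect: "finite (set_pmf p) \<Longrightarrow> measure p A = expect p (\<lambda>w. if w \<in> A then 1 else 0)"
proof -
  assume fin: "finite (set_pmf p)"
  have "measure p A = measure p (set_pmf p \<inter> A)" by (simp add: measure_Int_set_pmf Int_commute)
  also have "\<dots> = (\<Sum>w\<in>set_pmf p \<inter> A. pmf p w)" using fin by (simp add: measure_measure_pmf_finite)
  also have "\<dots> = expect p (\<lambda>w. if w \<in> A then 1 else 0)"
    unfolding expect_def using fin by (intro sum.mono_neutral_cong_left) auto
  finally show ?thesis .
qed

lemma pmf_map_cond_le:
  assumes fin: "finite (set_pmf q)" and ne: "set_pmf q \<inter> S \<noteq> {}"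
  shows "pmf (map_pmf f (cond_pmf q S)) c \<le> pmf (map_pmf f q) c / measure_pmf.prob q S"
proof -
  have finc: "finite (set_pmf (cond_pmf q S))" using fin set_cond_pmf[OF ne] by simp
  have "pmf (map_pmf f (cond_pmf q S)) c = (\<Sum>w\<in>set_pmf q \<inter> S. pmf q w / measure_pmf.prob q S * (if f w = c then 1 else 0))"
    unfolding pmf_map measure_expect[OF finc] unfolding expect_def set_cond_pmf[OF ne]
    by (rule sum.cong) (auto simp: pmf_cond[OF ne])
  also have "\<dots> \<le> (\<Sum>w\<in>set_pmf q. pmf q w / measure_pmf.prob q S * (if f w = c then 1 else 0))"
    using fin by (intro sum_mono2) auto
  also have "\<dots> = pmf (map_pmf f q) c / measure_pmf.prob q S"
    unfolding pmf_map measure_expect[OF fin] unfolding expect_def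
    by (simp add: sum_divide_distrib)
  finally show ?thesis .
qed

lemma cond_pair_pmf:
  assumes p: "finite (set_pmf p)" "set_pmf p \<inter> A \<noteq> {}" and q: "finite (set_pmf q)" "set_pmf q \<inter> B \<noteq> {}"
  shows "cond_pmf (pair_pmf p q) (A \<times> B) = pair_pmf (cond_pmf p A) (cond_pmf q B)"
proof (rule pmf_eqI)
  fix w :: "'a \<times> 'b"
  obtain a b where w: "w = (a, b)" by (cases w)
  have ne: "set_pmf (pair_pmf p q) \<inter> A \<times> B \<noteq> {}" using p q by auto
  have "measure (pair_pmf p q) (A \<times> B) = measure p A * measure q B"
  proof -
    have "measure (pair_pmf p q) (A \<times> B) = expect p (\<lambda>a. expect q (\<lambda>b. if a \<in> A \<and> b \<in> B then 1 else 0))"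
      using p q by (simp add: measure_expect expect_pair)
    also have "\<dots> = expect p (\<lambda>a. measure q B * (if a \<in> A then 1 else 0))"
      using expect_const[OF q(1), of 0] by (intro expect_cong) (simp add: measure_expect[OF q(1)])
    also have "\<dots> = measure q B * measure p A" unfolding expect_cmult by (simp add: measure_expect[OF p(1)])
    finally show ?thesis by (simp add: mult.commute)
  qed
  thus "pmf (cond_pmf (pair_pmf p q) (A \<times> B)) w = pmf (pair_pmf (cond_pmf p A) (cond_pmf q B)) w"
    by (auto simp: w pmf_cond[OF ne] pmf_pair pmf_cond[OF p(2)] pmf_cond[OF q(2)])
qed

lemma diagram_mor_tensor:
  assumes "diagram_mor G X Y f" "diagram_mor G X' Y' f'"
  shows "diagram_mor G (tensor X X') (tensor Y Y') (\<lambda>i. prod_encode \<circ> map_prod (f i) (f' i) \<circ> prod_decode)"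
proof -
  have "map_pmf (prod_encode \<circ> map_prod (f i) (f' i) \<circ> prod_decode) (sp (tensor X X') i) = sp (tensor Y Y') i"
    if "i \<in> Field G" for i
  proof -
    have "pair_pmf (sp Y i) (sp Y' i) = map_pmf (map_prod (f i) (f' i)) (pair_pmf (sp X i) (sp X' i))"
      unfolding map_prod_def map_pair using assms that by (auto simp: diagram_mor_def reduction_def)
    thus ?thesis by (simp add: tensor_def pmf.map_comp o_def)
  qed
  thus ?thesis using assms
    by (auto simp: diagram_mor_def reduction_def set_sp_tensor red_tensor)
qed

lemma diagram_aut_tensor:
  assumes "diagram_aut G X f" "diagram_aut G Y h"
  shows "diagram_aut G (tensor X Y) (\<lambda>i. prod_encode \<circ> map_prod (f i) (h i) \<circ> prod_decode)"
proof -
  obtain f' where f: "diagram_mor G X X f" "diagram_mor G X X f'"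
    "\<forall>i\<in>Field G. \<forall>a\<in>set_pmf (sp X i). f' i (f i a) = a \<and> f i (f' i a) = a"
    using assms(1) unfolding diagram_aut_def by blast
  obtain h' where h: "diagram_mor G Y Y h" "diagram_mor G Y Y h'"
    "\<forall>i\<in>Field G. \<forall>a\<in>set_pmf (sp Y i). h' i (h i a) = a \<and> h i (h' i a) = a"
    using assms(2) unfolding diagram_aut_def by blast
  show ?thesis unfolding diagram_aut_def
    by (intro conjI exI[of _ "\<lambda>i. prod_encode \<circ> map_prod (f' i) (h' i) \<circ> prod_decode"] diagram_mor_tensor f h)
      (use f(3) h(3) in \<open>auto simp: set_sp_tensor\<close>)
qed

lemma homogeneous_tensor:
  assumes "homogeneous G X" "homogeneous G Y" shows "homogeneous G (tensor X Y)"
  unfolding homogeneous_def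
proof (intro ballI)
  fix i c d assume i: "i \<in> Field G" and "c \<in> set_pmf (sp (tensor X Y) i)" "d \<in> set_pmf (sp (tensor X Y) i)"
  then obtain a b a' b' where cd: "c = prod_encode (a, b)" "d = prod_encode (a', b')"
    and s: "a \<in> set_pmf (sp X i)" "b \<in> set_pmf (sp Y i)" "a' \<in> set_pmf (sp X i)" "b' \<in> set_pmf (sp Y i)"
    by (auto simp: set_sp_tensor)
  obtain f where f: "diagram_aut G X f" "f i a = a'" using assms(1) i s(1,3) unfolding homogeneous_def by blast
  obtain h where h: "diagram_aut G Y h" "h i b = b'" using assms(2) i s(2,4) unfolding homogeneous_def by blast
  show "\<exists>f. diagram_aut G (tensor X Y) f \<and> f i c = d"
    by (intro exI[of _ "\<lambda>i. prod_encode \<circ> map_prod (f i) (h i) \<circ> prod_decode"] conjI diagram_aut_tensor f h)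
      (simp add: cd f h)
qed

text \<open>The logarithm of a linearly growing entropy stays within the order of the defect of
  quasi-linearity.\<close>

lemma ln_bound_powr:
  fixes B s E :: real
  assumes "B \<ge> 0" "s \<ge> 1" "0 \<le> E" "E \<le> B * s"
  shows "ln (2 + E) \<le> 4/3 * (2 + B) powr (3/4) * s powr (3/4)"
proof -
  have "ln (2 + E) \<le> ln ((2 + B) * s)" using assms by (intro ln_mono) (auto simp: algebra_simps)
  also have "\<dots> \<le> ((2 + B) * s) powr (3/4) / (3/4)"
    using assms mult_mono[of 1 "2 + B" 1 s] by (intro ln_powr_bound) auto
  also have "\<dots> = 4/3 * (2 + B) powr (3/4) * s powr (3/4)" using assms by (simp add: powr_mult)
  finally show ?thesis .
qed

context initial_index begin

text \<open>The independent coupling costs at most the sum of the entropies. This settles index 0,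
  where all entropies vanish.\<close>

lemma entropy_dist_le_sum:
  assumes X: "is_diagram G X" and Y: "is_diagram G Y"
  shows "entropy_dist G X Y \<le> (\<Sum>i\<in>Field G. Ent (sp X i) + Ent (sp Y i))"
proof -
  let ?q = "pair_pmf (sp X z) (sp Y z)"
  have fin: "finite (set_pmf ?q)" using X Y z_field by (simp add: is_diagram_finite)
  have r: "realizes G ?q (\<lambda>i w. red X z i (fst w)) X" "realizes G ?q (\<lambda>i w. red Y z i (snd w)) Y"
    by (rule realizes_comp[OF realizes_self[OF X]] realizes_comp[OF realizes_self[OF Y]];
      simp add: map_fst_pair_pmf map_snd_pair_pmf)+
  have "entropy_dist G X Y \<le> coupling_cost G ?q (\<lambda>i w. red X z i (fst w)) (\<lambda>i w. red Y z i (snd w))"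
    by (rule entropy_dist_le_cost[OF fin transG r X Y])
  also have "\<dots> \<le> (\<Sum>i\<in>Field G. Ent (sp X i) + Ent (sp Y i))"
    unfolding coupling_cost_def
  proof (rule sum_mono)
    fix i assume "i \<in> Field G"
    hence "map_pmf (\<lambda>w. red X z i (fst w)) ?q = sp X i" "map_pmf (\<lambda>w. red Y z i (snd w)) ?q = sp Y i"
      using r by (auto simp: realizes_def)
    thus "2 * ent (map_pmf (\<lambda>w. (red X z i (fst w), red Y z i (snd w))) ?q) - ent (map_pmf (\<lambda>w. red X z i (fst w)) ?q)
       - ent (map_pmf (\<lambda>w. red Y z i (snd w)) ?q) \<le> Ent (sp X i) + Ent (sp Y i)"
      using ent_joint_le[OF fin, of "\<lambda>w. red X z i (fst w)" "\<lambda>w. red Y z i (snd w)"] by (simp add: Ent_eq_ent)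
  qed
  finally show ?thesis .
qed

text \<open>
  Since \<open>0 powr (3/4) = 0\<close>, the condition of quasi-linearity for \<open>m = n = 0\<close> allows no error at all.
\<close>

lemma quasi_linear_Ent_0:
  assumes X: "quasi_linear G X" and i: "i \<in> Field G" shows "Ent (sp (X 0) i) = 0"
proof -
  obtain C where C: "\<forall>m n. entropy_dist G (tensor (X m) (X n)) (X (m + n)) \<le> C * real (m + n) powr (3/4)"
    using quasi_linearD[OF X] by blast
  note d = quasi_linear_diagram[OF X]
  have "\<bar>Ent (sp (tensor (X 0) (X 0)) i) - Ent (sp (X 0) i)\<bar> \<le> 0"
    using C[rule_format, of 0 0] Ent_diff_le[OF is_diagram_tensor[OF d d] d i, of 0 0 0] by simp
  thus ?thesis using Ent_tensor[of "X 0" i "X 0"] is_diagram_finite[OF d i] by simp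
qed

text \<open>A convergent sequence is bounded; at index 0 the bound holds because the entropy
  vanishes there.\<close>

lemma quasi_linear_Ent_bound:
  assumes X: "quasi_linear G X" and i: "i \<in> Field G" shows "\<exists>B\<ge>0. \<forall>n. Ent (sp (X n) i) \<le> B * real n"
proof -
  obtain B where B: "\<And>n. norm (Ent (sp (X n) i) / real n) \<le> B" "B > 0"
    using convergent_imp_Bseq[OF Ent_convergent[OF X i]] by (auto simp: Bseq_def)
  have "Ent (sp (X n) i) \<le> B * real n" for n
  proof (cases "n = 0")
    case False
    thus ?thesis using B(1)[of n] by (simp add: pos_divide_le_eq abs_le_iff)
  qed (use quasi_linear_Ent_0[OF X i] in simp)
  thus ?thesis using B(2) by (intro exI[of _ B]) auto
qed

end

section \<open>Conditioning is Lipschitz on homogeneous diagrams\<close>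

context conditioning begin

text \<open>In an independent product, conditioning on a pair of atoms conditions each factor
  separately; in this encoding the two diagrams are even equal.\<close>

lemma cond_tensor:
  assumes X: "is_diagram G X" and Y: "is_diagram G Y" and a: "a \<in> set_pmf (sp X u)" and b: "b \<in> set_pmf (sp Y u)"
  shows "cond_diagram G (tensor X Y) u (prod_encode (a, b)) = tensor (cond_diagram G X u a) (cond_diagram G Y u b)"
proof -
  let ?A = "{c. red X z u c = a}" and ?B = "{c. red Y z u c = b}"
  note fin = is_diagram_finite[OF X z_field] is_diagram_finite[OF Y z_field]
  have ne: "set_pmf (sp X z) \<inter> ?A \<noteq> {}" "set_pmf (sp Y z) \<inter> ?B \<noteq> {}"
    using fibre_nonempty[OF X a] fibre_nonempty[OF Y b] by (auto simp: fibre_def)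
  have vim: "prod_encode -` {c. red (tensor X Y) z u c = prod_encode (a, b)} = ?A \<times> ?B"
    by (auto simp: red_tensor)
  have "cnd (tensor X Y) (prod_encode (a, b)) = map_pmf prod_encode (cond_pmf (pair_pmf (sp X z) (sp Y z)) (?A \<times> ?B))"
    unfolding vim[symmetric] using ne by (subst cond_map_pmf[symmetric]) (auto simp: vim tensor_def)
  also have "\<dots> = map_pmf prod_encode (pair_pmf (cnd X a) (cnd Y b))"
    by (simp add: cond_pair_pmf[OF fin(1) ne(1) fin(2) ne(2)])
  finally have c: "cnd (tensor X Y) (prod_encode (a, b)) = map_pmf prod_encode (pair_pmf (cnd X a) (cnd Y b))" .
  have "map_pmf (red (tensor X Y) z i) (map_pmf prod_encode (pair_pmf p q)) =
    map_pmf prod_encode (pair_pmf (map_pmf (red X z i) p) (map_pmf (red Y z i) q))" for i p q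
  proof -
    have "pair_pmf (map_pmf (red X z i) p) (map_pmf (red Y z i) q) = map_pmf (map_prod (red X z i) (red Y z i)) (pair_pmf p q)"
      unfolding map_prod_def map_pair by simp
    thus ?thesis by (simp add: tensor_def pmf.map_comp o_def)
  qed
  thus ?thesis unfolding cond_diagram_push c by (simp add: push_def tensor_def)
qed

lemma Ent_cond_le:
  assumes X: "is_diagram G X" and h: "homogeneous G X" and a: "a \<in> set_pmf (sp X u)"
  shows "Ent (sp (cond_diagram G X u a) i) \<le> Ent (sp X z)"
proof -
  note F = card_fibre[OF X a]
  have "Ent (sp (cond_diagram G X u a) i) \<le> ent (cnd X a)"
    unfolding Ent_eq_ent cond_diagram_push push_simps by (rule ent_map_le) (simp add: set_cnd[OF X a] F)
  also have "\<dots> \<le> ln (card (fibre X a))"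
    by (rule ent_le_ln_card[OF F(1)]) (simp add: set_cnd[OF X a])
  also have "\<dots> \<le> ln (card (set_pmf (sp X z)))" using F by simp
  also have "\<dots> = ent (pmf_of_set (set_pmf (sp X z)))"
    by (rule ent_pmf_of_set[OF is_diagram_finite[OF X z_field] set_pmf_not_empty, symmetric])
  also have "\<dots> = Ent (sp X z)"
    unfolding Ent_eq_ent by (rule arg_cong[where f=ent, OF homogeneous_uniform[OF X h, symmetric]])
  finally show ?thesis .
qed

text \<open>Conditioning on an event \<open>S\<close> inside \<open>F u = a\<close> gives a law on
  the fibre whose density against the uniform one is at most \<open>P(F u = a) / P(S)\<close>. When
  \<open>S\<close> fixes an atom of a second space as well, the logarithm of this ratio is the
  surprisal of that atom given \<open>a\<close>.\<close>

lemma cond_translates_realized: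
  assumes X: "is_diagram G X" and h: "homogeneous G X" and q: "finite (set_pmf q)" "realizes G q F X"
    and S: "set_pmf q \<inter> S \<noteq> {}" "S \<subseteq> {w. F u w = a}"
  shows "entropy_dist G (push z X (map_pmf (F z) (cond_pmf q S))) (cond_diagram G X u a)
    \<le> card (Field G) * (2 * (ln (pmf (map_pmf (F u) q) a) - ln (measure_pmf.prob q S)) + 4 * ln (2 + Ent (sp X z)) + 8)"
proof -
  obtain w0 where w0: "w0 \<in> set_pmf q" "w0 \<in> S" using S(1) by blast
  have mS: "measure_pmf.prob q S > 0"
  proof -
    have "0 < pmf q w0" by (rule pmf_positive[OF w0(1)])
    also have "\<dots> \<le> measure_pmf.prob q S"
      unfolding measure_pmf_single[symmetric] using w0 by (intro measure_pmf.finite_measure_mono) auto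
    finally show ?thesis .
  qed
  have Fr: "red X z i (F z w) = F i w" if "i \<in> Field G" "w \<in> set_pmf q" for i w
    using q(2) z_to[OF that(1)] that(2) unfolding realizes_def by blast
  have a: "a \<in> set_pmf (sp X u)" using realizes_in[OF q(2) u w0(1)] w0(2) S(2) by auto
  have spu: "map_pmf (F u) q = sp X u" and spz: "map_pmf (F z) q = sp X z"
    using q(2) u z_field by (auto simp: realizes_def)
  let ?A = "set_pmf (sp X z)" and ?P = "pmf (map_pmf (F u) q) a"
  have A: "finite ?A" "?A \<noteq> {}" using is_diagram_finite[OF X z_field] by (auto simp: set_pmf_not_empty)
  note Fb = card_fibre[OF X a]
  have P: "?P = card (fibre X a) / card ?A"
  proof -
    have "?P = pmf (map_pmf (red X z u) (sp X z)) a"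
      unfolding spu is_diagram_reduction[OF X z_to[OF u]] ..
    also have "\<dots> = measure (pmf_of_set ?A) (red X z u -` {a})"
      unfolding pmf_map by (rule arg_cong[where f="\<lambda>p. measure_pmf.prob p _", OF homogeneous_uniform[OF X h]])
    also have "\<dots> = card (fibre X a) / card ?A"
      using A by (simp add: measure_pmf_of_set fibre_def vimage_def Int_def)
    finally show ?thesis .
  qed
  have SP: "measure_pmf.prob q S \<le> ?P"
    unfolding pmf_map using S(2) by (intro measure_pmf.finite_measure_mono) auto
  have "entropy_dist G (push z X (map_pmf (F z) (cond_pmf q S))) (cond_diagram G X u a)
    \<le> card (Field G) * (2 * ln (?P / measure_pmf.prob q S) + 4 * ln (2 + Ent (sp X z)) + 8)"
  proof (rule cond_translates[OF X h a])
    show "set_pmf (map_pmf (F z) (cond_pmf q S)) \<subseteq> fibre X a"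
    proof
      fix c assume "c \<in> set_pmf (map_pmf (F z) (cond_pmf q S))"
      then obtain w where w: "w \<in> set_pmf q" "w \<in> S" "c = F z w" using set_cond_pmf[OF S(1)] by auto
      thus "c \<in> fibre X a" using Fr[OF u w(1)] realizes_in[OF q(2) z_field w(1)] S(2) by (auto simp: fibre_def)
    qed
    show "1 \<le> ?P / measure_pmf.prob q S" using SP mS by simp
    fix c assume c: "c \<in> fibre X a"
    have "pmf (map_pmf (F z) (cond_pmf q S)) c \<le> pmf (sp X z) c / measure_pmf.prob q S"
      using pmf_map_cond_le[OF q(1) S(1), of "F z" c] by (simp only: spz)
    also have "pmf (sp X z) c = pmf (pmf_of_set ?A) c"
      by (rule arg_cong[where f="\<lambda>p. pmf p c", OF homogeneous_uniform[OF X h]])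
    also have "\<dots> = 1 / card ?A" using c A by (simp add: fibre_def)
    also have "1 / card ?A / measure_pmf.prob q S = ?P / measure_pmf.prob q S / card (fibre X a)"
      unfolding P using Fb mS by auto
    finally show "pmf (map_pmf (F z) (cond_pmf q S)) c \<le> ?P / measure_pmf.prob q S / card (fibre X a)" .
  qed
  also have "ln (?P / measure_pmf.prob q S) = ln ?P - ln (measure_pmf.prob q S)" using SP mS by (simp add: ln_div)
  finally show ?thesis .
qed

lemma realizes_cond:
  assumes q: "finite (set_pmf q)" "realizes G q F X" and S: "set_pmf q \<inter> S \<noteq> {}"
  shows "realizes G (cond_pmf q S) F (push z X (map_pmf (F z) (cond_pmf q S)))"
proof -
  have sub: "set_pmf (cond_pmf q S) \<subseteq> set_pmf q" using set_cond_pmf[OF S] by auto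
  have Fr: "red X i j (F i w) = F j w" if "(i, j) \<in> G" "w \<in> set_pmf q" for i j w
    using q(2) that unfolding realizes_def by blast
  have "map_pmf (F i) (cond_pmf q S) = map_pmf (red X z i) (map_pmf (F z) (cond_pmf q S))" if "i \<in> Field G" for i
    unfolding pmf.map_comp o_def
    by (rule map_pmf_cong[OF refl]) (use Fr[OF z_to[OF that]] sub in auto)
  thus ?thesis using Fr sub by (auto simp: realizes_def)
qed

text \<open>
  The atoms \<open>v = (a1, b1)\<close> are chosen so that the cost of the coupling conditioned on \<open>v\<close> and the surprisals
  of \<open>b1\<close> given \<open>a1\<close> and of \<open>a1\<close> given \<open>b1\<close> do not exceed their averages; by homogeneity \<open>a\<close> and \<open>b\<close> may
  be replaced by \<open>a1\<close> and \<open>b1\<close>.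
\<close>

lemma cond_lipschitz:
  assumes X: "is_diagram G X" and hX: "homogeneous G X" and a: "a \<in> set_pmf (sp X u)"
    and Y: "is_diagram G Y" and hY: "homogeneous G Y" and b: "b \<in> set_pmf (sp Y u)"
  shows "entropy_dist G (cond_diagram G X u a) (cond_diagram G Y u b) \<le> (1 + 2 * real (card (Field G))) * entropy_dist G X Y
    + card (Field G) * (4 * ln (2 + Ent (sp X z)) + 4 * ln (2 + Ent (sp Y z)) + 16)"
proof (rule field_le_epsilon)
  fix e :: real assume e: "e > 0"
  let ?N = "real (card (Field G))"
  \<comment> \<open>The slack is divided by the Lipschitz constant with which it will be
    multiplied.\<close>
  let ?c = "entropy_dist G X Y + e / (1 + 2 * ?N)"
  have N: "1 + 2 * ?N > 0" by (intro add_pos_nonneg) auto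
  have "entropy_dist G X Y < ?c" using e N by simp
  from coupling_exists[OF X Y this] obtain q :: "nat pmf" and F F'
    where q: "finite (set_pmf q)" "realizes G q F X" "realizes G q F' Y" "coupling_cost G q F F' < ?c" by blast
  define W where "W w = (F u w, F' u w)" for w
  let ?r = "map_pmf W q"
  have finr: "finite (set_pmf ?r)" using q(1) by simp
  have rf: "map_pmf fst ?r = map_pmf (F u) q" "map_pmf snd ?r = map_pmf (F' u) q"
    by (simp_all add: pmf.map_comp o_def W_def)
  \<comment> \<open>The surprisal of the second atom given the first; \<open>l2\<close> is the
    reverse.\<close>
  define l1 where "l1 v = ln (pmf (map_pmf (F u) q) (fst v)) - ln (pmf ?r v)" for v
  define l2 where "l2 v = ln (pmf (map_pmf (F' u) q) (snd v)) - ln (pmf ?r v)" for v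
  \<comment> \<open>One weighted sum, so that a single atom \<open>v\<close> controls the cost and
    both surprisals; the weight is that of the surprisals in the bounds for the translates.\<close>
  define \<phi> where "\<phi> v = coupling_cost G (cond_pmf q {w. W w = v}) F F' + 2 * ?N * (l1 v + l2 v)" for v
  have l1: "expect ?r l1 = ent ?r - ent (map_pmf (F u) q)"
    unfolding l1_def expect_diff using ent_map[OF finr, of fst] by (simp add: rf ent_expect expect_uminus)
  have l2: "expect ?r l2 = ent ?r - ent (map_pmf (F' u) q)"
    unfolding l2_def expect_diff using ent_map[OF finr, of snd] by (simp add: rf ent_expect expect_uminus)
  \<comment> \<open>The mean surprisals add up to the summand at \<open>u\<close> of the coupling
    cost; the other summands are nonnegative.\<close>
  have cu: "expect ?r l1 + expect ?r l2 \<le> coupling_cost G q F F'"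
  proof -
    let ?g = "\<lambda>i. 2 * ent (map_pmf (\<lambda>w. (F i w, F' i w)) q) - ent (map_pmf (F i) q) - ent (map_pmf (F' i) q)"
    have "?g u \<le> (\<Sum>i\<in>Field G. ?g i)"
    proof (rule member_le_sum[OF u _ fin])
      fix i
      show "0 \<le> ?g i"
        using ent_mono[OF q(1), of "\<lambda>w. (F i w, F' i w)" "F i"] ent_mono[OF q(1), of "\<lambda>w. (F i w, F' i w)" "F' i"] by auto
    qed
    thus ?thesis unfolding l1 l2 coupling_cost_def W_def by simp
  qed
  have "expect ?r \<phi> = expect ?r (\<lambda>v. coupling_cost G (cond_pmf q {w. W w = v}) F F') + 2 * ?N * (expect ?r l1 + expect ?r l2)"
    unfolding \<phi>_def by (simp only: expect_add expect_cmult)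
  also have "\<dots> \<le> coupling_cost G q F F' + 2 * ?N * coupling_cost G q F F'"
    by (intro add_mono coupling_cost_conditional q mult_left_mono cu) auto
  also have "\<dots> = (1 + 2 * ?N) * coupling_cost G q F F'" by (simp add: distrib_right)
  also have "\<dots> \<le> (1 + 2 * ?N) * ?c" using q(4) N by (intro mult_left_mono) auto
  also have "\<dots> = (1 + 2 * ?N) * entropy_dist G X Y + e" using N by (simp add: distrib_left)
  finally obtain v where v: "v \<in> set_pmf ?r" "\<phi> v \<le> (1 + 2 * ?N) * entropy_dist G X Y + e"
    using expect_exists_le[OF finr] by blast
  obtain a1 b1 where ab: "v = (a1, b1)" by (cases v)
  define S where "S = {w. W w = v}"
  have S: "set_pmf q \<inter> S \<noteq> {}" using v(1) by (auto simp: S_def)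
  have S1: "S \<subseteq> {w. F u w = a1}" and S2: "S \<subseteq> {w. F' u w = b1}" by (auto simp: S_def W_def ab)
  have mS: "measure_pmf.prob q S = pmf ?r v" by (simp add: pmf_map S_def vimage_def)
  obtain w0 where w0: "w0 \<in> set_pmf q" "w0 \<in> S" using S by blast
  have a1: "a1 \<in> set_pmf (sp X u)" and b1: "b1 \<in> set_pmf (sp Y u)"
    using realizes_in[OF q(2) u w0(1)] realizes_in[OF q(3) u w0(1)] w0(2) S1 S2 by auto
  let ?X1 = "push z X (map_pmf (F z) (cond_pmf q S))" and ?Y1 = "push z Y (map_pmf (F' z) (cond_pmf q S))"
  have finc: "finite (set_pmf (cond_pmf q S))" using q(1) set_cond_pmf[OF S] by simp
  have dX1: "is_diagram G ?X1"
    by (rule is_diagram_push[OF X]) (use realizes_in[OF q(2) z_field] set_cond_pmf[OF S] in auto)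
  have dY1: "is_diagram G ?Y1"
    by (rule is_diagram_push[OF Y]) (use realizes_in[OF q(3) z_field] set_cond_pmf[OF S] in auto)
  let ?C = "cond_diagram G"
  note dC = is_diagram_cond[OF X a] is_diagram_cond[OF X a1] is_diagram_cond[OF Y b1] is_diagram_cond[OF Y b]
  have k1: "entropy_dist G (?C X u a1) ?X1 \<le> ?N * (2 * l1 v + 4 * ln (2 + Ent (sp X z)) + 8)"
    using cond_translates_realized[OF X hX q(1,2) S S1] by (simp add: entropy_dist_commute mS l1_def ab)
  have k2: "entropy_dist G ?Y1 (?C Y u b1) \<le> ?N * (2 * l2 v + 4 * ln (2 + Ent (sp Y z)) + 8)"
    using cond_translates_realized[OF Y hY q(1,3) S S2] by (simp add: mS l2_def ab)
  have k3: "entropy_dist G ?X1 ?Y1 \<le> coupling_cost G (cond_pmf q S) F F'"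
    by (rule entropy_dist_le_cost[OF finc transG realizes_cond[OF q(1,2) S] realizes_cond[OF q(1,3) S] dX1 dY1])
  have t1: "entropy_dist G (?C X u a) (?C Y u b) \<le> entropy_dist G (?C X u a) (?C X u a1) + entropy_dist G (?C X u a1) (?C Y u b)"
    by (intro entropy_dist_triangle dC)
  have t2: "entropy_dist G (?C X u a1) (?C Y u b) \<le> entropy_dist G (?C X u a1) ?X1 + entropy_dist G ?X1 (?C Y u b)"
    by (intro entropy_dist_triangle dC dX1)
  have t3: "entropy_dist G ?X1 (?C Y u b) \<le> entropy_dist G ?X1 ?Y1 + entropy_dist G ?Y1 (?C Y u b)"
    by (intro entropy_dist_triangle dC dX1 dY1)
  have t4: "entropy_dist G ?Y1 (?C Y u b) \<le> entropy_dist G ?Y1 (?C Y u b1) + entropy_dist G (?C Y u b1) (?C Y u b)"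
    by (intro entropy_dist_triangle dC dY1)
  have z: "entropy_dist G (?C X u a) (?C X u a1) = 0" "entropy_dist G (?C Y u b1) (?C Y u b) = 0"
    by (rule cond_independent_of_atom[OF X hX a a1] cond_independent_of_atom[OF Y hY b1 b])+
  have "entropy_dist G (?C X u a) (?C Y u b) \<le> ?N * (2 * l1 v + 4 * ln (2 + Ent (sp X z)) + 8)
     + (coupling_cost G (cond_pmf q S) F F' + ?N * (2 * l2 v + 4 * ln (2 + Ent (sp Y z)) + 8))"
    using t1 t2 t3 t4 z k1 k2 k3 by linarith
  also have "\<dots> = \<phi> v + ?N * (4 * ln (2 + Ent (sp X z)) + 4 * ln (2 + Ent (sp Y z)) + 16)"
    unfolding \<phi>_def S_def[symmetric] by (simp add: algebra_simps)
  also have "\<dots> \<le> (1 + 2 * ?N) * entropy_dist G X Y + e + ?N * (4 * ln (2 + Ent (sp X z)) + 4 * ln (2 + Ent (sp Y z)) + 16)"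
    using v(2) by simp
  finally show "entropy_dist G (?C X u a) (?C Y u b) \<le> (1 + 2 * ?N) * entropy_dist G X Y
    + ?N * (4 * ln (2 + Ent (sp X z)) + 4 * ln (2 + Ent (sp Y z)) + 16) + e" by simp
qed

text \<open>The tensor of conditionals is the conditional of the tensor, so the Lipschitz bound
  compares it with the conditional at \<open>m + n\<close>; the logarithms fit into the allowed
  defect.\<close>

lemma quasi_linear_cond:
  assumes X: "quasi_linear G X" and h: "\<And>n. homogeneous G (X n)" and a: "\<And>n. a n \<in> set_pmf (sp (X n) u)"
  shows "quasi_linear G (\<lambda>n. cond_diagram G (X n) u (a n))"
proof -
  obtain C where C: "C > 0" "\<forall>m n. entropy_dist G (tensor (X m) (X n)) (X (m + n)) \<le> C * real (m + n) powr (3/4)"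
    using quasi_linearD[OF X] by blast
  obtain B where B: "B \<ge> 0" "\<And>n. Ent (sp (X n) z) \<le> B * real n"
    using quasi_linear_Ent_bound[OF X z_field] by blast
  note d = quasi_linear_diagram[OF X]
  let ?N = "real (card (Field G))" and ?c = "\<lambda>n. cond_diagram G (X n) u (a n)"
  define K where "K = (1 + 2 * ?N) * C + ?N * (8 * (4/3 * (2 + B) powr (3/4)) + 16)"
  have dc: "is_diagram G (?c n)" for n by (rule is_diagram_cond[OF d a])
  have K: "K > 0" unfolding K_def using C(1) by (intro add_pos_nonneg mult_pos_pos) auto
  have "entropy_dist G (tensor (?c m) (?c n)) (?c (m + n)) \<le> K * real (m + n) powr (3/4)" for m n
  \<comment> \<open>The defect allowed at index 0 is 0; there all entropies vanish and the
    independent coupling is free.\<close>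
  proof (cases "m + n = 0")
    case True
    have E0: "Ent (sp (?c 0) i) = 0" for i
      using Ent_cond_le[OF d h a, of 0 i] quasi_linear_Ent_0[OF X z_field] ent_nonneg[of "sp (?c 0) i"] by (simp add: Ent_eq_ent)
    have "entropy_dist G (tensor (?c 0) (?c 0)) (?c 0) \<le> (\<Sum>i\<in>Field G. 0)"
      by (rule order.trans[OF entropy_dist_le_sum[OF is_diagram_tensor[OF dc dc] dc]], rule sum_mono)
        (simp add: Ent_tensor is_diagram_finite[OF dc] E0)
    thus ?thesis using True by simp
  next
    case False
    let ?s = "real (m + n)" let ?T = "tensor (X m) (X n)"
    have "1 \<le> m + n" using False by linarith
    hence "real 1 \<le> ?s" by (simp only: of_nat_le_iff)
    hence s: "?s \<ge> 1" by simp
    have s1: "?s powr (3/4) \<ge> 1" using s by (intro ge_one_powr_ge_zero) auto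
    have ab: "prod_encode (a m, a n) \<in> set_pmf (sp ?T u)" using a by (auto simp: set_sp_tensor)
    have E1: "Ent (sp ?T z) \<le> B * ?s"
      using B(2)[of m] B(2)[of n] by (simp add: Ent_tensor is_diagram_finite[OF d z_field] algebra_simps)
    have E2: "Ent (sp (X (m + n)) z) \<le> B * ?s" by (rule B(2))
    have "entropy_dist G (tensor (?c m) (?c n)) (?c (m + n)) =
       entropy_dist G (cond_diagram G ?T u (prod_encode (a m, a n))) (?c (m + n))"
      by (simp only: cond_tensor[OF d d a a])
    also have "\<dots> \<le> (1 + 2 * ?N) * entropy_dist G ?T (X (m + n)) +
       ?N * (4 * ln (2 + Ent (sp ?T z)) + 4 * ln (2 + Ent (sp (X (m + n)) z)) + 16)"
      by (rule cond_lipschitz[OF is_diagram_tensor[OF d d] homogeneous_tensor[OF h h] ab d h a])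
    also have "\<dots> \<le> (1 + 2 * ?N) * (C * ?s powr (3/4)) + ?N * (4 * (4/3 * (2 + B) powr (3/4) * ?s powr (3/4))
       + 4 * (4/3 * (2 + B) powr (3/4) * ?s powr (3/4)) + 16 * ?s powr (3/4))"
      using s1 C(2) by (intro add_mono mult_left_mono ln_bound_powr B s E1 E2) (auto simp: Ent_eq_ent ent_nonneg)
    also have "\<dots> = K * ?s powr (3/4)" unfolding K_def by (simp add: algebra_simps)
    finally show ?thesis .
  qed
  thus ?thesis unfolding quasi_linear_def using dc K by blast
qed

text \<open>Divided by \<open>n\<close>, the logarithmic terms vanish in the limit.\<close>

lemma asym_cond_lipschitz:
  assumes X: "quasi_linear G X" and hX: "\<And>n. homogeneous G (X n)" and a: "\<And>n. a n \<in> set_pmf (sp (X n) u)"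
    and Y: "quasi_linear G Y" and hY: "\<And>n. homogeneous G (Y n)" and b: "\<And>n. b n \<in> set_pmf (sp (Y n) u)"
  shows "asym_entropy_dist G (\<lambda>n. cond_diagram G (X n) u (a n)) (\<lambda>n. cond_diagram G (Y n) u (b n))
    \<le> (1 + 2 * real (card (Field G))) * asym_entropy_dist G X Y"
proof (rule asym_entropy_dist_le[OF quasi_linear_cond[OF X hX a] quasi_linear_cond[OF Y hY b]])
  let ?N = "real (card (Field G))"
  let ?f = "\<lambda>n. (1 + 2 * real (card (Field G))) * entropy_dist G (X n) (Y n)
    + card (Field G) * (4 * ln (2 + Ent (sp (X n) z)) + 4 * ln (2 + Ent (sp (Y n) z)) + 16)"
  show "entropy_dist G (cond_diagram G (X n) u (a n)) (cond_diagram G (Y n) u (b n)) \<le> ?f n" for n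
    by (rule cond_lipschitz[OF quasi_linear_diagram[OF X] hX a quasi_linear_diagram[OF Y] hY b])
  have l: "(\<lambda>n. ln (2 + Ent (sp (X n) z)) / real n) \<longlonglongrightarrow> 0" if X: "quasi_linear G X" for X
  proof -
    obtain B where B: "B \<ge> 0" "\<And>n. Ent (sp (X n) z) \<le> B * real n"
      using quasi_linear_Ent_bound[OF X z_field] by blast
    show ?thesis
    proof (rule Lim_null_comparison)
      show "(\<lambda>n. 4/3 * (2 + B) powr (3/4) * real n powr (-1/4)) \<longlonglongrightarrow> 0"
        by (rule tendsto_mult_right_zero, rule tendsto_neg_powr, simp, rule filterlim_real_sequentially)
      show "\<forall>\<^sub>F n in sequentially. norm (ln (2 + Ent (sp (X n) z)) / real n) \<le> 4/3 * (2 + B) powr (3/4) * real n powr (-1/4)"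
      proof (rule eventually_sequentiallyI[of 1])
        fix n :: nat assume n: "n \<ge> 1"
        have E0: "Ent (sp (X n) z) \<ge> 0" by (simp add: Ent_eq_ent ent_nonneg)
        have "ln (2 + Ent (sp (X n) z)) \<le> 4/3 * (2 + B) powr (3/4) * real n powr (3/4)"
          using n by (intro ln_bound_powr B E0) auto
        also have "real n powr (3/4) = real n powr (-1/4) * real n"
          using n powr_add[of "real n" "-1/4" 1] by simp
        finally show "norm (ln (2 + Ent (sp (X n) z)) / real n) \<le> 4/3 * (2 + B) powr (3/4) * real n powr (-1/4)"
          using n E0 by (simp add: pos_divide_le_eq mult.assoc)
      qed
    qed
  qed
  have eq: "?f n / real n = (1 + 2 * real (card (Field G))) * (entropy_dist G (X n) (Y n) / real n)
      + ?N * (4 * (ln (2 + Ent (sp (X n) z)) / real n) + 4 * (ln (2 + Ent (sp (Y n) z)) / real n) + 16 / real n)" for n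
    by (simp add: add_divide_distrib times_divide_eq_right[symmetric] del: times_divide_eq_right)
  have "(\<lambda>n. ?f n / real n) \<longlonglongrightarrow> (1 + 2 * real (card (Field G))) * asym_entropy_dist G X Y + ?N * (4 * 0 + 4 * 0 + 0)"
    unfolding eq by (intro tendsto_intros l X Y asym_entropy_dist_lim lim_const_over_n)
  thus "(\<lambda>n. ?f n / real n) \<longlonglongrightarrow> (1 + 2 * real (card (Field G))) * asym_entropy_dist G X Y" by simp
qed

text \<open>Two homogeneous representatives are at asymptotic distance 0, so by the Lipschitz bound
  their conditionals are too, whatever atoms are chosen.\<close>

lemma hom_cond_eq:
  assumes x: "x \<in> Field G" and T: "T \<in> tropical G" "X \<in> T" and h: "\<And>n. homogeneous G (X n)" and a: "\<And>n. a n \<in> set_pmf (sp (X n) u)"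
  shows "hom_cond G (descendants G x) u T = asym_eq (Restr G (descendants G x)) `` {\<lambda>n. cond_diagram G (X n) u (a n)}"
proof -
  let ?R = "Restr G (descendants G x)" let ?c = "\<lambda>X a n. cond_diagram G (X n) u (a n)"
  interpret R: initial_index ?R x by (rule initial_index_Restr[OF x])
  have "asym_eq ?R `` {?c Y b} = asym_eq ?R `` {?c X a}"
    if Y: "Y \<in> T" "\<And>n. homogeneous G (Y n)" "\<And>n. b n \<in> set_pmf (sp (Y n) u)" for Y b
  proof (rule R.cls_eq)
    note ql = tropical_quasi_linear[OF T] tropical_quasi_linear[OF T(1) Y(1)]
    note qc = quasi_linear_cond[OF ql(1) h a] quasi_linear_cond[OF ql(2) Y(2,3)]
    show q: "quasi_linear ?R (?c Y b)" "quasi_linear ?R (?c X a)" by (rule quasi_linear_Restr qc)+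
    have "asym_entropy_dist ?R (?c Y b) (?c X a) \<le> asym_entropy_dist G (?c Y b) (?c X a)"
      by (rule asym_entropy_dist_Restr[OF x qc(2,1)])
    also have "\<dots> \<le> (1 + 2 * real (card (Field G))) * asym_entropy_dist G Y X"
      by (rule asym_cond_lipschitz[OF ql(2) Y(2,3) ql(1) h a])
    also have "asym_entropy_dist G Y X = 0" by (rule tropical_dist_0[OF T(1) Y(1) T(2)])
    finally show "asym_entropy_dist ?R (?c Y b) (?c X a) = 0" using R.asym_entropy_dist_nonneg[OF q] by simp
  qed
  hence "asym_eq ?R `` {?c X a | X a. X \<in> T \<and> (\<forall>n. homogeneous G (X n)) \<and> (\<forall>n. a n \<in> set_pmf (sp (X n) u))}
    = asym_eq ?R `` {?c X a}" using T(2) h a by blast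
  thus ?thesis by (simp add: hom_cond_def)
qed

lemma hom_cond_tropical:
  assumes x: "x \<in> Field G" and T: "T \<in> tropical G" "X \<in> T" and h: "\<And>n. homogeneous G (X n)"
  shows "\<exists>a. (\<forall>n. a n \<in> set_pmf (sp (X n) u)) \<and>
    hom_cond G (descendants G x) u T = asym_eq (Restr G (descendants G x)) `` {\<lambda>n. cond_diagram G (X n) u (a n)} \<and>
    hom_cond G (descendants G x) u T \<in> tropical (Restr G (descendants G x))"
proof -
  let ?R = "Restr G (descendants G x)"
  interpret R: initial_index ?R x by (rule initial_index_Restr[OF x])
  define a where "a n = (SOME c. c \<in> set_pmf (sp (X n) u))" for n
  have a: "a n \<in> set_pmf (sp (X n) u)" for n unfolding a_def by (simp add: some_in_eq set_pmf_not_empty)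
  have eq: "hom_cond G (descendants G x) u T = asym_eq ?R `` {\<lambda>n. cond_diagram G (X n) u (a n)}"
    by (rule hom_cond_eq[OF x T h a])
  have "hom_cond G (descendants G x) u T \<in> tropical ?R"
    unfolding eq by (rule R.cls_tropical, rule quasi_linear_Restr, rule quasi_linear_cond[OF tropical_quasi_linear[OF T] h a])
  with a eq show ?thesis by blast
qed

lemma hom_cond_lipschitz:
  assumes x: "x \<in> Field G" and S: "S \<in> tropical_homogeneous G" and T: "T \<in> tropical_homogeneous G"
  shows "trop_dist (Restr G (descendants G x)) (hom_cond G (descendants G x) u S) (hom_cond G (descendants G x) u T)
    \<le> (1 + 2 * real (card (Field G))) * trop_dist G S T"
proof -
  let ?R = "Restr G (descendants G x)"
  interpret R: initial_index ?R x by (rule initial_index_Restr[OF x])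
  obtain X where X: "S \<in> tropical G" "X \<in> S" "\<And>n. homogeneous G (X n)" using S unfolding tropical_homogeneous_def by blast
  obtain Y where Y: "T \<in> tropical G" "Y \<in> T" "\<And>n. homogeneous G (Y n)" using T unfolding tropical_homogeneous_def by blast
  obtain a where a: "\<And>n. a n \<in> set_pmf (sp (X n) u)"
    "hom_cond G (descendants G x) u S = asym_eq ?R `` {\<lambda>n. cond_diagram G (X n) u (a n)}"
    "hom_cond G (descendants G x) u S \<in> tropical ?R"
    using hom_cond_tropical[OF x X] by blast
  obtain b where b: "\<And>n. b n \<in> set_pmf (sp (Y n) u)"
    "hom_cond G (descendants G x) u T = asym_eq ?R `` {\<lambda>n. cond_diagram G (Y n) u (b n)}"
    "hom_cond G (descendants G x) u T \<in> tropical ?R"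
    using hom_cond_tropical[OF x Y] by blast
  note ql = tropical_quasi_linear[OF X(1,2)] tropical_quasi_linear[OF Y(1,2)]
  note qc = quasi_linear_cond[OF ql(1) X(3) a(1)] quasi_linear_cond[OF ql(2) Y(3) b(1)]
  have "trop_dist ?R (hom_cond G (descendants G x) u S) (hom_cond G (descendants G x) u T) =
    asym_entropy_dist ?R (\<lambda>n. cond_diagram G (X n) u (a n)) (\<lambda>n. cond_diagram G (Y n) u (b n))"
    unfolding a(2) b(2) by (rule R.trop_dist_cls) (intro quasi_linear_Restr qc)+
  also have "\<dots> \<le> asym_entropy_dist G (\<lambda>n. cond_diagram G (X n) u (a n)) (\<lambda>n. cond_diagram G (Y n) u (b n))"
    by (rule asym_entropy_dist_Restr[OF x qc])
  also have "\<dots> \<le> (1 + 2 * real (card (Field G))) * asym_entropy_dist G X Y"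
    by (rule asym_cond_lipschitz[OF ql(1) X(3) a(1) ql(2) Y(3) b(1)])
  also have "asym_entropy_dist G X Y = trop_dist G S T" by (rule trop_dist_eq[OF X(1,2) Y(1,2), symmetric])
  finally show ?thesis .
qed

end


section \<open>Random permutations of lists\<close>

abbreviation perms :: "nat \<Rightarrow> (nat \<Rightarrow> nat) set" where "perms n \<equiv> {\<sigma>. \<sigma> permutes {..<n}}"

definition shuffled :: "'a list \<Rightarrow> 'a list pmf" where
  "shuffled xs = map_pmf (\<lambda>\<sigma>. permute_list \<sigma> xs) (pmf_of_set (perms (length xs)))"

lemma finite_perms: "finite (perms n)" "perms n \<noteq> {}"
  by (rule finite_permutations, simp) (use permutes_id in blast)

lemma set_perms [simp]: "set_pmf (pmf_of_set (perms n)) = perms n"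
  using finite_perms by (rule set_pmf_of_set[rotated])

lemma map_compose_perms:
  assumes "\<tau> permutes {..<n}"
  shows "map_pmf (\<lambda>\<sigma>. \<sigma> \<circ> \<tau>) (pmf_of_set (perms n)) = pmf_of_set (perms n)"
    and "map_pmf (\<lambda>\<sigma>. \<tau> \<circ> \<sigma>) (pmf_of_set (perms n)) = pmf_of_set (perms n)"
proof -
  have s: "surj \<tau>" "inj \<tau>" using assms by (auto dest: permutes_surj permutes_inj)
  have "inj_on (\<lambda>\<sigma>. \<sigma> \<circ> \<tau>) (perms n)"
    using s(1) by (auto simp: inj_on_def fun_eq_iff surj_def) metis
  moreover have "(\<lambda>\<sigma>. \<sigma> \<circ> \<tau>) ` perms n = perms n"
    using image_compose_permutations_right[OF assms] by (auto simp: image_def)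
  ultimately show "map_pmf (\<lambda>\<sigma>. \<sigma> \<circ> \<tau>) (pmf_of_set (perms n)) = pmf_of_set (perms n)"
    using map_pmf_of_set_inj[OF _ finite_perms(2,1)] by metis
  have "inj_on (\<lambda>\<sigma>. \<tau> \<circ> \<sigma>) (perms n)"
    using s(2) by (auto simp: inj_on_def fun_eq_iff dest: injD)
  moreover have "(\<lambda>\<sigma>. \<tau> \<circ> \<sigma>) ` perms n = perms n"
    using image_compose_permutations_left[OF assms] by (auto simp: image_def)
  ultimately show "map_pmf (\<lambda>\<sigma>. \<tau> \<circ> \<sigma>) (pmf_of_set (perms n)) = pmf_of_set (perms n)"
    using map_pmf_of_set_inj[OF _ finite_perms(2,1)] by metis
qed

text \<open>Arrangements of the same letters differ by a fixed permutation, which is absorbed by the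
  uniform one.\<close>

lemma shuffled_cong:
  assumes "mset xs = mset ys" shows "shuffled xs = shuffled ys"
proof -
  obtain \<tau> where \<tau>: "\<tau> permutes {..<length ys}" "permute_list \<tau> ys = xs"
    using mset_eq_permutation[OF assms] by blast
  have len: "length xs = length ys" using assms by (rule mset_eq_length)
  have "shuffled xs = map_pmf (\<lambda>\<sigma>. permute_list (\<tau> \<circ> \<sigma>) ys) (pmf_of_set (perms (length ys)))"
    unfolding shuffled_def len
    by (rule map_pmf_cong[OF refl]) (auto simp: \<tau>(2)[symmetric] permute_list_compose finite_perms)
  also have "\<dots> = map_pmf (\<lambda>\<sigma>. permute_list \<sigma> ys) (map_pmf (\<lambda>\<sigma>. \<tau> \<circ> \<sigma>) (pmf_of_set (perms (length ys))))"
    by (simp add: pmf.map_comp o_def)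
  finally show ?thesis by (simp add: map_compose_perms(2)[OF \<tau>(1)] shuffled_def)
qed

lemma set_shuffled: "xs \<in> set_pmf (shuffled ys) \<Longrightarrow> mset xs = mset ys"
  by (auto simp: shuffled_def finite_perms)

lemma replicate_pmf_pair: "replicate_pmf (Suc n) p = map_pmf (\<lambda>(x, xs). x # xs) (pair_pmf p (replicate_pmf n p))"
  by (simp add: pair_pmf_def map_bind_pmf)

lemma pmf_replicate:
  "length xs = n \<Longrightarrow> pmf (replicate_pmf n p) xs = prod_list (map (pmf p) xs)"
proof (induction xs arbitrary: n)
  case (Cons x xs)
  have "pmf (map_pmf (\<lambda>(x, xs). x # xs) (pair_pmf p (replicate_pmf (length xs) p))) ((\<lambda>(x, xs). x # xs) (x, xs)) =
    pmf (pair_pmf p (replicate_pmf (length xs) p)) (x, xs)"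
    by (rule pmf_map_inj') (auto simp: inj_on_def)
  thus ?case using Cons by (auto simp: replicate_pmf_pair pmf_pair simp del: replicate_pmf.simps)
qed auto

text \<open>Exchangeability: the weight of a word is the product of the weights of its letters, in
  whatever order.\<close>

lemma map_permute_replicate:
  assumes \<sigma>: "\<sigma> permutes {..<n}"
  shows "map_pmf (permute_list \<sigma>) (replicate_pmf n p) = replicate_pmf n p"
proof (rule pmf_eqI)
  fix ys
  let ?R = "replicate_pmf n p"
  have len: "length xs = n" if "xs \<in> set_pmf ?R" for xs using that by (simp add: set_replicate_pmf)
  have inv: "permute_list (inv \<sigma>) (permute_list \<sigma> xs) = xs" "permute_list \<sigma> (permute_list (inv \<sigma>) xs) = xs"
    if "length xs = n" for xs
    using that permutes_inv[OF \<sigma>] \<sigma> permutes_inv_o[OF \<sigma>] by (simp_all flip: permute_list_compose)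
  show "pmf (map_pmf (permute_list \<sigma>) ?R) ys = pmf ?R ys"
  proof (cases "length ys = n")
    case True
    define xs where "xs = permute_list (inv \<sigma>) ys"
    have xs: "permute_list \<sigma> xs = ys" "length xs = n" using inv True by (auto simp: xs_def)
    have "pmf (map_pmf (permute_list \<sigma>) ?R) ys = measure ?R {xs}"
      unfolding pmf_map
    proof (rule measure_prob_cong_0)
      fix v assume "v \<in> permute_list \<sigma> -` {ys} - {xs}"
      hence "permute_list \<sigma> v = ys" "v \<noteq> xs" by auto
      hence "length v \<noteq> n" using inv(1)[of v] by (auto simp: xs_def)
      thus "pmf ?R v = 0" using len by (auto simp: set_pmf_iff)
    qed (use xs in auto)
    also have "\<dots> = pmf ?R xs" by (simp add: measure_pmf_single)
    also have "\<dots> = pmf ?R ys"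
    proof -
      have "mset xs = mset ys" using xs \<sigma> by (metis mset_permute_list)
      hence "prod_list (map (pmf p) xs) = prod_list (map (pmf p) ys)"
        by (metis mset_map prod_mset_prod_list)
      thus ?thesis using True xs(2) by (simp add: pmf_replicate)
    qed
    finally show ?thesis .
  next
    case False
    have "ys \<notin> set_pmf ?R" "ys \<notin> set_pmf (map_pmf (permute_list \<sigma>) ?R)" using False len by auto
    hence "pmf ?R ys = 0" "pmf (map_pmf (permute_list \<sigma>) ?R) ys = 0" by (simp_all only: pmf_eq_0_set_pmf not_False_eq_True)
    thus ?thesis by simp
  qed
qed

text \<open>Each fixed permutation preserves the law of a random word, hence so does a random
  one.\<close>

lemma bind_shuffled_replicate: "bind_pmf (replicate_pmf n p) shuffled = replicate_pmf n p"
proof -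
  have "bind_pmf (replicate_pmf n p) shuffled =
     bind_pmf (replicate_pmf n p) (\<lambda>xs. bind_pmf (pmf_of_set (perms n)) (\<lambda>\<sigma>. return_pmf (permute_list \<sigma> xs)))"
    by (rule bind_pmf_cong[OF refl]) (auto simp: shuffled_def map_pmf_def set_replicate_pmf)
  also have "\<dots> = bind_pmf (pmf_of_set (perms n)) (\<lambda>\<sigma>. map_pmf (permute_list \<sigma>) (replicate_pmf n p))"
    unfolding map_pmf_def by (rule bind_commute_pmf)
  also have "\<dots> = bind_pmf (pmf_of_set (perms n)) (\<lambda>\<sigma>. replicate_pmf n p)"
    by (rule bind_pmf_cong[OF refl]) (auto simp: finite_perms intro: map_permute_replicate)
  finally show ?thesis by simp
qed

section \<open>Hamming distance and alignment of words\<close>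

definition mismatches :: "'a list \<Rightarrow> 'a list \<Rightarrow> nat" where
  "mismatches xs ys = length (filter (\<lambda>(x, y). x \<noteq> y) (zip xs ys))"

lemma mismatches_commute: "mismatches xs ys = mismatches ys xs"
  unfolding mismatches_def by (subst zip_commute) (simp add: filter_map o_def case_prod_unfold eq_commute)

lemma mismatches_map_le: "mismatches (map f xs) (map f ys) \<le> mismatches xs ys"
proof -
  have "length (filter (\<lambda>w. f (fst w) \<noteq> f (snd w)) ws) \<le> length (filter (\<lambda>w. fst w \<noteq> snd w) ws)" for ws
    by (induction ws) auto
  thus ?thesis by (simp add: mismatches_def zip_map_map filter_map o_def case_prod_unfold)
qed

lemma mismatches_permute:
  assumes "\<sigma> permutes {..<length ys}" "length xs = length ys"
  shows "mismatches (permute_list \<sigma> xs) (permute_list \<sigma> ys) = mismatches xs ys"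
proof -
  have "mset (permute_list \<sigma> (zip xs ys)) = mset (zip xs ys)" using assms by (intro mset_permute_list) simp
  hence "size (filter_mset P (mset (permute_list \<sigma> (zip xs ys)))) = size (filter_mset P (mset (zip xs ys)))" for P by simp
  thus ?thesis unfolding mismatches_def using assms
    by (simp add: permute_list_zip[symmetric] size_mset[symmetric] mset_filter del: size_mset)
qed

text \<open>The common part \<open>c\<close> of the two multisets is put in front of both words.
  There are then at most as many mismatches as surplus letters of \<open>xs\<close>, and these are
  bounded by the differences of multiplicities.\<close>

lemma align_lists:
  assumes len: "length xs = length ys" and A: "finite A" "set xs \<subseteq> A"
  shows "\<exists>xs' ys'. mset xs' = mset xs \<and> mset ys' = mset ys \<and>
    real (mismatches xs' ys') \<le> (\<Sum>a\<in>A. \<bar>real (count (mset xs) a) - real (count (mset ys) a)\<bar>)"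
proof -
  let ?C = "mset xs \<inter># mset ys"
  obtain c a b where c: "mset c = ?C" and a: "mset a = mset xs - ?C" and b: "mset b = mset ys - ?C"
    using ex_mset by metis
  have ca: "mset (c @ a) = mset xs" "mset (c @ b) = mset ys" 
    unfolding mset_append c a b by (intro subset_mset.add_diff_inverse; simp)+
  have zz: "filter (\<lambda>(x, y). x \<noteq> y) (zip c c) = []" by (induction c) auto
  have "mismatches (c @ a) (c @ b) \<le> length a"
    unfolding mismatches_def by (simp add: zz) (metis length_filter_le length_zip min.cobounded1 order.trans)
  also have "length a = (\<Sum>x\<in>set_mset (mset xs - ?C). count (mset xs - ?C) x)"
    unfolding a[symmetric] size_multiset_overloaded_eq[symmetric] by simp
  also have "\<dots> = (\<Sum>x\<in>A. count (mset xs - ?C) x)"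
  proof (rule sum.mono_neutral_left[OF A(1)])
    show "set_mset (mset xs - ?C) \<subseteq> A"
    proof
      fix x assume "x \<in># mset xs - ?C"
      hence "x \<in># mset xs" by (rule in_diffD)
      thus "x \<in> A" using A(2) by auto
    qed
  qed (simp add: not_in_iff)
  finally have "real (mismatches (c @ a) (c @ b)) \<le> (\<Sum>x\<in>A. real (count (mset xs - ?C) x))"
    by (simp flip: of_nat_sum)
  also have "\<dots> \<le> (\<Sum>x\<in>A. \<bar>real (count (mset xs) x) - real (count (mset ys) x)\<bar>)"
    by (intro sum_mono) (auto simp: min_def)
  finally show ?thesis using ca by blast
qed

fun noisy_list :: "real \<Rightarrow> 'a set \<Rightarrow> 'a list \<Rightarrow> 'a list pmf" where
  "noisy_list e A [] = return_pmf []"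
| "noisy_list e A (x # xs) = map_pmf (\<lambda>(y, ys). y # ys) (pair_pmf (noisy e A x) (noisy_list e A xs))"

text \<open>The kernel treats the letters independently, so the costs add: \<open>2 e\<close> for
  every letter and \<open>ln (card A / e)\<close> for every mismatch.\<close>

lemma noisy_list_cost:
  fixes e :: real
  assumes e: "0 < e" "e \<le> 1/2" and A: "finite A"
  shows "length xs = length ys \<Longrightarrow> set ys \<subseteq> A \<Longrightarrow> 0 < pmf (noisy_list e A xs) ys \<and>
    - ln (pmf (noisy_list e A xs) ys) \<le> 2 * e * length xs + mismatches xs ys * ln (card A / e)"
proof (induction xs ys rule: list_induct2)
  case (Cons x xs y ys)
  have p: "pmf (noisy_list e A (x # xs)) (y # ys) = pmf (noisy e A x) y * pmf (noisy_list e A xs) ys"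
  proof -
    have "pmf (noisy_list e A (x # xs)) ((\<lambda>(y, ys). y # ys) (y, ys)) = pmf (pair_pmf (noisy e A x) (noisy_list e A xs)) (y, ys)"
      unfolding noisy_list.simps by (rule pmf_map_inj') (auto simp: inj_on_def)
    thus ?thesis by (simp add: pmf_pair)
  qed
  have y: "y \<in> A" and ys: "set ys \<subseteq> A" using Cons.prems by auto
  note IH = Cons.IH[OF ys]
  note n = pmf_noisy_pos[OF e A y, of x] noisy_cost[OF e A y, of x]
  have "- ln (pmf (noisy_list e A (x # xs)) (y # ys)) = - ln (pmf (noisy e A x) y) + - ln (pmf (noisy_list e A xs) ys)"
    unfolding p using n(1) IH by (simp add: ln_mult)
  also have "\<dots> \<le> (2 * e + (if x = y then 0 else ln (card A / e))) + (2 * e * length xs + mismatches xs ys * ln (card A / e))"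
    by (intro add_mono n(2) IH[THEN conjunct2])
  also have "\<dots> = 2 * e * length (x # xs) + mismatches (x # xs) (y # ys) * ln (card A / e)"
    by (simp add: mismatches_def algebra_simps)
  finally show ?case using n(1) IH unfolding p by auto
qed (auto simp: mismatches_def)


lemma set_replicate_sub: "w \<in> set_pmf (replicate_pmf n p) \<Longrightarrow> set w \<subseteq> set_pmf p"
  by (auto simp: set_replicate_pmf)

text \<open>The count of a letter is a sum of \<open>n\<close> independent indicators, so its mean
  deviation is at most \<open>sqrt n\<close>. Some word \<open>s\<close> has at most the average
  total deviation, and the triangle inequality through the mean counts doubles the bound.\<close>

lemma typical_word:
  assumes p: "finite (set_pmf p)" and n: "n > 0"
  shows "\<exists>s\<in>set_pmf (replicate_pmf n p).
    expect (replicate_pmf n p) (\<lambda>t. \<Sum>a\<in>set_pmf p. \<bar>real (count (mset t) a) - real (count (mset s) a)\<bar>)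
      \<le> 2 * real (card (set_pmf p)) * sqrt n"
proof -
  let ?A = "set_pmf p" and ?R = "replicate_pmf n p"
  have finR: "finite (set_pmf ?R)" by (rule finite_replicate_pmf[OF p])
  let ?g = "\<lambda>t. \<Sum>a\<in>?A. \<bar>real (count (mset t) a) - n * pmf p a\<bar>"
  have "expect ?R (\<lambda>t. \<bar>real (count (mset t) a) - n * pmf p a\<bar>) \<le> sqrt n" if a: "a \<in> ?A" for a
  proof -
    define \<phi> where "\<phi> x = (if x = a then 1 else 0) - pmf p a" for x
    have m: "expect p \<phi> = 0"
    proof -
      have "expect p (\<lambda>x. if x = a then 1 else 0) = pmf p a"
        unfolding expect_def using p a by (simp add: if_distrib[of "(*) _"] cong: if_cong)
      thus ?thesis unfolding \<phi>_def by (simp add: expect_diff expect_const[OF p])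
    qed
    have "expect p (\<lambda>x. (\<phi> x)\<^sup>2) \<le> expect p (\<lambda>x. 1)"
    proof (rule expect_mono)
      fix x
      have "\<bar>\<phi> x\<bar> \<le> 1" by (auto simp: \<phi>_def pmf_le_1)
      thus "(\<phi> x)\<^sup>2 \<le> 1" by (simp add: abs_square_le_1)
    qed
    hence v: "expect p (\<lambda>x. (\<phi> x)\<^sup>2) \<le> 1" by (simp add: expect_const[OF p])
    have s: "real (count (mset t) a) - length t * pmf p a = (\<Sum>x\<leftarrow>t. \<phi> x)" for t
      by (induction t) (auto simp: \<phi>_def algebra_simps)
    have "expect ?R (\<lambda>t. \<bar>real (count (mset t) a) - n * pmf p a\<bar>) = expect ?R (\<lambda>t. \<bar>\<Sum>x\<leftarrow>t. \<phi> x\<bar>)"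
      by (rule expect_cong) (auto simp: s[symmetric] set_replicate_pmf)
    also have "\<dots> \<le> sqrt n"
      by (rule expect_abs_le[OF finR]) (use n v mult_left_mono[OF v, of "real n"] in \<open>simp_all add: expect_replicate_square[OF p m]\<close>)
    finally show ?thesis .
  qed
  hence "expect ?R ?g \<le> (\<Sum>a\<in>?A. sqrt n)" unfolding expect_sum by (rule sum_mono)
  hence g: "expect ?R ?g \<le> card ?A * sqrt n" by simp
  from expect_exists_le[OF finR this] obtain s where s: "s \<in> set_pmf ?R" "?g s \<le> card ?A * sqrt n" by blast
  have "expect ?R (\<lambda>t. \<Sum>a\<in>?A. \<bar>real (count (mset t) a) - real (count (mset s) a)\<bar>) \<le> expect ?R (\<lambda>t. ?g t + ?g s)"
    by (rule expect_mono) (auto simp: sum.distrib[symmetric] intro!: sum_mono)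
  also have "\<dots> = expect ?R ?g + ?g s" by (simp only: expect_add expect_const[OF finR])
  also have "\<dots> \<le> 2 * real (card ?A) * sqrt n" using g s(2) by simp
  finally show ?thesis using s(1) by blast
qed


section \<open>Diagrams of words\<close>

text \<open>A law \<open>p\<close> of words over the initial space, reduced letter by letter. Words
  pass through \<open>list_encode\<close> because every space of a diagram lives on the
  naturals.\<close>

definition words :: "'i \<Rightarrow> 'i diagram \<Rightarrow> nat list pmf \<Rightarrow> 'i diagram" where
  "words z X p = \<lparr> sp = (\<lambda>i. map_pmf (\<lambda>xs. list_encode (map (red X z i) xs)) p),
     red = (\<lambda>i j. list_encode \<circ> map (red X i j) \<circ> list_decode) \<rparr>"

lemma words_simps [simp]:
  "sp (words z X p) i = map_pmf (\<lambda>xs. list_encode (map (red X z i) xs)) p"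
  "red (words z X p) i j w = list_encode (map (red X i j) (list_decode w))"
  by (simp_all add: words_def)

lemma diagram_mor_fst: "diagram_mor G (tensor X Y) X (\<lambda>_. fst \<circ> prod_decode)"
  by (auto simp: diagram_mor_def reduction_def tensor_def pmf.map_comp o_def map_fst_pair_pmf)

lemma diagram_mor_snd: "diagram_mor G (tensor X Y) Y (\<lambda>_. snd \<circ> prod_decode)"
  by (auto simp: diagram_mor_def reduction_def tensor_def pmf.map_comp o_def map_snd_pair_pmf)

lemma coupling_cost_0:
  assumes "finite (set_pmf p)"
    "\<And>i v w. v \<in> set_pmf p \<Longrightarrow> w \<in> set_pmf p \<Longrightarrow> i \<in> Field G \<Longrightarrow> F i v = F i w \<longleftrightarrow> F' i v = F' i w"
  shows "coupling_cost G p F F' = 0"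
  unfolding coupling_cost_def
proof (rule sum.neutral, rule ballI)
  fix i assume i: "i \<in> Field G"
  have "ent (map_pmf (\<lambda>w. (F i w, F' i w)) p) = ent (map_pmf (F i) p)"
    by (rule ent_cong[OF assms(1)]) (use assms(2)[OF _ _ i] in auto)
  moreover have "ent (map_pmf (\<lambda>w. (F i w, F' i w)) p) = ent (map_pmf (F' i) p)"
    by (rule ent_cong[OF assms(1)]) (use assms(2)[OF _ _ i] in auto)
  ultimately show "2 * ent (map_pmf (\<lambda>w. (F i w, F' i w)) p) - ent (map_pmf (F i) p) - ent (map_pmf (F' i) p) = 0" by simp
qed

context initial_index begin

lemma realizes_words:
  assumes X: "is_diagram G X" and p: "\<And>w. w \<in> set_pmf q \<Longrightarrow> set (f w) \<subseteq> set_pmf (sp X z)" "map_pmf f q = p"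
  shows "realizes G q (\<lambda>i w. list_encode (map (red X z i) (f w))) (words z X p)"
proof -
  have "map (red X i j \<circ> red X z i) (f w) = map (red X z j) (f w)" if ij: "(i, j) \<in> G" and w: "w \<in> set_pmf q" for i j w
  proof (rule map_cong[OF refl])
    fix x assume "x \<in> set (f w)"
    hence "x \<in> set_pmf (sp X z)" using p(1)[OF w] by auto
    moreover have "i \<in> Field G" using ij by (auto simp: Field_def)
    ultimately show "(red X i j \<circ> red X z i) x = red X z j x" using is_diagram_comp[OF X z_to ij] by simp
  qed
  thus ?thesis using p(2) by (auto simp: realizes_def pmf.map_comp o_def list_encode_eq)
qed

lemma is_diagram_words:
  assumes X: "is_diagram G X" and p: "finite (set_pmf p)" "\<And>w. w \<in> set_pmf p \<Longrightarrow> set w \<subseteq> set_pmf (sp X z)"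
  shows "is_diagram G (words z X p)"
proof -
  note r = realizes_words[OF X, of p id p, simplified, OF p(2)]
  have fld: "i \<in> Field G" "j \<in> Field G" if "(i, j) \<in> G" for i j using that by (auto simp: Field_def)
  have sub: "\<exists>w. a = list_encode w \<and> set w \<subseteq> set_pmf (sp X i)" if i: "i \<in> Field G" and a: "a \<in> set_pmf (sp (words z X p) i)" for i a
  proof -
    obtain w where w: "w \<in> set_pmf p" "a = list_encode (map (red X z i) w)" using a by auto
    have "set (map (red X z i) w) \<subseteq> set_pmf (sp X i)"
      using p(2)[OF w(1)] realizes_in[OF realizes_self[OF X] i] by auto
    thus ?thesis using w(2) by blast
  qed
  have "map_pmf (red (words z X p) i j) (sp (words z X p) i) = sp (words z X p) j" if ij: "(i, j) \<in> G" for i j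
    unfolding words_simps(1) pmf.map_comp
  proof (rule map_pmf_cong[OF refl])
    fix w assume "w \<in> set_pmf p"
    thus "(red (words z X p) i j \<circ> (\<lambda>xs. list_encode (map (red X z i) xs))) w = list_encode (map (red X z j) w)"
      using r ij unfolding realizes_def o_def by blast
  qed
  moreover have "red (words z X p) i i a = a" if i: "i \<in> Field G" and a: "a \<in> set_pmf (sp (words z X p) i)" for i a
  proof -
    obtain w where w: "a = list_encode w" "set w \<subseteq> set_pmf (sp X i)" using sub[OF i a] by blast
    have "map (red X i i) w = w" using w(2) is_diagram_id[OF X i] by (intro map_idI) auto
    thus ?thesis by (simp add: w(1))
  qed
  moreover have "red (words z X p) j k (red (words z X p) i j a) = red (words z X p) i k a"
    if ij: "(i, j) \<in> G" "(j, k) \<in> G" and a: "a \<in> set_pmf (sp (words z X p) i)" for i j k a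
  proof -
    obtain w where w: "a = list_encode w" "set w \<subseteq> set_pmf (sp X i)" using sub[OF fld(1)[OF ij(1)] a] by blast
    have "map (red X j k \<circ> red X i j) w = map (red X i k) w"
      using w(2) is_diagram_comp[OF X ij] by (intro map_cong) auto
    thus ?thesis by (simp add: w(1) list_encode_eq)
  qed
  moreover have "finite (set_pmf (sp (words z X p) i))" for i using p(1) by simp
  ultimately show ?thesis
    unfolding is_diagram_def reduction_def by (simp only:) auto
qed

text \<open>The \<open>n\<close>-fold tensor power, with words in place of nested pairs so that
  permutations of the positions act on it.\<close>

definition wpow :: "'i diagram \<Rightarrow> nat \<Rightarrow> 'i diagram" where
  "wpow X n = words z X (replicate_pmf n (sp X z))"

lemma finite_rep: "is_diagram G X \<Longrightarrow> finite (set_pmf (replicate_pmf n (sp X z)))"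
  by (intro finite_replicate_pmf is_diagram_finite[OF _ z_field])

lemma is_diagram_wpow: "is_diagram G X \<Longrightarrow> is_diagram G (wpow X n)"
  unfolding wpow_def by (intro is_diagram_words finite_rep set_replicate_sub)

text \<open>Concatenation: the length \<open>m\<close> of the first word is fixed, so the pair and
  the concatenation determine each other at every object.\<close>

lemma wpow_add:
  assumes X: "is_diagram G X"
  shows "entropy_dist G (tensor (wpow X m) (wpow X n)) (wpow X (m + n)) = 0"
proof (rule antisym)
  let ?p = "replicate_pmf m (sp X z)" and ?q = "replicate_pmf n (sp X z)"
  let ?w = "pair_pmf ?p ?q" let ?e = "\<lambda>i xs. list_encode (map (red X z i) xs)"
  have fin: "finite (set_pmf ?w)" using finite_rep[OF X] by simp
  have sub: "set v \<subseteq> set_pmf (sp X z)" "length v = m" "set w \<subseteq> set_pmf (sp X z)" if "(v, w) \<in> set_pmf ?w" for v w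
    using that by (auto simp: set_replicate_pmf)
  have 1: "realizes G ?w (\<lambda>i (v, w). prod_encode (?e i v, ?e i w)) (tensor (wpow X m) (wpow X n))"
    unfolding wpow_def by (intro realizes_tensor realizes_words[OF X, of _ "\<lambda>w. w"] set_replicate_sub) auto
  have 2: "realizes G ?w (\<lambda>i w. ?e i (fst w @ snd w)) (wpow X (m + n))"
    unfolding wpow_def
  proof (rule realizes_words[OF X])
    show "map_pmf (\<lambda>w. fst w @ snd w) ?w = replicate_pmf (m + n) (sp X z)"
      by (simp add: replicate_pmf_distrib pair_pmf_def map_bind_pmf)
  qed (use sub in force)
  have "entropy_dist G (tensor (wpow X m) (wpow X n)) (wpow X (m + n)) \<le>
     coupling_cost G ?w (\<lambda>i (v, w). prod_encode (?e i v, ?e i w)) (\<lambda>i w. ?e i (fst w @ snd w))"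
    by (rule entropy_dist_le_cost[OF fin transG 1 2]) (intro is_diagram_tensor is_diagram_wpow X)+
  also have "\<dots> = 0"
    by (rule coupling_cost_0[OF fin]) (auto simp: sub(2) list_encode_eq)
  finally show "entropy_dist G (tensor (wpow X m) (wpow X n)) (wpow X (m + n)) \<le> 0" .
qed (intro entropy_dist_nonneg is_diagram_tensor is_diagram_wpow X)

lemma wpow_1:
  assumes X: "is_diagram G X" shows "entropy_dist G X (wpow X 1) = 0"
proof (rule antisym)
  have fin: "finite (set_pmf (sp X z))" by (rule is_diagram_finite[OF X z_field])
  have r: "realizes G (sp X z) (\<lambda>i w. list_encode (map (red X z i) [w])) (wpow X 1)"
    unfolding wpow_def by (rule realizes_words[OF X]) (simp, simp only: replicate_pmf_1)
  have "entropy_dist G X (wpow X 1) \<le> coupling_cost G (sp X z) (red X z) (\<lambda>i w. list_encode (map (red X z i) [w]))"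
    by (rule entropy_dist_le_cost[OF fin transG realizes_self[OF X] r X is_diagram_wpow[OF X]])
  also have "\<dots> = 0"
    by (rule coupling_cost_0[OF fin]) (simp del: list_encode.simps add: list_encode_eq)
  finally show "entropy_dist G X (wpow X 1) \<le> 0" .
qed (intro entropy_dist_nonneg is_diagram_wpow X)

text \<open>One more letter costs at most its own entropy; this pays for the carry when indices are
  divided by \<open>N\<close>.\<close>

lemma wpow_Suc:
  assumes X: "is_diagram G X"
  shows "entropy_dist G (wpow X n) (wpow X (Suc n)) \<le> (\<Sum>i\<in>Field G. Ent (sp (wpow X 1) i))"
proof -
  note d = is_diagram_wpow[OF X]
  have "entropy_dist G (wpow X n) (wpow X (Suc n)) \<le> entropy_dist G (wpow X n) (tensor (wpow X 1) (wpow X n))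
     + entropy_dist G (tensor (wpow X 1) (wpow X n)) (wpow X (1 + n))"
    unfolding plus_1_eq_Suc by (intro entropy_dist_triangle d is_diagram_tensor)
  also have "\<dots> = entropy_dist G (tensor (wpow X 1) (wpow X n)) (wpow X n)"
    using wpow_add[OF X, of 1 n] by (simp add: entropy_dist_commute)
  also have "\<dots> \<le> (\<Sum>i\<in>Field G. Ent (sp (tensor (wpow X 1) (wpow X n)) i) - Ent (sp (wpow X n) i))"
    by (rule entropy_dist_le_mor[OF is_diagram_tensor[OF d d] diagram_mor_snd])
  also have "\<dots> = (\<Sum>i\<in>Field G. Ent (sp (wpow X 1) i))"
    by (rule sum.cong[OF refl]) (subst Ent_tensor, auto intro: is_diagram_finite[OF d])
  finally show ?thesis .
qed

text \<open>Permutations of the positions commute with letterwise reductions and act transitively on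
  the arrangements of \<open>s\<close>, hence on their images at every object.\<close>

lemma homogeneous_shuffled:
  "homogeneous G (words z X (shuffled s))"
  unfolding homogeneous_def
proof (intro ballI)
  let ?n = "length s" let ?H = "words z X (shuffled s)"
  let ?a = "\<lambda>\<tau> (i::'i). list_encode \<circ> permute_list \<tau> \<circ> list_decode"
  have at: "\<exists>\<sigma>. \<sigma> permutes {..<?n} \<and> a = list_encode (map (red X z i) (permute_list \<sigma> s))"
    if "a \<in> set_pmf (sp ?H i)" for a i using that by (auto simp: shuffled_def finite_perms)
  have mor: "diagram_mor G ?H ?H (?a \<tau>)" if \<tau>: "\<tau> permutes {..<?n}" for \<tau>
  proof -
    have pm: "permute_list \<tau> (map f (permute_list \<sigma> s)) = map f (permute_list \<tau> (permute_list \<sigma> s))" for f :: "nat \<Rightarrow> nat" and \<sigma>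
      using \<tau> by (simp add: permute_list_map)
    have sh: "map_pmf (permute_list \<tau>) (shuffled s) = shuffled s"
    proof -
      have "map_pmf (permute_list \<tau>) (shuffled s) = map_pmf (\<lambda>\<sigma>. permute_list (\<sigma> \<circ> \<tau>) s) (pmf_of_set (perms ?n))"
        unfolding shuffled_def pmf.map_comp o_def
        by (rule map_pmf_cong[OF refl]) (simp add: permute_list_compose[OF \<tau>, unfolded o_def])
      also have "\<dots> = map_pmf (\<lambda>\<sigma>. permute_list \<sigma> s) (map_pmf (\<lambda>\<sigma>. \<sigma> \<circ> \<tau>) (pmf_of_set (perms ?n)))"
        by (simp add: pmf.map_comp o_def)
      finally show ?thesis by (simp add: map_compose_perms(1)[OF \<tau>] shuffled_def)
    qed
    have "map_pmf (?a \<tau> i) (sp ?H i) = sp ?H i" for i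
    proof -
      have "map_pmf (?a \<tau> i) (sp ?H i) = map_pmf (\<lambda>xs. list_encode (map (red X z i) xs)) (map_pmf (permute_list \<tau>) (shuffled s))"
        unfolding words_simps pmf.map_comp
        by (rule map_pmf_cong[OF refl]) (auto simp: shuffled_def finite_perms pm)
      thus ?thesis by (simp add: sh)
    qed
    moreover have "?a \<tau> j (red ?H i j a) = red ?H i j (?a \<tau> i a)" if "a \<in> set_pmf (sp ?H i)" for i j a
      using at[OF that] \<tau> by (auto simp: permute_list_map)
    ultimately show ?thesis by (auto simp: diagram_mor_def reduction_def simp del: words_simps o_apply)
  qed
  fix i a b assume "a \<in> set_pmf (sp ?H i)" "b \<in> set_pmf (sp ?H i)"
  then obtain \<sigma> \<sigma>' where \<sigma>: "\<sigma> permutes {..<?n}" "a = list_encode (map (red X z i) (permute_list \<sigma> s))"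
    and \<sigma>': "\<sigma>' permutes {..<?n}" "b = list_encode (map (red X z i) (permute_list \<sigma>' s))" using at by metis
  \<comment> \<open>Lists are permuted from the right: applying \<open>\<tau>\<close> to the
    arrangement by \<open>\<sigma>\<close> gives that by \<open>\<sigma> \<circ> \<tau>\<close>,
    which has to be \<open>\<sigma>'\<close>.\<close>
  define \<tau> where "\<tau> = inv \<sigma> \<circ> \<sigma>'"
  have \<tau>: "\<tau> permutes {..<?n}" unfolding \<tau>_def by (rule permutes_compose[OF \<sigma>'(1) permutes_inv[OF \<sigma>(1)]])
  have "\<sigma> \<circ> \<tau> = \<sigma>'" unfolding \<tau>_def using permutes_inv_o(1)[OF \<sigma>(1)] by (simp add: o_assoc)
  hence "?a \<tau> i a = b" using \<sigma>(2) \<sigma>'(2) \<tau> by (simp add: permute_list_map flip: permute_list_compose)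
  moreover have "diagram_aut G ?H (?a \<tau>)"
    unfolding diagram_aut_def
  proof (intro conjI exI[of _ "?a (inv \<tau>)"] mor \<tau> permutes_inv ballI)
    fix i c assume "c \<in> set_pmf (sp ?H i)"
    from at[OF this] obtain \<sigma> where "c = list_encode (map (red X z i) (permute_list \<sigma> s))" by blast
    then obtain w where w: "length w = ?n" "c = list_encode w" by (metis length_map length_permute_list)
    show "?a (inv \<tau>) i (?a \<tau> i c) = c" "?a \<tau> i (?a (inv \<tau>) i c) = c"
      using w \<tau> permutes_inv[OF \<tau>] permutes_inv_o[OF \<tau>] by (simp_all flip: permute_list_compose)
  qed
  ultimately show "\<exists>f. diagram_aut G ?H f \<and> f i a = b" by blast
qed

end


section \<open>Homogeneous diagrams are dense\<close>

context initial_index begin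

text \<open>
  A random word and a random permutation of a fixed typical word are aligned by permuting both with the
  same permutation; they then differ in about \<open>sqrt n\<close> letters.
\<close>

lemma shuffled_close:
  assumes X: "is_diagram G X" and n: "n > 0" and A: "A = set_pmf (sp X z)"
  shows "\<exists>s. set s \<subseteq> A \<and> entropy_dist G (wpow X n) (words z X (shuffled s)) \<le>
    card (Field G) * (2 * (sqrt n + 2 * real (card A) * sqrt n * ln (2 * real (card A) * sqrt n)))"
proof -
  let ?p = "sp X z"
  let ?R = "replicate_pmf n ?p" and ?P = "pmf_of_set (perms n)"
  have finA: "finite A" using A is_diagram_finite[OF X z_field] by simp
  have neA: "A \<noteq> {}" using A by (simp add: set_pmf_not_empty)
  have cA: "card A \<ge> 1" using finA neA by (simp add: Suc_le_eq card_gt_0_iff)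
  obtain s where s: "s \<in> set_pmf ?R"
    "expect ?R (\<lambda>t. \<Sum>a\<in>A. \<bar>real (count (mset t) a) - real (count (mset s) a)\<bar>) \<le> 2 * real (card A) * sqrt n"
    using typical_word[OF is_diagram_finite[OF X z_field] n] unfolding A by blast
  have lenR: "length t = n" "set t \<subseteq> A" if "t \<in> set_pmf ?R" for t
    using that by (auto simp: set_replicate_pmf A)
  have "\<forall>t\<in>set_pmf ?R. \<exists>al. mset (fst al) = mset t \<and> mset (snd al) = mset s \<and>
    real (mismatches (fst al) (snd al)) \<le> (\<Sum>a\<in>A. \<bar>real (count (mset t) a) - real (count (mset s) a)\<bar>)"
  proof
    fix t assume t: "t \<in> set_pmf ?R"
    obtain t' s' where "mset t' = mset t" "mset s' = mset s"
      "real (mismatches t' s') \<le> (\<Sum>a\<in>A. \<bar>real (count (mset t) a) - real (count (mset s) a)\<bar>)"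
      using align_lists[of t s A] lenR[OF t] lenR[OF s(1)] finA by auto
    thus "\<exists>al. mset (fst al) = mset t \<and> mset (snd al) = mset s \<and>
      real (mismatches (fst al) (snd al)) \<le> (\<Sum>a\<in>A. \<bar>real (count (mset t) a) - real (count (mset s) a)\<bar>)"
      by (intro exI[of _ "(t', s')"]) auto
  qed
  from bchoice[OF this] obtain al where al: "\<And>t. t \<in> set_pmf ?R \<Longrightarrow> mset (fst (al t)) = mset t"
    "\<And>t. t \<in> set_pmf ?R \<Longrightarrow> mset (snd (al t)) = mset s"
    "\<And>t. t \<in> set_pmf ?R \<Longrightarrow> real (mismatches (fst (al t)) (snd (al t))) \<le>
      (\<Sum>a\<in>A. \<bar>real (count (mset t) a) - real (count (mset s) a)\<bar>)"
    by blast
  let ?W = "pair_pmf ?R ?P"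
  let ?f = "\<lambda>w. permute_list (snd w) (fst (al (fst w)))" and ?g = "\<lambda>w. permute_list (snd w) (snd (al (fst w)))"
  have finW: "finite (set_pmf ?W)" using finite_rep[OF X] finite_perms by simp
  have W: "fst w \<in> set_pmf ?R" "snd w permutes {..<n}" if "w \<in> set_pmf ?W" for w using that by auto
  have al_len: "length (fst (al t)) = n" "length (snd (al t)) = n" "set (fst (al t)) \<subseteq> A" "set (snd (al t)) \<subseteq> A"
    if t: "t \<in> set_pmf ?R" for t
    using mset_eq_length[OF al(1)[OF t]] mset_eq_length[OF al(2)[OF t]] mset_eq_setD[OF al(1)[OF t]] mset_eq_setD[OF al(2)[OF t]]
      lenR[OF t] lenR[OF s(1)] by auto
  have Wset: "set (?f w) \<subseteq> A" "set (?g w) \<subseteq> A" "length (?f w) = n" "length (?g w) = n" if w: "w \<in> set_pmf ?W" for w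
    using al_len[OF W(1)[OF w]] W(2)[OF w] by (auto simp: set_permute_list)
  have Wshuf: "map_pmf (\<lambda>w. permute_list (snd w) (h (fst w))) ?W = bind_pmf ?R (\<lambda>t. shuffled (h t))"
    if "\<And>t. t \<in> set_pmf ?R \<Longrightarrow> length (h t) = n" for h :: "_ \<Rightarrow> nat list"
    unfolding pair_pmf_def map_bind_pmf map_return_pmf
    by (rule bind_pmf_cong[OF refl]) (use that in \<open>simp add: shuffled_def map_pmf_def\<close>)
  \<comment> \<open>The alignment reorders \<open>t\<close> in a way that depends on
    \<open>t\<close>; the uniform permutation erases this, so the first word is again a random
    word.\<close>
  have mf: "map_pmf ?f ?W = ?R"
  proof -
    have "map_pmf ?f ?W = bind_pmf ?R (\<lambda>t. shuffled (fst (al t)))" by (rule Wshuf) (rule al_len)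
    also have "\<dots> = bind_pmf ?R shuffled" by (rule bind_pmf_cong[OF refl], rule shuffled_cong, rule al)
    finally show ?thesis by (simp add: bind_shuffled_replicate)
  qed
  \<comment> \<open>The second word always has the letters of \<open>s\<close>, so its law does not
    depend on \<open>t\<close>.\<close>
  have mg: "map_pmf ?g ?W = shuffled s"
  proof -
    have "map_pmf ?g ?W = bind_pmf ?R (\<lambda>t. shuffled (snd (al t)))" by (rule Wshuf) (rule al_len)
    also have "\<dots> = bind_pmf ?R (\<lambda>t. shuffled s)" by (rule bind_pmf_cong[OF refl], rule shuffled_cong, rule al)
    finally show ?thesis by simp
  qed
  let ?e = "\<lambda>i xs. list_encode (map (red X z i) xs)"
  have dH: "is_diagram G (words z X (shuffled s))"
  proof (rule is_diagram_words[OF X])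
    show "finite (set_pmf (shuffled s))" using finite_perms by (simp add: shuffled_def)
    show "set w \<subseteq> set_pmf ?p" if "w \<in> set_pmf (shuffled s)" for w
      using mset_eq_setD[OF set_shuffled[OF that]] lenR[OF s(1)] A by simp
  qed
  \<comment> \<open>The noise level at which correct letters cost \<open>2 e n = sqrt n\<close> in
    total, the order of the number of mismatches.\<close>
  define e where "e = 1 / (2 * sqrt n)"
  have sn: "sqrt n \<ge> 1" using n by simp
  have e: "0 < e" "e \<le> 1/2" using sn by (auto simp: e_def field_simps)
  define L where "L = ln (2 * real (card A) * sqrt n)"
  have "1 * 1 \<le> 2 * real (card A) * sqrt n" using cA sn by (intro mult_mono) auto
  hence L0: "L \<ge> 0" by (simp add: L_def)
  have mis: "expect ?W (\<lambda>w. real (mismatches (?f w) (?g w))) \<le> 2 * real (card A) * sqrt n"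
  proof -
    have "expect ?W (\<lambda>w. real (mismatches (?f w) (?g w))) \<le>
      expect ?W (\<lambda>w. \<Sum>a\<in>A. \<bar>real (count (mset (fst w)) a) - real (count (mset s) a)\<bar>)"
    proof (rule expect_mono)
      fix w assume w: "w \<in> set_pmf ?W"
      have "mismatches (?f w) (?g w) = mismatches (fst (al (fst w))) (snd (al (fst w)))"
        by (rule mismatches_permute) (use W[OF w] al_len[OF W(1)[OF w]] in auto)
      thus "real (mismatches (?f w) (?g w)) \<le> (\<Sum>a\<in>A. \<bar>real (count (mset (fst w)) a) - real (count (mset s) a)\<bar>)"
        using al(3)[OF W(1)[OF w]] by simp
    qed
    also have "\<dots> = expect (map_pmf fst ?W) (\<lambda>t. \<Sum>a\<in>A. \<bar>real (count (mset t) a) - real (count (mset s) a)\<bar>)"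
      by (rule expect_map[OF finW, symmetric])
    also have "\<dots> \<le> 2 * real (card A) * sqrt n" using s(2) by (simp only: map_fst_pair_pmf)
    finally show ?thesis .
  qed
  \<comment> \<open>One bound for both conditional entropies; the roles of \<open>f\<close> and
    \<open>g\<close> are exchanged between its two uses.\<close>
  have half: "ent (map_pmf (\<lambda>w. (?e i (f w), ?e i (g w))) ?W) \<le> ent (map_pmf (\<lambda>w. ?e i (f w)) ?W) + (sqrt n + 2 * real (card A) * sqrt n * L)"
    if f: "\<And>w. w \<in> set_pmf ?W \<Longrightarrow> length (f w) = n" and g: "\<And>w. w \<in> set_pmf ?W \<Longrightarrow> length (g w) = n \<and> set (g w) \<subseteq> A"
      and m: "expect ?W (\<lambda>w. real (mismatches (f w) (g w))) \<le> 2 * real (card A) * sqrt n" for f g i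
  proof -
    let ?r = "map (red X z i)" and ?B = "red X z i ` A"
    have B: "finite ?B" "card ?B \<le> card A" "card ?B > 0" using finA neA by (auto simp: card_image_le card_gt_0_iff)
    have lnB: "ln (card ?B / e) \<le> L" unfolding L_def using B sn
      by (intro ln_mono) (auto simp: e_def mult.commute mult.left_commute intro!: mult_right_mono)
    have c: "0 < pmf (noisy_list e ?B (?r (f w))) (?r (g w)) \<and>
      - ln (pmf (noisy_list e ?B (?r (f w))) (?r (g w))) \<le> 2 * e * n + mismatches (?r (f w)) (?r (g w)) * ln (card ?B / e)"
      if w: "w \<in> set_pmf ?W" for w
      using noisy_list_cost[OF e B(1), of "?r (f w)" "?r (g w)"] f[OF w] g[OF w] by auto
    have "ent (map_pmf (\<lambda>w. (?r (f w), ?r (g w))) ?W) \<le> ent (map_pmf (\<lambda>w. ?r (f w)) ?W) +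
      expect ?W (\<lambda>w. - ln (pmf (noisy_list e ?B (?r (f w))) (?r (g w))))"
      by (rule ent_pair_le_kernel[OF finW]) (use c in blast)
    also have "expect ?W (\<lambda>w. - ln (pmf (noisy_list e ?B (?r (f w))) (?r (g w)))) \<le> expect ?W (\<lambda>w. 2 * e * n + L * real (mismatches (f w) (g w)))"
    proof (rule expect_mono)
      fix w assume w: "w \<in> set_pmf ?W"
      have "mismatches (?r (f w)) (?r (g w)) * ln (card ?B / e) \<le> mismatches (f w) (g w) * L"
      proof -
        have "mismatches (?r (f w)) (?r (g w)) * ln (card ?B / e) \<le> mismatches (?r (f w)) (?r (g w)) * L"
          by (intro mult_left_mono lnB) auto
        also have "\<dots> \<le> mismatches (f w) (g w) * L"
          by (intro mult_right_mono L0) (simp add: mismatches_map_le)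
        finally show ?thesis .
      qed
      thus "- ln (pmf (noisy_list e ?B (?r (f w))) (?r (g w))) \<le> 2 * e * n + L * real (mismatches (f w) (g w))"
        using c[OF w] by (simp add: mult.commute)
    qed
    also have "\<dots> = 2 * e * n + L * expect ?W (\<lambda>w. real (mismatches (f w) (g w)))"
      by (simp only: expect_add expect_cmult expect_const[OF finW])
    also have "\<dots> \<le> 2 * e * n + L * (2 * real (card A) * sqrt n)" by (intro add_left_mono mult_left_mono m L0)
    also have "2 * e * n = sqrt n" using n by (simp add: e_def real_div_sqrt)
    finally have "ent (map_pmf (\<lambda>w. (?r (f w), ?r (g w))) ?W) \<le> ent (map_pmf (\<lambda>w. ?r (f w)) ?W) + (sqrt n + 2 * real (card A) * sqrt n * L)"
      by (simp add: mult.commute)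
    moreover have "ent (map_pmf (\<lambda>w. (?e i (f w), ?e i (g w))) ?W) = ent (map_pmf (\<lambda>w. (?r (f w), ?r (g w))) ?W)"
      by (rule ent_cong[OF finW]) (auto simp: list_encode_eq)
    moreover have "ent (map_pmf (\<lambda>w. ?e i (f w)) ?W) = ent (map_pmf (\<lambda>w. ?r (f w)) ?W)"
      by (rule ent_cong[OF finW]) (auto simp: list_encode_eq)
    ultimately show ?thesis by simp
  qed
  have "entropy_dist G (wpow X n) (words z X (shuffled s)) \<le> coupling_cost G ?W (\<lambda>i w. ?e i (?f w)) (\<lambda>i w. ?e i (?g w))"
    unfolding wpow_def
    by (rule entropy_dist_le_cost[OF finW transG realizes_words[OF X _ mf] realizes_words[OF X _ mg]])
      (use Wset A is_diagram_wpow[OF X, unfolded wpow_def] dH in auto)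
  also have "\<dots> \<le> (\<Sum>i\<in>Field G. 2 * (sqrt n + 2 * real (card A) * sqrt n * L))"
    unfolding coupling_cost_def
  proof (intro sum_mono cost_le_conditional[OF finW])
    fix i
    show "ent (map_pmf (\<lambda>w. (?e i (?f w), ?e i (?g w))) ?W) \<le> ent (map_pmf (\<lambda>w. ?e i (?f w)) ?W) + (sqrt n + 2 * real (card A) * sqrt n * L)"
      by (rule half) (use Wset mis in auto)
    show "ent (map_pmf (\<lambda>w. (?e i (?g w), ?e i (?f w))) ?W) \<le> ent (map_pmf (\<lambda>w. ?e i (?g w)) ?W) + (sqrt n + 2 * real (card A) * sqrt n * L)"
      by (rule half) (use Wset mis in \<open>auto simp: mismatches_commute\<close>)
  qed
  finally have "entropy_dist G (wpow X n) (words z X (shuffled s)) \<le>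
    card (Field G) * (2 * (sqrt n + 2 * real (card A) * sqrt n * L))" by simp
  thus ?thesis using lenR[OF s(1)] unfolding L_def by blast
qed

text \<open>The logarithm is bounded by a multiple of \<open>n powr (1/4)\<close>, which turns
  \<open>sqrt n * ln n\<close> into the admissible order \<open>n powr (3/4)\<close>.\<close>

lemma homogeneous_approximation:
  assumes X: "is_diagram G X"
  shows "\<exists>D\<ge>0. \<forall>n. \<exists>H. is_diagram G H \<and> homogeneous G H \<and> entropy_dist G (wpow X n) H \<le> D * real n powr (3/4)"
proof -
  define A where "A = set_pmf (sp X z)"
  have finA: "finite A" using A_def is_diagram_finite[OF X z_field] by simp
  have "A \<noteq> {}" using A_def by (simp add: set_pmf_not_empty)
  hence cA: "real (card A) \<ge> 1" using finA by (simp add: Suc_le_eq card_gt_0_iff)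
  let ?a = "real (card A)"
  define D where "D = card (Field G) * (2 * (1 + 2 * ?a * (2 * (2 * ?a) powr (1/2))))"
  have dia: "is_diagram G (words z X (shuffled s))" if "set s \<subseteq> A" for s
  proof (rule is_diagram_words[OF X])
    show "finite (set_pmf (shuffled s))" using finite_perms by (simp add: shuffled_def)
    show "set w \<subseteq> set_pmf (sp X z)" if "w \<in> set_pmf (shuffled s)" for w
      using mset_eq_setD[OF set_shuffled[OF that]] \<open>set s \<subseteq> A\<close> A_def by simp
  qed
  have "\<exists>H. is_diagram G H \<and> homogeneous G H \<and> entropy_dist G (wpow X n) H \<le> D * real n powr (3/4)" for n
  proof (cases "n = 0")
    case True
    \<comment> \<open>At \<open>n = 0\<close> the error must vanish; both diagrams are then those of
      the empty word.\<close>
    have "shuffled ([] :: nat list) = replicate_pmf 0 (sp X z)"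
      by (simp add: shuffled_def map_pmf_const)
    hence "words z X (shuffled []) = wpow X n" using True by (simp add: wpow_def)
    thus ?thesis
      using homogeneous_shuffled[of X "[]"] dia[of "[]"] entropy_dist_self[OF dia[of "[]"]] True by auto
  next
    case False
    hence n: "n > 0" by simp
    obtain s where s: "set s \<subseteq> A" "entropy_dist G (wpow X n) (words z X (shuffled s)) \<le>
      card (Field G) * (2 * (sqrt n + 2 * real (card A) * sqrt n * ln (2 * real (card A) * sqrt n)))"
      using shuffled_close[OF X n A_def] by blast
    have r1: "real n \<ge> 1" using n by simp
    have sq: "sqrt n = real n powr (1/2)" by (simp add: powr_half_sqrt)
    have sq2: "sqrt n \<le> real n powr (3/4)" unfolding sq using r1 by (intro powr_mono) auto
    have one: "1 * 1 \<le> 2 * ?a * sqrt n" using cA n by (intro mult_mono) auto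
    have "ln (2 * ?a * sqrt n) \<le> (2 * ?a * sqrt n) powr (1/2) / (1/2)"
      using one by (intro ln_powr_bound) auto
    also have "\<dots> = 2 * (2 * ?a) powr (1/2) * real n powr (1/4)"
      unfolding sq by (simp add: powr_mult powr_powr)
    finally have ln: "ln (2 * ?a * sqrt n) \<le> 2 * (2 * ?a) powr (1/2) * real n powr (1/4)" .
    have "2 * ?a * sqrt n * ln (2 * ?a * sqrt n) \<le> 2 * ?a * sqrt n * (2 * (2 * ?a) powr (1/2) * real n powr (1/4))"
      by (intro mult_left_mono ln) auto
    also have "\<dots> = 2 * ?a * (2 * (2 * ?a) powr (1/2)) * (real n powr (1/2) * real n powr (1/4))"
      unfolding sq by (simp add: algebra_simps)
    also have "real n powr (1/2) * real n powr (1/4) = real n powr (3/4)" by (simp add: powr_add[symmetric])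
    finally have t: "2 * ?a * sqrt n * ln (2 * ?a * sqrt n) \<le> 2 * ?a * (2 * (2 * ?a) powr (1/2)) * real n powr (3/4)" .
    have "card (Field G) * (2 * (sqrt n + 2 * ?a * sqrt n * ln (2 * ?a * sqrt n))) \<le>
      card (Field G) * (2 * (real n powr (3/4) + 2 * ?a * (2 * (2 * ?a) powr (1/2)) * real n powr (3/4)))"
      by (intro mult_left_mono add_mono sq2 t) auto
    also have "\<dots> = D * real n powr (3/4)" by (simp add: D_def algebra_simps)
    finally show ?thesis using s homogeneous_shuffled[of X s] dia[OF s(1)] by (meson order.trans)
  qed
  moreover have "D \<ge> 0" unfolding D_def by simp
  ultimately show ?thesis by blast
qed

text \<open>As a function of \<open>q\<close> the distance is almost subadditive with constant
  \<open>C * N powr (3/4)\<close>, because word powers add up exactly, and it starts from 0 at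
  \<open>q = 1\<close>.\<close>

lemma wpow_approximates:
  assumes X: "quasi_linear G X"
  shows "\<exists>C\<ge>0. \<forall>N q. q \<ge> 1 \<longrightarrow> entropy_dist G (X (q * N)) (wpow (X N) q) \<le> q * (10 * C * real N powr (3/4))"
proof -
  obtain C where C: "C > 0" "\<forall>m n. entropy_dist G (tensor (X m) (X n)) (X (m + n)) \<le> C * real (m + n) powr (3/4)"
    using quasi_linearD[OF X] by blast
  note d = quasi_linear_diagram[OF X]
  have "entropy_dist G (X (q * N)) (wpow (X N) q) \<le> q * (10 * C * real N powr (3/4))" if q: "q \<ge> 1" for N q
  proof -
    note w = is_diagram_wpow[OF d[of N]]
    have "entropy_dist G (X (q * N)) (wpow (X N) q) \<le> q * entropy_dist G (X (1 * N)) (wpow (X N) 1)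
       + 10 * (C * real N powr (3/4)) * (q - q powr (3/4))"
    proof (rule almost_subadditive_multiple[where a="\<lambda>q. entropy_dist G (X (q * N)) (wpow (X N) q)", OF _ _ q])
      fix m n
      have "entropy_dist G (X ((m + n) * N)) (wpow (X N) (m + n)) \<le>
        entropy_dist G (X ((m + n) * N)) (tensor (X (m * N)) (X (n * N))) +
        (entropy_dist G (tensor (X (m * N)) (X (n * N))) (tensor (wpow (X N) m) (wpow (X N) n)) +
         entropy_dist G (tensor (wpow (X N) m) (wpow (X N) n)) (wpow (X N) (m + n)))"
        by (intro order.trans[OF entropy_dist_triangle[of _ "tensor (X (m * N)) (X (n * N))"]] add_left_mono
            entropy_dist_triangle d w is_diagram_tensor)
      also have "\<dots> \<le> C * real (m * N + n * N) powr (3/4) +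
         ((entropy_dist G (X (m * N)) (wpow (X N) m) + entropy_dist G (X (n * N)) (wpow (X N) n)) + 0)"
        unfolding wpow_add[OF d] distrib_right
        by (intro add_mono entropy_dist_tensor d w order.refl, subst entropy_dist_commute, rule C(2)[rule_format])
      also have "real (m * N + n * N) powr (3/4) = real N powr (3/4) * real (m + n) powr (3/4)"
        by (subst powr_mult[symmetric]) (auto simp: algebra_simps)
      finally show "entropy_dist G (X ((m + n) * N)) (wpow (X N) (m + n)) \<le> entropy_dist G (X (m * N)) (wpow (X N) m)
        + entropy_dist G (X (n * N)) (wpow (X N) n) + C * real N powr (3/4) * real (m + n) powr (3/4)"
        by (simp add: mult.assoc)
    qed (use C in auto)
    also have "entropy_dist G (X (1 * N)) (wpow (X N) 1) = 0" using wpow_1[OF d[of N]] by simp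
    also have "real q * 0 + 10 * (C * real N powr (3/4)) * (q - q powr (3/4)) \<le> q * (10 * C * real N powr (3/4))"
      using C(1) by (simp add: algebra_simps)
    finally show ?thesis .
  qed
  with C(1) show ?thesis by (intro exI[of _ C]) auto
qed

text \<open>\<open>(m + n) div N\<close> exceeds the sum of the quotients by at most one, which
  costs one more letter.\<close>

lemma quasi_linear_wpow:
  assumes X: "is_diagram G X" and N: "N > 0"
  shows "quasi_linear G (\<lambda>n. wpow X (n div N))"
proof -
  note d = is_diagram_wpow[OF X]
  define E where "E = (\<Sum>i\<in>Field G. Ent (sp (wpow X 1) i))"
  have E: "E \<ge> 0" unfolding E_def by (intro sum_nonneg) (simp add: Ent_eq_ent ent_nonneg)
  have "entropy_dist G (tensor (wpow X (m div N)) (wpow X (n div N))) (wpow X ((m + n) div N)) \<le> (E + 1) * real (m + n) powr (3/4)" for m n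
  proof -
    have "entropy_dist G (tensor (wpow X (m div N)) (wpow X (n div N))) (wpow X ((m + n) div N)) \<le>
       0 + entropy_dist G (wpow X (m div N + n div N)) (wpow X ((m + n) div N))"
      using entropy_dist_triangle[OF is_diagram_tensor[OF d d] d d] wpow_add[OF X] by metis
    also have "\<dots> \<le> (E + 1) * real (m + n) powr (3/4)"
    proof (cases "(m + n) div N = m div N + n div N")
      case True
      thus ?thesis using E by (simp add: entropy_dist_self[OF d])
    next
      case False
      hence "(m mod N + n mod N) div N \<noteq> 0" by (simp add: div_add1_eq[of m n N])
      moreover have "(m mod N + n mod N) div N < 2"
        using mod_less_divisor[OF N, of m] mod_less_divisor[OF N, of n] by (intro less_mult_imp_div_less) linarith
      ultimately have "(m + n) div N = Suc (m div N + n div N)" by (simp add: div_add1_eq[of m n N])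
      hence "entropy_dist G (wpow X (m div N + n div N)) (wpow X ((m + n) div N)) \<le> E"
        using wpow_Suc[OF X] unfolding E_def by simp
      moreover have "m + n \<noteq> 0" using False by auto
      hence "real (m + n) \<ge> 1" by linarith
      hence "real (m + n) powr (3/4) \<ge> 1" by (rule ge_one_powr_ge_zero) simp
      hence "(E + 1) * 1 \<le> (E + 1) * real (m + n) powr (3/4)" using E by (intro mult_left_mono) auto
      ultimately show ?thesis by simp
    qed
    finally show ?thesis .
  qed
  thus ?thesis unfolding quasi_linear_def using d E by (intro conjI allI exI[of _ "E + 1"]) auto
qed

text \<open>The sequence is replaced by powers of one diagram \<open>X N\<close>, at asymptotic
  distance at most \<open>10 * C * N powr (-1/4)\<close>, and these by homogeneous diagrams with an
  error of order \<open>n powr (3/4)\<close>, which vanishes asymptotically.\<close>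

lemma homogeneous_dense:
  assumes T: "T \<in> tropical G" and e: "e > 0"
  shows "\<exists>H\<in>tropical_homogeneous G. trop_dist G H T < e"
proof -
  obtain X where XT: "X \<in> T" using tropical_nonempty[OF T] by blast
  have X: "quasi_linear G X" by (rule tropical_quasi_linear[OF T XT])
  note d = quasi_linear_diagram[OF X]
  obtain C where C: "C \<ge> 0" "\<And>N q. q \<ge> 1 \<Longrightarrow> entropy_dist G (X (q * N)) (wpow (X N) q) \<le> q * (10 * C * real N powr (3/4))"
    using wpow_approximates[OF X] by blast
  have "(\<lambda>N. 10 * C * real N powr (-1/4)) \<longlonglongrightarrow> 0"
    by (rule tendsto_mult_right_zero, rule tendsto_neg_powr, simp, rule filterlim_real_sequentially)
  from LIMSEQ_D[OF this e] obtain N0 where N0: "\<And>N. N \<ge> N0 \<Longrightarrow> \<bar>10 * C * real N powr (-1/4)\<bar> < e" by auto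
  define N where "N = Suc N0"
  have N: "N > 0" "10 * C * real N powr (-1/4) < e" using N0[of N] unfolding N_def by simp_all
  let ?W = "\<lambda>n. wpow (X N) (n div N)"
  have W: "quasi_linear G ?W" by (rule quasi_linear_wpow[OF d N(1)])
  obtain D where D: "D \<ge> 0" "\<And>n. \<exists>H. is_diagram G H \<and> homogeneous G H \<and> entropy_dist G (wpow (X N) n) H \<le> D * real n powr (3/4)"
    using homogeneous_approximation[OF d] by blast
  then obtain H where H: "\<And>n. is_diagram G (H n)" "\<And>n. homogeneous G (H n)"
    "\<And>n. entropy_dist G (wpow (X N) n) (H n) \<le> D * real n powr (3/4)" by metis
  let ?H = "\<lambda>n. H (n div N)"
  have WH: "entropy_dist G (?W n) (?H n) \<le> D * real n powr (3/4)" for n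
    by (rule order.trans[OF H(3)]) (intro mult_left_mono D powr_three_quarters_mono div_le_dividend)
  have qH: "quasi_linear G ?H" by (rule quasi_linear_close[OF W H(1) WH D(1)])
  have "asym_entropy_dist G ?W ?H \<le> 0"
  proof (rule asym_entropy_dist_le[OF W qH WH])
    have l: "(\<lambda>n. D * real n powr (-1/4)) \<longlonglongrightarrow> 0"
      by (rule tendsto_mult_right_zero, rule tendsto_neg_powr, simp, rule filterlim_real_sequentially)
    have "D * real n powr (3/4) / real n = D * real n powr (-1/4)" for n
      using powr_add[of "real n" "-1/4" 1] by (cases "n = 0") auto
    thus "(\<lambda>n. D * real n powr (3/4) / real n) \<longlonglongrightarrow> 0" using l by simp
  qed
  moreover have "asym_entropy_dist G X ?W \<le> 10 * C * real N powr (-1/4)"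
  proof (rule LIMSEQ_le_const2)
    \<comment> \<open>The limit is read off along the multiples of \<open>N\<close>, where the power
      is compared with \<open>X (q * N)\<close>.\<close>
    have "strict_mono (\<lambda>q. q * N)" using N by (simp add: strict_mono_def)
    from LIMSEQ_subseq_LIMSEQ[OF asym_entropy_dist_lim[OF X W] this]
    show "(\<lambda>q. entropy_dist G (X (q * N)) (?W (q * N)) / real (q * N)) \<longlonglongrightarrow> asym_entropy_dist G X ?W"
      by (simp add: o_def)
    show "\<exists>M. \<forall>q\<ge>M. entropy_dist G (X (q * N)) (?W (q * N)) / real (q * N) \<le> 10 * C * real N powr (-1/4)"
    proof (intro exI[of _ 1] allI impI)
      fix q :: nat assume q: "q \<ge> 1"
      have "real N powr (3/4) = real N powr (-1/4) * real N" using powr_add[of "real N" "-1/4" 1] by simp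
      thus "entropy_dist G (X (q * N)) (?W (q * N)) / real (q * N) \<le> 10 * C * real N powr (-1/4)"
        using C(2)[OF q, of N] N q by (simp add: pos_divide_le_eq mult.commute mult.left_commute)
    qed
  qed
  ultimately have less: "asym_entropy_dist G X ?H < e"
    using asym_entropy_dist_triangle[OF X W qH] N(2) by linarith
  have "\<exists>Y\<in>cls ?H. \<forall>n. homogeneous G (Y n)"
    by (rule bexI[OF _ cls_self[OF qH]]) (rule allI, rule H(2))
  hence "cls ?H \<in> tropical_homogeneous G"
    unfolding tropical_homogeneous_def using cls_tropical[OF qH] by (intro CollectI conjI)
  moreover have "trop_dist G (cls ?H) T < e"
    unfolding trop_dist_eq[OF cls_tropical[OF qH] cls_self[OF qH] T XT]
    by (subst asym_entropy_dist_commute) (rule less)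
  ultimately show ?thesis by blast
qed

end


section \<open>Adding independent noise to the ancestors of an object\<close>

text \<open>Noise with \<open>M\<close> equally likely values sits at the ancestors of
  \<open>u\<close>, passed on by identity maps, and is forgotten elsewhere. This is functorial
  because an ancestor of an ancestor of \<open>u\<close> is an ancestor of \<open>u\<close>.\<close>

definition noise :: "'i rel \<Rightarrow> 'i \<Rightarrow> nat \<Rightarrow> 'i diagram" where
  "noise G u M = \<lparr> sp = (\<lambda>i. if (i, u) \<in> G then pmf_of_set {..<M} else return_pmf 0),
     red = (\<lambda>i j. if (j, u) \<in> G then id else (\<lambda>_. 0)) \<rparr>"

lemma noise_simps:
  "sp (noise G u M) i = (if (i, u) \<in> G then pmf_of_set {..<M} else return_pmf 0)"
  "red (noise G u M) i j = (if (j, u) \<in> G then id else (\<lambda>_. 0))"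
  by (simp_all add: noise_def)

lemma set_noise: "M > 0 \<Longrightarrow> set_pmf (sp (noise G u M) i) = (if (i, u) \<in> G then {..<M} else {0})"
  by (simp add: noise_simps set_pmf_of_set lessThan_empty_iff)

lemma Ent_noise: "M > 0 \<Longrightarrow> Ent (sp (noise G u M) i) = (if (i, u) \<in> G then ln M else 0)"
  using ent_pmf_of_set[of "{..<M}"] by (auto simp: noise_simps Ent_eq_ent)

lemma pair_pmf_of_set:
  assumes "finite A" "A \<noteq> {}" "finite B" "B \<noteq> {}"
  shows "pair_pmf (pmf_of_set A) (pmf_of_set B) = pmf_of_set (A \<times> B)"
proof (rule pmf_eqI)
  fix w :: "'a \<times> 'b"
  show "pmf (pair_pmf (pmf_of_set A) (pmf_of_set B)) w = pmf (pmf_of_set (A \<times> B)) w"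
    using assms by (cases w) (simp add: pmf_pair indicator_def)
qed

lemma bij_betw_div_mod:
  assumes "N > 0" shows "bij_betw (\<lambda>c. (c div N, c mod N)) {..<M * N} ({..<M} \<times> {..<N :: nat})"
proof (rule bij_betw_byWitness[where f' = "\<lambda>(a, b). a * N + b"])
  show "(\<lambda>(a, b). a * N + b) ` ({..<M} \<times> {..<N}) \<subseteq> {..<M * N}"
  proof clarsimp
    fix a b assume "a < M" "b < N"
    hence "a * N + b < Suc a * N" by simp
    also have "\<dots> \<le> M * N" using \<open>a < M\<close> by (intro mult_le_mono1) simp
    finally show "a * N + b < M * N" .
  qed
qed (use assms in \<open>auto simp: less_mult_imp_div_less\<close>)

text \<open>One direction tests minimality on the image of \<open>Z\<close> in the product of
  \<open>X\<close> and \<open>U\<close>. For the other, a map \<open>h\<close> through which an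
  injective map factors is itself injective, hence an isomorphism onto its image law.\<close>

lemma minimal_fan_iff_inj:
  assumes fin: "finite (set_pmf Z)" and f: "reduction Z X f" and g: "reduction Z U g"
  shows "minimal_fan Z X U f g \<longleftrightarrow> inj_on (\<lambda>a. (f a, g a)) (set_pmf Z)"
proof
  assume m: "minimal_fan Z X U f g"
  let ?h = "\<lambda>a. prod_encode (f a, g a)"
  have "reduction (map_pmf ?h Z) X (\<lambda>b. fst (prod_decode b))" "reduction (map_pmf ?h Z) U (\<lambda>b. snd (prod_decode b))"
    using f g by (simp_all add: reduction_def pmf.map_comp o_def)
  hence "iso_reduction Z (map_pmf ?h Z) ?h"
    using m[unfolded minimal_fan_def, THEN conjunct2, THEN conjunct2, rule_format,
      of "map_pmf ?h Z" "\<lambda>b. fst (prod_decode b)" "\<lambda>b. snd (prod_decode b)" ?h] fin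
    by (simp add: reduction_def)
  then obtain k where "\<forall>a\<in>set_pmf Z. k (?h a) = a" by (auto simp: iso_reduction_def)
  hence "inj_on ?h (set_pmf Z)" by (intro inj_on_inverseI) auto
  thus "inj_on (\<lambda>a. (f a, g a)) (set_pmf Z)" by (auto simp: inj_on_def)
next
  assume inj: "inj_on (\<lambda>a. (f a, g a)) (set_pmf Z)"
  have "iso_reduction Z W h" if h: "reduction Z W h" and pq: "\<forall>a\<in>set_pmf Z. p (h a) = f a \<and> q (h a) = g a" for W p q h
  proof -
    have "inj_on h (set_pmf Z)"
    proof (rule inj_onI)
      fix a b assume "a \<in> set_pmf Z" "b \<in> set_pmf Z" "h a = h b"
      thus "a = b" using pq inj_onD[OF inj, of a b] by metis
    qed
    hence k: "\<forall>a\<in>set_pmf Z. inv_into (set_pmf Z) h (h a) = a" by simp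
    have W: "map_pmf h Z = W" using h by (simp add: reduction_def)
    have "map_pmf (inv_into (set_pmf Z) h) W = map_pmf id Z"
      unfolding W[symmetric] pmf.map_comp by (rule map_pmf_cong[OF refl]) (use k in simp)
    moreover have "\<forall>b\<in>set_pmf W. h (inv_into (set_pmf Z) h b) = b"
      unfolding W[symmetric] by (auto simp: k)
    ultimately show ?thesis using h k
      unfolding iso_reduction_def by (intro conjI exI[of _ "inv_into (set_pmf Z) h"]) (auto simp: reduction_def)
  qed
  thus "minimal_fan Z X U f g" using f g by (auto simp: minimal_fan_def)
qed

context initial_index begin

lemma is_diagram_noise:
  assumes M: "M > 0" shows "is_diagram G (noise G u M)"
proof -
  have tr: "(i, u) \<in> G" if "(i, j) \<in> G" "(j, u) \<in> G" for i j using that transG by (auto dest: transD)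
  have "map_pmf (red (noise G u M) i j) (sp (noise G u M) i) = sp (noise G u M) j" if "(i, j) \<in> G" for i j
    using tr[OF that] by (auto simp: noise_simps map_pmf_const)
  moreover have "red (noise G u M) j k (red (noise G u M) i j a) = red (noise G u M) i k a" if "(i, j) \<in> G" "(j, k) \<in> G" for i j k a
    using tr[OF that(2)] by (auto simp: noise_simps)
  moreover have "red (noise G u M) i i a = a" if "a \<in> set_pmf (sp (noise G u M) i)" for i a
    using that M by (auto simp: noise_simps)
  moreover have "finite (set_pmf (sp (noise G u M) i))" for i using set_noise[OF M, of G u i] by simp
  ultimately show ?thesis unfolding is_diagram_def reduction_def by (simp only:) auto
qed

text \<open>The same transposition acts at all ancestors of \<open>u\<close>, between which the
  reductions are identities.\<close>

lemma homogeneous_noise: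
  assumes M: "M > 0" shows "homogeneous G (noise G u M)"
  unfolding homogeneous_def
proof (intro ballI)
  fix i a b assume ab: "a \<in> set_pmf (sp (noise G u M) i)" "b \<in> set_pmf (sp (noise G u M) i)"
  define f where "f j = (if (j, u) \<in> G then Transposition.transpose a b else id)" for j
  have tr: "(i, u) \<in> G" if "(i, j) \<in> G" "(j, u) \<in> G" for i j using that transG by (auto dest: transD)
  have abM: "a < M" "b < M" using ab M by (auto simp: set_noise split: if_splits)
  have "Transposition.transpose a b ` {..<M} = {..<M}" using abM by simp
  hence mp: "map_pmf (Transposition.transpose a b) (pmf_of_set {..<M}) = pmf_of_set {..<M}"
    using map_pmf_of_set_inj[of "Transposition.transpose a b" "{..<M}"] M by (auto simp: lessThan_empty_iff)
  have "diagram_mor G (noise G u M) (noise G u M) f"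
    using mp tr by (auto simp: diagram_mor_def reduction_def noise_simps f_def)
  hence "diagram_aut G (noise G u M) f"
    unfolding diagram_aut_def by (intro conjI exI[of _ f]) (auto simp: f_def)
  moreover have "f i a = b" using ab M by (auto simp: f_def set_noise split: if_splits)
  ultimately show "\<exists>f. diagram_aut G (noise G u M) f \<and> f i a = b" by blast
qed

text \<open>Division with remainder by \<open>N\<close> turns a uniform number below
  \<open>M * N\<close> into a pair of independent uniform ones.\<close>

lemma noise_mult:
  assumes M: "M > 0" "N > 0"
  shows "entropy_dist G (noise G u (M * N)) (tensor (noise G u M) (noise G u N)) = 0"
proof (rule entropy_dist_eq_0)
  have MN: "M * N > 0" using M by simp
  show d: "is_diagram G (noise G u (M * N))" "is_diagram G (tensor (noise G u M) (noise G u N))"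
    by (intro is_diagram_tensor is_diagram_noise MN M)+
  have tr: "(i, u) \<in> G" if "(i, j) \<in> G" "(j, u) \<in> G" for i j using that transG by (auto dest: transD)
  let ?d = "\<lambda>c. prod_encode (c div N, c mod N)"
  have "map_pmf ?d (pmf_of_set {..<M * N}) = map_pmf prod_encode (map_pmf (\<lambda>c. (c div N, c mod N)) (pmf_of_set {..<M * N}))"
    by (simp add: pmf.map_comp o_def)
  also have "map_pmf (\<lambda>c. (c div N, c mod N)) (pmf_of_set {..<M * N}) = pmf_of_set ({..<M} \<times> {..<N})"
    using M by (intro map_pmf_of_set_bij_betw bij_betw_div_mod) (auto simp: lessThan_empty_iff)
  also have "\<dots> = pair_pmf (pmf_of_set {..<M}) (pmf_of_set {..<N})"
    using M by (subst pair_pmf_of_set) auto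
  finally have m: "map_pmf ?d (pmf_of_set {..<M * N}) = map_pmf prod_encode (pair_pmf (pmf_of_set {..<M}) (pmf_of_set {..<N}))" .
  show "diagram_mor G (noise G u (M * N)) (tensor (noise G u M) (noise G u N)) (\<lambda>i. if (i, u) \<in> G then ?d else (\<lambda>_. prod_encode (0, 0)))"
    using m tr by (auto simp: diagram_mor_def reduction_def tensor_def noise_simps map_pmf_const)
  fix i assume i: "i \<in> Field G"
  show "Ent (sp (noise G u (M * N)) i) \<le> Ent (sp (tensor (noise G u M) (noise G u N)) i)"
    using M MN is_diagram_finite[OF is_diagram_noise i] by (simp add: Ent_tensor Ent_noise ln_mult)
qed

text \<open>Doubling \<open>M\<close> adds one fair bit, and projecting it away loses at most
  \<open>ln 2\<close> at each object.\<close>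

lemma noise_double:
  assumes M: "M > 0"
  shows "entropy_dist G (noise G u M) (noise G u (2 * M)) \<le> card (Field G) * ln 2"
proof -
  note d = is_diagram_noise[of _ u]
  let ?T = "tensor (noise G u 2) (noise G u M)"
  have "entropy_dist G (noise G u M) (noise G u (2 * M)) \<le> entropy_dist G (noise G u M) ?T + entropy_dist G ?T (noise G u (2 * M))"
    using M by (intro entropy_dist_triangle d is_diagram_tensor) auto
  also have "\<dots> = entropy_dist G ?T (noise G u M)"
    using noise_mult[of 2 M u] M by (simp add: entropy_dist_commute)
  also have "\<dots> \<le> (\<Sum>i\<in>Field G. Ent (sp ?T i) - Ent (sp (noise G u M) i))"
    using M by (intro entropy_dist_le_mor[OF _ diagram_mor_snd] is_diagram_tensor d) auto
  also have "\<dots> \<le> (\<Sum>i\<in>Field G. ln 2)"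
  proof (rule sum_mono)
    fix i assume i: "i \<in> Field G"
    show "Ent (sp ?T i) - Ent (sp (noise G u M) i) \<le> ln 2"
      using M is_diagram_finite[OF d i] by (simp add: Ent_tensor Ent_noise)
  qed
  finally show ?thesis by simp
qed

text \<open>With powers of two as sizes the tensor product multiplies exactly, and the only defect
  is the rounding of the exponent: one bit at most.\<close>

lemma quasi_linear_noise:
  fixes c :: real
  assumes c: "c \<ge> 0"
  shows "quasi_linear G (\<lambda>n. noise G u (2 ^ nat \<lfloor>real n * c\<rfloor>))"
proof -
  let ?k = "\<lambda>n. nat \<lfloor>real n * c\<rfloor>" and ?C = "\<lambda>k. noise G u (2 ^ k)"
  note d = is_diagram_noise[of "2 ^ _" u, simplified]
  have "entropy_dist G (tensor (?C (?k m)) (?C (?k n))) (?C (?k (m + n))) \<le> (card (Field G) * ln 2 + 1) * real (m + n) powr (3/4)" for m n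
  proof -
    have kk: "?k (m + n) = ?k m + ?k n \<or> ?k (m + n) = Suc (?k m + ?k n)"
    proof -
      have "real m * c \<ge> 0" "real n * c \<ge> 0" using c by auto
      moreover have "real (m + n) * c = real m * c + real n * c" by (simp add: distrib_right)
      ultimately show ?thesis by linarith
    qed
    have k0: "?k (m + n) = ?k m + ?k n" if "m + n = 0" using that by simp
    have "entropy_dist G (tensor (?C (?k m)) (?C (?k n))) (?C (?k (m + n))) \<le>
      entropy_dist G (tensor (?C (?k m)) (?C (?k n))) (?C (?k m + ?k n)) + entropy_dist G (?C (?k m + ?k n)) (?C (?k (m + n)))"
      by (intro entropy_dist_triangle d is_diagram_tensor)
    also have "entropy_dist G (tensor (?C (?k m)) (?C (?k n))) (?C (?k m + ?k n)) = 0"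
      using noise_mult[of "2 ^ ?k m" "2 ^ ?k n" u] by (simp add: power_add entropy_dist_commute)
    also have "0 + entropy_dist G (?C (?k m + ?k n)) (?C (?k (m + n))) \<le> (card (Field G) * ln 2 + 1) * real (m + n) powr (3/4)"
    proof (cases "?k (m + n) = ?k m + ?k n")
      case True
      thus ?thesis by (simp add: entropy_dist_self[OF d])
    next
      case False
      hence "?k (m + n) = Suc (?k m + ?k n)" using kk by blast
      hence e: "entropy_dist G (?C (?k m + ?k n)) (?C (?k (m + n))) \<le> card (Field G) * ln 2"
        using noise_double[of "2 ^ (?k m + ?k n)" u] by simp
      have "m + n \<noteq> 0" using False k0 by blast
      hence "real (m + n) \<ge> 1" by linarith
      hence "real (m + n) powr (3/4) \<ge> 1" by (rule ge_one_powr_ge_zero) simp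
      hence "(card (Field G) * ln 2 + 1) * 1 \<le> (card (Field G) * ln 2 + 1) * real (m + n) powr (3/4)"
        by (intro mult_left_mono) auto
      thus ?thesis using e by simp
    qed
    finally show ?thesis .
  qed
  moreover have "0 < card (Field G) * ln 2 + (1::real)" by (intro add_nonneg_pos) auto
  ultimately show ?thesis unfolding quasi_linear_def using d by blast
qed

end

lemma floor_rate:
  fixes c :: real
  assumes "c \<ge> 0"
  shows "(\<lambda>n. real (nat \<lfloor>real n * c\<rfloor>) / real n) \<longlonglongrightarrow> c"
proof (rule LIM_zero_cancel, rule Lim_null_comparison)
  show "(\<lambda>n. 1 / real n) \<longlonglongrightarrow> 0" by (rule lim_const_over_n)
  show "\<forall>\<^sub>F n in sequentially. norm (real (nat \<lfloor>real n * c\<rfloor>) / real n - c) \<le> 1 / real n"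
  proof (rule eventually_sequentiallyI[of 1])
    fix n :: nat assume n: "n \<ge> 1"
    have "real n * c \<ge> 0" using assms by simp
    hence "\<bar>real (nat \<lfloor>real n * c\<rfloor>) - real n * c\<bar> \<le> 1" by linarith
    moreover have "real (nat \<lfloor>real n * c\<rfloor>) / real n - c = (real (nat \<lfloor>real n * c\<rfloor>) - real n * c) / real n"
      using n by (simp add: diff_divide_distrib)
    ultimately show "norm (real (nat \<lfloor>real n * c\<rfloor>) / real n - c) \<le> 1 / real n"
      using n by (simp add: divide_right_mono)
  qed
qed

section \<open>The noised diagram and its conditional diagram\<close>

locale noisy_extension = conditioning G z u for G :: "'i rel" and z u +
  fixes x :: 'i and l :: real
  assumes zx: "(z, x) \<in> G" and split: "\<And>i. i \<in> Field G \<Longrightarrow> ((x, i) \<in> G) \<noteq> ((i, u) \<in> G)" and l: "l > 0"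
begin

text \<open>\<open>l / ln 2\<close> bits per step are \<open>l\<close> in natural units.\<close>

definition noises :: "nat \<Rightarrow> 'i diagram" where
  "noises n = noise G u (2 ^ nat \<lfloor>real n * (l / ln 2)\<rfloor>)"

abbreviation noised :: "(nat \<Rightarrow> 'i diagram) \<Rightarrow> nat \<Rightarrow> 'i diagram" where
  "noised X \<equiv> (\<lambda>n. tensor (X n) (noises n))"

abbreviation "S \<equiv> descendants G x"
abbreviation "R \<equiv> Restr G S"

lemma xF: "x \<in> Field G"
  using zx by (auto simp: Field_def)

sublocale R: initial_index R x
  by (rule initial_index_Restr[OF xF])

lemma zu: "(z, u) \<in> G"
  by (rule z_to[OF u])

lemma quasi_linear_noises: "quasi_linear G noises"
  unfolding noises_def[abs_def] by (rule quasi_linear_noise) (use l in simp)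

lemma is_diagram_noises: "is_diagram G (noises n)"
  by (rule quasi_linear_diagram[OF quasi_linear_noises])

lemma homogeneous_noises: "homogeneous G (noises n)"
  unfolding noises_def by (rule homogeneous_noise) simp

lemma quasi_linear_noised: "quasi_linear G X \<Longrightarrow> quasi_linear G (noised X)"
  by (rule quasi_linear_tensor[OF _ quasi_linear_noises])

text \<open>Here admissibility enters: the objects of \<open>R\<close> descend from
  \<open>x\<close>, so the noise is trivial on all of them.\<close>

lemma not_ancestor: "i \<in> Field R \<Longrightarrow> (i, u) \<notin> G"
  using split[of i] by (auto simp: Field_Restr descendants_def)

text \<open>The projection to the first factor is a morphism without loss of entropy. It serves for
  the subdiagram itself and for its conditional version.\<close>

lemma Restr_tensor_trivial:
  assumes X: "quasi_linear R X" and Y: "\<And>n. is_diagram R (Y n)" and XY: "quasi_linear R (\<lambda>n. tensor (X n) (Y n))"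
    and 0: "\<And>n i. i \<in> Field R \<Longrightarrow> Ent (sp (Y n) i) = 0"
  shows "R.cls (\<lambda>n. tensor (X n) (Y n)) = R.cls X"
proof (rule R.cls_eq[OF XY X], rule R.asym_entropy_dist_eq_0[OF XY X])
  fix n
  note d = R.quasi_linear_diagram[OF X]
  show "entropy_dist R (tensor (X n) (Y n)) (X n) = 0"
  proof (rule R.entropy_dist_eq_0[OF is_diagram_tensor[OF d Y] d diagram_mor_fst])
    fix i assume i: "i \<in> Field R"
    show "Ent (sp (tensor (X n) (Y n)) i) \<le> Ent (sp (X n) i)"
      by (simp add: Ent_tensor is_diagram_finite[OF d i] is_diagram_finite[OF Y i] 0[OF i])
  qed
qed

lemma Ent_noises: "Ent (sp (noises n) i) = (if (i, u) \<in> G then real (nat \<lfloor>real n * (l / ln 2)\<rfloor>) * ln 2 else 0)"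
  unfolding noises_def by (simp add: Ent_noise ln_realpow)

lemma trop_sub_noised:
  assumes X: "quasi_linear G X"
  shows "trop_sub G S (cls (noised X)) = trop_sub G S (cls X)"
proof -
  note q = quasi_linear_noised[OF X]
  show ?thesis
    unfolding trop_sub_eq[OF xF cls_tropical[OF X] cls_self[OF X]] trop_sub_eq[OF xF cls_tropical[OF q] cls_self[OF q]]
    by (rule Restr_tensor_trivial)
      (auto intro: quasi_linear_Restr X q is_diagram_Restr is_diagram_noises simp: Ent_noises not_ancestor)
qed

text \<open>\<open>z\<close> is an ancestor of \<open>u\<close> and gains \<open>l\<close>;
  \<open>x\<close> is not, and gains nothing.\<close>

lemma trop_cond_ent_noised:
  assumes X: "quasi_linear G X"
  shows "trop_cond_ent (cls (noised X)) z x = trop_cond_ent (cls X) z x + l"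
proof -
  note q = quasi_linear_noised[OF X]
  have E: "Ent (sp (noised X n) i) / real n = Ent (sp (X n) i) / real n + Ent (sp (noises n) i) / real n" if "i \<in> Field G" for n i
    by (simp add: Ent_tensor is_diagram_finite[OF quasi_linear_diagram[OF X] that] is_diagram_finite[OF is_diagram_noises that] add_divide_distrib)
  have lim: "trop_ent (cls (noised X)) i = trop_ent (cls X) i + c"
    if i: "i \<in> Field G" and c: "(\<lambda>n. Ent (sp (noises n) i) / real n) \<longlonglongrightarrow> c" for i c
    using LIMSEQ_unique[OF trop_ent_lim[OF cls_tropical[OF q] cls_self[OF q] i, unfolded E[OF i]]
      tendsto_add[OF trop_ent_lim[OF cls_tropical[OF X] cls_self[OF X] i] c]] .
  have "(\<lambda>n. real (nat \<lfloor>real n * (l / ln 2)\<rfloor>) / real n * ln 2) \<longlonglongrightarrow> l / ln 2 * ln 2"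
    by (intro tendsto_mult tendsto_const floor_rate) (use l in simp)
  hence "(\<lambda>n. Ent (sp (noises n) z) / real n) \<longlonglongrightarrow> l" by (simp add: Ent_noises zu)
  from lim[OF z_field this] have "trop_ent (cls (noised X)) z = trop_ent (cls X) z + l" .
  moreover have "(x, u) \<notin> G" using split[OF xF] reflG[OF xF] by simp
  hence "(\<lambda>n. Ent (sp (noises n) x) / real n) \<longlonglongrightarrow> 0" by (simp add: Ent_noises)
  from lim[OF xF this] have "trop_ent (cls (noised X)) x = trop_ent (cls X) x + 0" .
  ultimately show ?thesis by (simp add: trop_cond_ent_def)
qed

text \<open>The noise reaches \<open>u\<close> by the identity map, so the images of an atom in the
  spaces at \<open>x\<close> and \<open>u\<close> together still determine its noise
  component.\<close>

lemma minimal_fan_noised: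
  assumes X: "is_diagram G X" and m: "minimal_fan (sp X z) (sp X x) (sp X u) (red X z x) (red X z u)"
  shows "minimal_fan (sp (tensor X (noises n)) z) (sp (tensor X (noises n)) x) (sp (tensor X (noises n)) u)
    (red (tensor X (noises n)) z x) (red (tensor X (noises n)) z u)"
proof -
  let ?T = "tensor X (noises n)"
  have T: "is_diagram G ?T" by (intro is_diagram_tensor X is_diagram_noises)
  have r: "reduction (sp Y z) (sp Y i) (red Y z i)" if "is_diagram G Y" "i \<in> Field G" for Y i
    using is_diagram_reduction[OF that(1) z_to[OF that(2)]] by (simp add: reduction_def)
  have inj: "inj_on (\<lambda>a. (red X z x a, red X z u a)) (set_pmf (sp X z))"
    using m minimal_fan_iff_inj[OF is_diagram_finite[OF X z_field] r[OF X xF] r[OF X u]] by blast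
  have red_u: "red (noises n) z u = id" using reflG[OF u] by (simp add: noises_def noise_simps)
  have "inj_on (\<lambda>a. (red ?T z x a, red ?T z u a)) (set_pmf (sp ?T z))"
    using inj by (auto simp: inj_on_def set_sp_tensor red_tensor red_u)
  thus ?thesis
    using minimal_fan_iff_inj[OF is_diagram_finite[OF T z_field] r[OF T xF] r[OF T u]] by blast
qed

text \<open>Tensoring a homogeneous representative with the same noise keeps it homogeneous and does
  not increase distances. Conditioning on the pair \<open>(a n, 0)\<close> splits into factors, and
  the noise factor is constant on the descendants of \<open>x\<close>.\<close>

lemma noised_homogeneous_class:
  assumes X: "quasi_linear G X" and T: "T \<in> tropical_homogeneous G"
  shows "\<exists>T'\<in>tropical_homogeneous G. trop_dist G T' (cls (noised X)) \<le> trop_dist G T (cls X) \<and>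
    hom_cond G S u T' = hom_cond G S u T"
proof -
  obtain Y where Y: "T \<in> tropical G" "Y \<in> T" "\<And>n. homogeneous G (Y n)"
    using T unfolding tropical_homogeneous_def by blast
  have qY: "quasi_linear G Y" by (rule tropical_quasi_linear[OF Y(1,2)])
  note d = quasi_linear_diagram[OF qY] is_diagram_noises quasi_linear_diagram[OF X]
  note q = quasi_linear_noised[OF qY] quasi_linear_noised[OF X]
  have h: "homogeneous G (noised Y n)" for n by (intro homogeneous_tensor Y homogeneous_noises)
  have "\<exists>W\<in>cls (noised Y). \<forall>n. homogeneous G (W n)"
    by (rule bexI[OF _ cls_self[OF q(1)]]) (rule allI, rule h)
  hence hom: "cls (noised Y) \<in> tropical_homogeneous G"
    unfolding tropical_homogeneous_def using cls_tropical[OF q(1)] by (intro CollectI conjI)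
  have dist: "trop_dist G (cls (noised Y)) (cls (noised X)) \<le> trop_dist G T (cls X)"
    unfolding trop_dist_cls[OF q] trop_dist_eq[OF Y(1,2) cls_tropical[OF X] cls_self[OF X]]
  proof (rule asym_entropy_dist_le[OF q _ asym_entropy_dist_lim[OF qY X]])
    fix n
    show "entropy_dist G (noised Y n) (noised X n) \<le> entropy_dist G (Y n) (X n)"
      using entropy_dist_tensor[OF d(1)[of n] d(3)[of n] d(2)[of n] d(2)[of n]] entropy_dist_self[OF d(2)[of n]] by linarith
  qed
  obtain a where a: "\<forall>n. a n \<in> set_pmf (sp (Y n) u)" and ca: "hom_cond G S u T = R.cls (\<lambda>n. cond_diagram G (Y n) u (a n))"
    using hom_cond_tropical[OF xF Y] by blast
  have b: "0 \<in> set_pmf (sp (noises n) u)" for n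
    using reflG[OF u] by (simp add: noises_def set_noise)
  have ab: "prod_encode (a n, 0) \<in> set_pmf (sp (noised Y n) u)" for n
    using a b by (auto simp: set_sp_tensor)
  have ct: "cond_diagram G (noised Y n) u (prod_encode (a n, 0)) = tensor (cond_diagram G (Y n) u (a n)) (cond_diagram G (noises n) u 0)" for n
    using a by (intro cond_tensor d b) blast
  have qc: "quasi_linear G (\<lambda>n. cond_diagram G (Y n) u (a n))"
    by (rule quasi_linear_cond[OF qY Y(3)]) (use a in blast)
  have qct: "quasi_linear G (\<lambda>n. tensor (cond_diagram G (Y n) u (a n)) (cond_diagram G (noises n) u 0))"
    using quasi_linear_cond[OF q(1) h ab] unfolding ct .
  have "hom_cond G S u (cls (noised Y)) = R.cls (\<lambda>n. tensor (cond_diagram G (Y n) u (a n)) (cond_diagram G (noises n) u 0))"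
    using hom_cond_eq[OF xF cls_tropical[OF q(1)] cls_self[OF q(1)] h ab] unfolding ct .
  also have "\<dots> = R.cls (\<lambda>n. cond_diagram G (Y n) u (a n))"
  proof (rule Restr_tensor_trivial[OF quasi_linear_Restr[OF qc] _ quasi_linear_Restr[OF qct]])
    show "is_diagram R (cond_diagram G (noises n) u 0)" for n
      by (intro is_diagram_Restr is_diagram_cond d b)
    fix n i assume i: "i \<in> Field R"
    have "red (noises n) z i = (\<lambda>_. 0)" using not_ancestor[OF i] by (simp add: noises_def noise_simps)
    thus "Ent (sp (cond_diagram G (noises n) u 0) i) = 0"
      by (simp add: cond_diagram_push map_pmf_const Ent_eq_ent)
  qed
  finally show ?thesis using hom dist ca by (intro bexI[OF _ hom]) auto
qed

text \<open>
  A homogeneous approximation of the noised class need not itself be noised. It is compared with the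
  noised version of a homogeneous approximation of the original class, which exists by density.
\<close>

lemma trop_cond_noised:
  assumes X: "quasi_linear G X"
  shows "trop_cond G S u (cls (noised X)) = trop_cond G S u (cls X)"
proof -
  let ?Z = "cls (noised X)" and ?Z' = "cls X"
  let ?P = "\<lambda>T C. \<forall>H. (\<forall>k. H k \<in> tropical_homogeneous G) \<and> (\<lambda>k. trop_dist G (H k) T) \<longlonglongrightarrow> 0 \<longrightarrow>
        (\<lambda>k. trop_dist R (hom_cond G S u (H k)) C) \<longlonglongrightarrow> 0"
  note tZ = cls_tropical[OF quasi_linear_noised[OF X]] and tZ' = cls_tropical[OF X]
  have ht: "T \<in> tropical G" if "T \<in> tropical_homogeneous G" for T
    using that by (simp add: tropical_homogeneous_def)
  have hc: "hom_cond G S u T \<in> tropical R" if T: "T \<in> tropical_homogeneous G" for T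
  proof -
    obtain Y where Y: "T \<in> tropical G" "Y \<in> T" "\<And>n. homogeneous G (Y n)"
      using T unfolding tropical_homogeneous_def by blast
    show ?thesis using hom_cond_tropical[OF xF Y] by blast
  qed
  \<comment> \<open>Homogeneous approximations of the old class are noised to approximations of the
    new one with the same conditionals.\<close>
  have lift: "\<exists>H'. (\<forall>k. H' k \<in> tropical_homogeneous G) \<and> (\<lambda>k. trop_dist G (H' k) ?Z) \<longlonglongrightarrow> 0 \<and>
      (\<forall>k. hom_cond G S u (H' k) = hom_cond G S u (H k))"
    if H: "\<forall>k. H k \<in> tropical_homogeneous G" "(\<lambda>k. trop_dist G (H k) ?Z') \<longlonglongrightarrow> 0" for H
  proof -
    have "\<forall>k. \<exists>T'. T' \<in> tropical_homogeneous G \<and> trop_dist G T' ?Z \<le> trop_dist G (H k) ?Z' \<and>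
      hom_cond G S u T' = hom_cond G S u (H k)"
      using noised_homogeneous_class[OF X H(1)[rule_format]] unfolding Bex_def by (rule allI)
    from choice[OF this] obtain H' where H': "\<forall>k. H' k \<in> tropical_homogeneous G \<and> trop_dist G (H' k) ?Z \<le> trop_dist G (H k) ?Z' \<and>
      hom_cond G S u (H' k) = hom_cond G S u (H k)" by blast
    have "(\<lambda>k. trop_dist G (H' k) ?Z) \<longlonglongrightarrow> 0"
      by (rule Lim_null_comparison[OF _ H(2)])
        (use H' trop_dist_nonneg[OF ht tZ] in \<open>auto intro!: always_eventually\<close>)
    thus ?thesis using H' by blast
  qed
  \<comment> \<open>The conditions on \<open>C\<close> for the two classes are equivalent, so both
    descriptions by \<open>THE\<close> denote the same class.\<close>
  have "?P ?Z C \<longleftrightarrow> ?P ?Z' C" if C: "C \<in> tropical R" for C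
  proof (intro iffI allI impI)
    fix H assume P: "?P ?Z C" and H: "(\<forall>k. H k \<in> tropical_homogeneous G) \<and> (\<lambda>k. trop_dist G (H k) ?Z') \<longlonglongrightarrow> 0"
    obtain H' where H': "\<forall>k. H' k \<in> tropical_homogeneous G" "(\<lambda>k. trop_dist G (H' k) ?Z) \<longlonglongrightarrow> 0"
      "\<forall>k. hom_cond G S u (H' k) = hom_cond G S u (H k)" using lift[OF H[THEN conjunct1] H[THEN conjunct2]] by blast
    have "(\<lambda>k. trop_dist R (hom_cond G S u (H' k)) C) \<longlonglongrightarrow> 0" by (rule P[THEN spec, THEN mp, OF conjI[OF H'(1,2)]])
    thus "(\<lambda>k. trop_dist R (hom_cond G S u (H k)) C) \<longlonglongrightarrow> 0" using H'(3) by simp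
  next
    fix H assume P: "?P ?Z' C" and "(\<forall>k. H k \<in> tropical_homogeneous G) \<and> (\<lambda>k. trop_dist G (H k) ?Z) \<longlonglongrightarrow> 0"
    hence H: "\<And>k. H k \<in> tropical_homogeneous G" "(\<lambda>k. trop_dist G (H k) ?Z) \<longlonglongrightarrow> 0" by auto
    \<comment> \<open>Density provides a homogeneous sequence \<open>K\<close> tending to the old
      class; its noised lift \<open>H'\<close> tends to the new class and has conditionals that tend
      to \<open>C\<close>.\<close>
    have "\<forall>k. \<exists>T. T \<in> tropical_homogeneous G \<and> trop_dist G T ?Z' < 1 / real (Suc k)"
    proof
      fix k
      have "1 / real (Suc k) > 0" by simp
      from homogeneous_dense[OF tZ' this]
      show "\<exists>T. T \<in> tropical_homogeneous G \<and> trop_dist G T ?Z' < 1 / real (Suc k)" by blast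
    qed
    from choice[OF this] obtain K where K: "\<forall>k. K k \<in> tropical_homogeneous G \<and> trop_dist G (K k) ?Z' < 1 / real (Suc k)" by blast
    have K1: "\<forall>k. K k \<in> tropical_homogeneous G" using K by simp
    have Klim: "(\<lambda>k. trop_dist G (K k) ?Z') \<longlonglongrightarrow> 0"
    proof (rule Lim_null_comparison)
      show "(\<lambda>k. 1 / real (Suc k)) \<longlonglongrightarrow> 0" by (rule LIMSEQ_Suc[OF lim_const_over_n])
      show "\<forall>\<^sub>F k in sequentially. norm (trop_dist G (K k) ?Z') \<le> 1 / real (Suc k)"
      proof (rule always_eventually, rule allI)
        fix k
        show "norm (trop_dist G (K k) ?Z') \<le> 1 / real (Suc k)"
          using K[rule_format, of k] trop_dist_nonneg[OF ht tZ', of "K k"] by simp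
      qed
    qed
    obtain H' where H': "\<forall>k. H' k \<in> tropical_homogeneous G" "(\<lambda>k. trop_dist G (H' k) ?Z) \<longlonglongrightarrow> 0"
      "\<forall>k. hom_cond G S u (H' k) = hom_cond G S u (K k)" using lift[OF K1 Klim] by blast
    have Kc: "(\<lambda>k. trop_dist R (hom_cond G S u (K k)) C) \<longlonglongrightarrow> 0" by (rule P[THEN spec, THEN mp, OF conjI[OF K1 Klim]])
    let ?c = "1 + 2 * real (card (Field G))"
    show "(\<lambda>k. trop_dist R (hom_cond G S u (H k)) C) \<longlonglongrightarrow> 0"
    proof (rule Lim_null_comparison)
      \<comment> \<open>Both \<open>H k\<close> and \<open>H' k\<close> approach the new class, so
        by the Lipschitz bound their conditionals approach each other.\<close>
      have "(\<lambda>k. ?c * (trop_dist G (H k) ?Z + trop_dist G (H' k) ?Z) + trop_dist R (hom_cond G S u (K k)) C) \<longlonglongrightarrow> ?c * (0 + 0) + 0"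
        by (intro tendsto_intros H(2) H'(2) Kc)
      thus "(\<lambda>k. ?c * (trop_dist G (H k) ?Z + trop_dist G (H' k) ?Z) + trop_dist R (hom_cond G S u (K k)) C) \<longlonglongrightarrow> 0" by simp
      show "\<forall>\<^sub>F k in sequentially. norm (trop_dist R (hom_cond G S u (H k)) C) \<le>
        ?c * (trop_dist G (H k) ?Z + trop_dist G (H' k) ?Z) + trop_dist R (hom_cond G S u (K k)) C"
      proof (rule always_eventually, rule allI)
        fix k
        note h = H(1)[of k] H'(1)[rule_format, of k] K[rule_format, of k, THEN conjunct1]
        have "trop_dist R (hom_cond G S u (H k)) C \<le> trop_dist R (hom_cond G S u (H k)) (hom_cond G S u (H' k))
           + trop_dist R (hom_cond G S u (H' k)) C"
          by (intro R.trop_dist_triangle hc h C)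
        hence t: "trop_dist R (hom_cond G S u (H k)) C \<le> trop_dist R (hom_cond G S u (H k)) (hom_cond G S u (H' k))
           + trop_dist R (hom_cond G S u (K k)) C" using H'(3) by simp
        have "trop_dist R (hom_cond G S u (H k)) (hom_cond G S u (H' k)) \<le> ?c * trop_dist G (H k) (H' k)"
          by (rule hom_cond_lipschitz[OF xF h(1,2)])
        also have "\<dots> \<le> ?c * (trop_dist G (H k) ?Z + trop_dist G ?Z (H' k))"
          by (intro mult_left_mono trop_dist_triangle ht h tZ) auto
        also have "trop_dist G ?Z (H' k) = trop_dist G (H' k) ?Z" by (intro trop_dist_commute ht h tZ)
        finally show "norm (trop_dist R (hom_cond G S u (H k)) C) \<le>
          ?c * (trop_dist G (H k) ?Z + trop_dist G (H' k) ?Z) + trop_dist R (hom_cond G S u (K k)) C"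
          using t R.trop_dist_nonneg[OF hc[OF h(1)] C] by simp
      qed
    qed
  qed
  hence "(\<lambda>C. C \<in> tropical R \<and> ?P ?Z C) = (\<lambda>C. C \<in> tropical R \<and> ?P ?Z' C)"
    by (intro ext conj_cong refl)
  thus ?thesis unfolding trop_cond_def by (rule arg_cong[where f=The])
qed

end

theorem theorem3p3:
  fixes G :: "'i rel" and Z' :: "'i tropical" and z x u :: 'i and l :: real
  assumes "indexing_category G"
    and "Z' \<in> tropical G"
    and "trop_admissible_fan G Z' z x u"
    and "trop_reduced_fan Z' z x"
    and "l > 0"
  shows "\<exists>Z\<in>tropical G.
    trop_sub G (descendants G x) Z = trop_sub G (descendants G x) Z' \<and>
    trop_admissible_fan G Z z x u \<and>
    trop_cond_ent Z z x = l \<and>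
    trop_cond G (descendants G x) u Z = trop_cond G (descendants G x) u Z'"
proof -
  have fan: "(z, x) \<in> G" "(z, u) \<in> G" "trop_minimal_fan Z' z x u" "initial G z"
    "\<forall>i\<in>Field G. ((x, i) \<in> G) \<noteq> ((i, u) \<in> G)"
    using assms(3) unfolding trop_admissible_fan_def by blast+
  interpret noisy_extension G z u x l
    using assms(1,5) fan by unfold_locales (auto simp: indexing_category_def Field_def)
  \<comment> \<open>A representative whose fan is minimal for every \<open>n\<close>; the noise
    preserves this term by term.\<close>
  obtain X where XZ: "X \<in> Z'" and m: "\<And>n. minimal_fan (sp (X n) z) (sp (X n) x) (sp (X n) u) (red (X n) z x) (red (X n) z u)"
    using fan(3) unfolding trop_minimal_fan_def by blast
  have X: "quasi_linear G X" by (rule tropical_quasi_linear[OF assms(2) XZ])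
  have Z': "Z' = cls X" by (rule tropical_cls[OF assms(2) XZ])
  note q = quasi_linear_noised[OF X]
  have "trop_minimal_fan (cls (noised X)) z x u"
    unfolding trop_minimal_fan_def
    by (rule bexI[OF _ cls_self[OF q]]) (intro allI minimal_fan_noised quasi_linear_diagram[OF X] m)
  hence "trop_admissible_fan G (cls (noised X)) z x u"
    using fan unfolding trop_admissible_fan_def by blast
  \<comment> \<open>The given fan is reduced, so the conditional entropy rises from 0 to
    \<open>l\<close>.\<close>
  moreover have "trop_cond_ent (cls (noised X)) z x = l"
    using trop_cond_ent_noised[OF X] assms(4) by (simp add: trop_reduced_fan_def Z')
  ultimately show ?thesis
    using cls_tropical[OF q] trop_sub_noised[OF X] trop_cond_noised[OF X] unfolding Z' by blast
qed

end
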